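(* Let $R$ be a commutative ring with unit and let $\mathcal{A}$ be a homologically connective dg category over $R$. Given any two objects of the category $\mathrm{Post}(\mathcal{A})$ of Postnikov towers for $\mathcal{A}$, there exists a zig-zag of weak equivalences in $\mathrm{Post}(\mathcal{A})$ relating the two.
   Context: Complexes are complexes of $R$-modules with homological grading (the differential lowers degree). $\mathrm{dgcat}$ is the category of small dg categories over $R$. For a dg category $\mathcal{A}$, $\mathsf{H}_0(\mathcal{A})$ is the category with the same objects and morphisms $\mathsf{H}_0(\mathcal{A}(x,y))$. A dg functor $F:\mathcal{A}\to\mathcal{B}$ is a quasi-equivalence if each $F(x,y):\mathcal{A}(x,y)\to\mathcal{B}(Fx,Fy)$ is a quasi-isomorphism and $\mathsf{H}_0(F)$ is an equivalence of categories. A small dg category $\mathcal{A}$ is homologically connective if $\mathsf{H}_i(\mathcal{A}(x,y))=0$ for all objects $x,y$ and all $i<0$; it is positively graded if $\mathcal{A}(x,y)_i=0$ for all $x,y$ and all $i<0$. $\tau_{\geq 0}(\mathcal{A})$ denotes the positively graded dg category with the same objects obtained by applying the intelligent truncation (degree $0$ cycles in degree $0$, unchanged in degrees $>0$, zero in degrees $<0$) to each complex of morphisms. A Postnikov tower $(\mathcal{A}_n)_{n\geq 0}$ for a positively graded dg category $\mathcal{A}$ is a commutative diagram in $\mathrm{dgcat}$ consisting of dg functors $\cdots\to\mathcal{A}_2\to\mathcal{A}_1\to\mathcal{A}_0$ and dg functors $P_n:\mathcal{A}\to\mathcal{A}_n$ ($n\ge 0$) compatible with them, such that for all $n\geq 0$: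 (A1) for all objects $x,y\in\mathcal{A}$ the induced map $\mathsf{H}_i(\mathcal{A}(x,y))\to\mathsf{H}_i(\mathcal{A}_n(P_nx,P_ny))$ is an isomorphism for $i\leq n$; (A2) $P_n$ induces an equivalence of categories $\mathsf{H}_0(\mathcal{A})\to\mathsf{H}_0(\mathcal{A}_n)$; (B) for all objects $x,y\in\mathcal{A}_n$, $\mathsf{H}_i(\mathcal{A}_n(x,y))=0$ for $i>n$. For a homologically connective $\mathcal{A}$, a Postnikov tower for $\mathcal{A}$ means a Postnikov tower for $\tau_{\geq 0}(\mathcal{A})$. A morphism $M:(\mathcal{A}_n)_{n\geq 0}\to(\mathcal{A}'_n)_{n\geq 0}$ of Postnikov towers for $\mathcal{A}$ is a family of dg functors $M_n:\mathcal{A}_n\to\mathcal{A}'_n$ commuting with the tower maps and with the maps from $\mathcal{A}$ (respectively $\tau_{\ge 0}(\mathcal{A})$). $\mathrm{Post}(\mathcal{A})$ is the resulting category. A weak equivalence in $\mathrm{Post}(\mathcal{A})$ is a morphism $M$ all of whose components $M_n$ are quasi-equivalences. *)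

theory Defs
  imports "HOL-Algebra.Module" "HOL-Algebra.AbelCoset"
begin

section \<open>Linear maps and complexes of modules\<close>

definition mod_hom ::
  "('r, 's) ring_scheme \<Rightarrow> ('r, 'a, 't) module_scheme \<Rightarrow> ('r, 'b, 'u) module_scheme \<Rightarrow> ('a \<Rightarrow> 'b) set"
  where "mod_hom R M N = {f. f \<in> carrier M \<rightarrow> carrier N \<and>
    (\<forall>x\<in>carrier M. \<forall>y\<in>carrier M. f (x \<oplus>\<^bsub>M\<^esub> y) = f x \<oplus>\<^bsub>N\<^esub> f y) \<and>
    (\<forall>r\<in>carrier R. \<forall>x\<in>carrier M. f (r \<odot>\<^bsub>M\<^esub> x) = r \<odot>\<^bsub>N\<^esub> f x)}"

definition mod_iso ::
  "('r, 's) ring_scheme \<Rightarrow> ('r, 'a, 't) module_scheme \<Rightarrow> ('r, 'b, 'u) module_scheme \<Rightarrow> ('a \<Rightarrow> 'b) set"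
  where "mod_iso R M N = {f \<in> mod_hom R M N. bij_betw f (carrier M) (carrier N)}"

text \<open>Complexes are unbounded, graded by \<^typ>\<open>int\<close>; the differential
  \<open>bdry C i\<close> goes from degree \<open>i\<close> to degree \<open>i - 1\<close>.\<close>

record ('r, 'm) cplx =
  chains :: "int \<Rightarrow> ('r, 'm) module"
  bdry :: "int \<Rightarrow> 'm \<Rightarrow> 'm"

locale chain_complex = R?: cring R
  for R :: "('r, 's) ring_scheme" (structure) and C :: "('r, 'm) cplx" +
  assumes chains_module: "\<And>i. module R (chains C i)"
    and bdry_hom: "\<And>i. bdry C i \<in> mod_hom R (chains C i) (chains C (i - 1))"
    and bdry_bdry: "\<And>i x. x \<in> carrier (chains C i) \<Longrightarrow>
          bdry C (i - 1) (bdry C i x) = \<zero>\<^bsub>chains C (i - 2)\<^esub>"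

definition cycles :: "('r, 'm) cplx \<Rightarrow> int \<Rightarrow> 'm set"
  where "cycles C i = {x \<in> carrier (chains C i). bdry C i x = \<zero>\<^bsub>chains C (i - 1)\<^esub>}"

definition boundaries :: "('r, 'm) cplx \<Rightarrow> int \<Rightarrow> 'm set"
  where "boundaries C i = bdry C (i + 1) ` carrier (chains C (i + 1))"

definition hclass :: "('r, 'm) cplx \<Rightarrow> int \<Rightarrow> 'm \<Rightarrow> 'm set"
  where "hclass C i x = boundaries C i +>\<^bsub>chains C i\<^esub> x"

text \<open>The quotient module of cycles modulo boundaries.  The library's module record extends the
  ring record; the fields \<open>mult\<close> and \<open>one\<close> play no role for modules.\<close>

definition homology :: "('r, 'm) cplx \<Rightarrow> int \<Rightarrow> ('r, 'm set) module"
  where "homology C i =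
    \<lparr>carrier = hclass C i ` cycles C i,
     mult = undefined,
     one = undefined,
     zero = boundaries C i,
     add = set_add (chains C i),
     smult = (\<lambda>r X. \<Union>x\<in>X. hclass C i (r \<odot>\<^bsub>chains C i\<^esub> x))\<rparr>"

definition homology_zero :: "('r, 'm) cplx \<Rightarrow> int \<Rightarrow> bool"
  where "homology_zero C i \<longleftrightarrow> carrier (homology C i) = {\<zero>\<^bsub>homology C i\<^esub>}"

text \<open>For a chain map \<open>f\<close> all the classes in the union below coincide, so the class of \<open>x\<close> is sent
  to the class of \<open>f i x\<close>.\<close>

definition homology_map :: "('r, 'n) cplx \<Rightarrow> (int \<Rightarrow> 'm \<Rightarrow> 'n) \<Rightarrow> int \<Rightarrow> 'm set \<Rightarrow> 'n set"
  where "homology_map D f i X = (\<Union>x\<in>X. hclass D i (f i x))"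

definition homology_iso_at ::
  "('r, 's) ring_scheme \<Rightarrow> ('r, 'm) cplx \<Rightarrow> ('r, 'n) cplx \<Rightarrow> (int \<Rightarrow> 'm \<Rightarrow> 'n) \<Rightarrow> int \<Rightarrow> bool"
  where "homology_iso_at R C D f i \<longleftrightarrow>
    homology_map D f i \<in> mod_iso R (homology C i) (homology D i)"

definition chain_map ::
  "('r, 's) ring_scheme \<Rightarrow> ('r, 'm) cplx \<Rightarrow> ('r, 'n) cplx \<Rightarrow> (int \<Rightarrow> 'm \<Rightarrow> 'n) \<Rightarrow> bool"
  where "chain_map R C D f \<longleftrightarrow>
    (\<forall>i. f i \<in> mod_hom R (chains C i) (chains D i)) \<and>
    (\<forall>i. \<forall>x\<in>carrier (chains C i). f (i - 1) (bdry C i x) = bdry D i (f i x))"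

definition quasi_isomorphism ::
  "('r, 's) ring_scheme \<Rightarrow> ('r, 'm) cplx \<Rightarrow> ('r, 'n) cplx \<Rightarrow> (int \<Rightarrow> 'm \<Rightarrow> 'n) \<Rightarrow> bool"
  where "quasi_isomorphism R C D f \<longleftrightarrow> chain_map R C D f \<and> (\<forall>i. homology_iso_at R C D f i)"

definition good_truncation :: "('r, 'm) cplx \<Rightarrow> ('r, 'm) cplx"
  where "good_truncation C = C\<lparr>chains := (\<lambda>i.
    if i > 0 then chains C i
    else if i = 0 then (chains C 0)\<lparr>carrier := cycles C 0\<rparr>
    else (chains C i)\<lparr>carrier := {\<zero>\<^bsub>chains C i\<^esub>}\<rparr>)\<rparr>"


section \<open>Categories, functors, equivalences\<close>

text \<open>Composition is written in the usual order: \<open>cmp C x y z g f\<close> is \<open>g\<close> after \<open>f\<close>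
  for \<open>f : x \<rightarrow> y\<close> and \<open>g : y \<rightarrow> z\<close>.\<close>

record ('o, 'a) cat =
  obs :: "'o set"
  arr :: "'o \<Rightarrow> 'o \<Rightarrow> 'a set"
  cmp :: "'o \<Rightarrow> 'o \<Rightarrow> 'o \<Rightarrow> 'a \<Rightarrow> 'a \<Rightarrow> 'a"
  idt :: "'o \<Rightarrow> 'a"

locale small_category =
  fixes C :: "('o, 'a) cat"
  assumes cmp_closed: "\<And>x y z g f. \<lbrakk>x \<in> obs C; y \<in> obs C; z \<in> obs C; g \<in> arr C y z; f \<in> arr C x y\<rbrakk>
        \<Longrightarrow> cmp C x y z g f \<in> arr C x z"
    and idt_closed: "\<And>x. x \<in> obs C \<Longrightarrow> idt C x \<in> arr C x x"
    and cmp_assoc: "\<And>w x y z h g f. \<lbrakk>w \<in> obs C; x \<in> obs C; y \<in> obs C; z \<in> obs C;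
        h \<in> arr C y z; g \<in> arr C x y; f \<in> arr C w x\<rbrakk>
        \<Longrightarrow> cmp C w y z h (cmp C w x y g f) = cmp C w x z (cmp C x y z h g) f"
    and cmp_idt_right: "\<And>x y f. \<lbrakk>x \<in> obs C; y \<in> obs C; f \<in> arr C x y\<rbrakk> \<Longrightarrow> cmp C x x y f (idt C x) = f"
    and cmp_idt_left: "\<And>x y f. \<lbrakk>x \<in> obs C; y \<in> obs C; f \<in> arr C x y\<rbrakk> \<Longrightarrow> cmp C x y y (idt C y) f = f"

record ('o, 'a, 'p, 'b) cat_functor =
  fob :: "'o \<Rightarrow> 'p"
  far :: "'o \<Rightarrow> 'o \<Rightarrow> 'a \<Rightarrow> 'b"

definition is_functor :: "('o, 'a) cat \<Rightarrow> ('p, 'b) cat \<Rightarrow> ('o, 'a, 'p, 'b) cat_functor \<Rightarrow> bool"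
  where "is_functor C D F \<longleftrightarrow>
    (\<forall>x\<in>obs C. fob F x \<in> obs D) \<and>
    (\<forall>x\<in>obs C. \<forall>y\<in>obs C. far F x y \<in> arr C x y \<rightarrow> arr D (fob F x) (fob F y)) \<and>
    (\<forall>x\<in>obs C. \<forall>y\<in>obs C. \<forall>z\<in>obs C. \<forall>g\<in>arr C y z. \<forall>f\<in>arr C x y.
      far F x z (cmp C x y z g f) =
        cmp D (fob F x) (fob F y) (fob F z) (far F y z g) (far F x y f)) \<and>
    (\<forall>x\<in>obs C. far F x x (idt C x) = idt D (fob F x))"

definition id_functor :: "('o, 'a, 'o, 'a) cat_functor"
  where "id_functor = \<lparr>fob = (\<lambda>x. x), far = (\<lambda>x y f. f)\<rparr>"

definition comp_functor ::
  "('p, 'b, 'q, 'c) cat_functor \<Rightarrow> ('o, 'a, 'p, 'b) cat_functor \<Rightarrow> ('o, 'a, 'q, 'c) cat_functor"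
  where "comp_functor G F =
    \<lparr>fob = (\<lambda>x. fob G (fob F x)),
     far = (\<lambda>x y f. far G (fob F x) (fob F y) (far F x y f))\<rparr>"

definition isomorphism_in :: "('o, 'a) cat \<Rightarrow> 'o \<Rightarrow> 'o \<Rightarrow> 'a \<Rightarrow> bool"
  where "isomorphism_in C x y f \<longleftrightarrow> f \<in> arr C x y \<and>
    (\<exists>g\<in>arr C y x. cmp C x y x g f = idt C x \<and> cmp C y x y f g = idt C y)"

definition naturally_isomorphic ::
  "('o, 'a) cat \<Rightarrow> ('p, 'b) cat \<Rightarrow> ('o, 'a, 'p, 'b) cat_functor \<Rightarrow> ('o, 'a, 'p, 'b) cat_functor \<Rightarrow> bool"
  where "naturally_isomorphic C D F G \<longleftrightarrow> (\<exists>\<eta>.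
    (\<forall>x\<in>obs C. isomorphism_in D (fob F x) (fob G x) (\<eta> x)) \<and>
    (\<forall>x\<in>obs C. \<forall>y\<in>obs C. \<forall>f\<in>arr C x y.
      cmp D (fob F x) (fob F y) (fob G y) (\<eta> y) (far F x y f) =
      cmp D (fob F x) (fob G x) (fob G y) (far G x y f) (\<eta> x)))"

definition equivalence_of_categories ::
  "('o, 'a) cat \<Rightarrow> ('p, 'b) cat \<Rightarrow> ('o, 'a, 'p, 'b) cat_functor \<Rightarrow> bool"
  where "equivalence_of_categories C D F \<longleftrightarrow> is_functor C D F \<and> (\<exists>G. is_functor D C G \<and>
    naturally_isomorphic C C (comp_functor G F) id_functor \<and>
    naturally_isomorphic D D (comp_functor F G) id_functor)"


section \<open>Small dg categories and dg functors\<close>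

text \<open>\<open>Hom A x y\<close> is the complex of morphisms from \<open>x\<close> to \<open>y\<close>.  \<open>Cmp A x y z p q g f\<close> is the composite
  of \<open>g\<close>, of degree \<open>p\<close> from \<open>y\<close> to \<open>z\<close>, after \<open>f\<close>, of degree \<open>q\<close> from \<open>x\<close> to \<open>y\<close>.
  Smallness is relative to the types \<open>'o\<close> of objects and \<open>'m\<close> of morphisms.\<close>

record ('o, 'r, 'm) dgcat =
  Obj :: "'o set"
  Hom :: "'o \<Rightarrow> 'o \<Rightarrow> ('r, 'm) cplx"
  Cmp :: "'o \<Rightarrow> 'o \<Rightarrow> 'o \<Rightarrow> int \<Rightarrow> int \<Rightarrow> 'm \<Rightarrow> 'm \<Rightarrow> 'm"
  Idt :: "'o \<Rightarrow> 'm"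

abbreviation HomD :: "('o, 'r, 'm) dgcat \<Rightarrow> 'o \<Rightarrow> 'o \<Rightarrow> int \<Rightarrow> ('r, 'm) module"
  where "HomD A x y i \<equiv> chains (Hom A x y) i"

abbreviation dif :: "('o, 'r, 'm) dgcat \<Rightarrow> 'o \<Rightarrow> 'o \<Rightarrow> int \<Rightarrow> 'm \<Rightarrow> 'm"
  where "dif A x y i \<equiv> bdry (Hom A x y) i"

definition koszul :: "('r, 'm, 's) module_scheme \<Rightarrow> int \<Rightarrow> 'm \<Rightarrow> 'm"
  where "koszul M p x = (if even p then x else \<ominus>\<^bsub>M\<^esub> x)"

text \<open>Bilinearity together with the graded Leibniz rule says that composition is a chain map
  from the tensor product of the complexes \<open>Hom A y z\<close> and \<open>Hom A x y\<close> over \<open>R\<close> to \<open>Hom A x z\<close>.\<close>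

locale dg_category = R?: cring R
  for R :: "('r, 's) ring_scheme" (structure) and A :: "('o, 'r, 'm) dgcat" +
  assumes Hom_complex: "\<And>x y. \<lbrakk>x \<in> Obj A; y \<in> Obj A\<rbrakk> \<Longrightarrow> chain_complex R (Hom A x y)"
    and Cmp_linear_left: "\<And>x y z p q f. \<lbrakk>x \<in> Obj A; y \<in> Obj A; z \<in> Obj A; f \<in> carrier (HomD A x y q)\<rbrakk>
        \<Longrightarrow> (\<lambda>g. Cmp A x y z p q g f) \<in> mod_hom R (HomD A y z p) (HomD A x z (p + q))"
    and Cmp_linear_right: "\<And>x y z p q g. \<lbrakk>x \<in> Obj A; y \<in> Obj A; z \<in> Obj A; g \<in> carrier (HomD A y z p)\<rbrakk>
        \<Longrightarrow> (\<lambda>f. Cmp A x y z p q g f) \<in> mod_hom R (HomD A x y q) (HomD A x z (p + q))"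
    and Leibniz: "\<And>x y z p q g f. \<lbrakk>x \<in> Obj A; y \<in> Obj A; z \<in> Obj A;
          g \<in> carrier (HomD A y z p); f \<in> carrier (HomD A x y q)\<rbrakk>
        \<Longrightarrow> dif A x z (p + q) (Cmp A x y z p q g f) =
            Cmp A x y z (p - 1) q (dif A y z p g) f \<oplus>\<^bsub>HomD A x z (p + q - 1)\<^esub>
            koszul (HomD A x z (p + q - 1)) p (Cmp A x y z p (q - 1) g (dif A x y q f))"
    and Cmp_assoc: "\<And>w x y z p q r h g f. \<lbrakk>w \<in> Obj A; x \<in> Obj A; y \<in> Obj A; z \<in> Obj A;
          h \<in> carrier (HomD A y z p); g \<in> carrier (HomD A x y q); f \<in> carrier (HomD A w x r)\<rbrakk>
        \<Longrightarrow> Cmp A w y z p (q + r) h (Cmp A w x y q r g f) =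
            Cmp A w x z (p + q) r (Cmp A x y z p q h g) f"
    and Idt_cycle: "\<And>x. x \<in> Obj A \<Longrightarrow> Idt A x \<in> cycles (Hom A x x) 0"
    and Cmp_Idt_right: "\<And>x y p f. \<lbrakk>x \<in> Obj A; y \<in> Obj A; f \<in> carrier (HomD A x y p)\<rbrakk>
        \<Longrightarrow> Cmp A x x y p 0 f (Idt A x) = f"
    and Cmp_Idt_left: "\<And>x y p f. \<lbrakk>x \<in> Obj A; y \<in> Obj A; f \<in> carrier (HomD A x y p)\<rbrakk>
        \<Longrightarrow> Cmp A x y y 0 p (Idt A y) f = f"

record ('o, 'm, 'p, 'n) dgfun =
  onObj :: "'o \<Rightarrow> 'p"
  onHom :: "'o \<Rightarrow> 'o \<Rightarrow> int \<Rightarrow> 'm \<Rightarrow> 'n"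

definition dg_functor ::
  "('r, 's) ring_scheme \<Rightarrow> ('o, 'r, 'm) dgcat \<Rightarrow> ('p, 'r, 'n) dgcat \<Rightarrow> ('o, 'm, 'p, 'n) dgfun \<Rightarrow> bool"
  where "dg_functor R A B F \<longleftrightarrow>
    (\<forall>x\<in>Obj A. onObj F x \<in> Obj B) \<and>
    (\<forall>x\<in>Obj A. \<forall>y\<in>Obj A. chain_map R (Hom A x y) (Hom B (onObj F x) (onObj F y)) (onHom F x y)) \<and>
    (\<forall>x\<in>Obj A. \<forall>y\<in>Obj A. \<forall>z\<in>Obj A. \<forall>p q.
      \<forall>g\<in>carrier (HomD A y z p). \<forall>f\<in>carrier (HomD A x y q).
      onHom F x z (p + q) (Cmp A x y z p q g f) =
        Cmp B (onObj F x) (onObj F y) (onObj F z) p q (onHom F y z p g) (onHom F x y q f)) \<and>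
    (\<forall>x\<in>Obj A. onHom F x x 0 (Idt A x) = Idt B (onObj F x))"

definition dg_compose ::
  "('p, 'n, 'q, 'k) dgfun \<Rightarrow> ('o, 'm, 'p, 'n) dgfun \<Rightarrow> ('o, 'm, 'q, 'k) dgfun"
  where "dg_compose G F =
    \<lparr>onObj = (\<lambda>x. onObj G (onObj F x)),
     onHom = (\<lambda>x y i f. onHom G (onObj F x) (onObj F y) i (onHom F x y i f))\<rparr>"

text \<open>Equality of dg functors out of \<open>A\<close>: the underlying HOL functions may differ outside the
  objects and morphisms of \<open>A\<close>.\<close>

definition dgfun_eq ::
  "('o, 'r, 'm) dgcat \<Rightarrow> ('o, 'm, 'p, 'n) dgfun \<Rightarrow> ('o, 'm, 'p, 'n) dgfun \<Rightarrow> bool"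
  where "dgfun_eq A F G \<longleftrightarrow>
    (\<forall>x\<in>Obj A. onObj F x = onObj G x) \<and>
    (\<forall>x\<in>Obj A. \<forall>y\<in>Obj A. \<forall>i. \<forall>f\<in>carrier (HomD A x y i). onHom F x y i f = onHom G x y i f)"

text \<open>The unions over representatives below are, as in \<^const>\<open>homology_map\<close>, unions of equal classes.\<close>

definition H0_cat :: "('o, 'r, 'm) dgcat \<Rightarrow> ('o, 'm set) cat"
  where "H0_cat A =
    \<lparr>obs = Obj A,
     arr = (\<lambda>x y. carrier (homology (Hom A x y) 0)),
     cmp = (\<lambda>x y z G F. \<Union>g\<in>G. \<Union>f\<in>F. hclass (Hom A x z) 0 (Cmp A x y z 0 0 g f)),
     idt = (\<lambda>x. hclass (Hom A x x) 0 (Idt A x))\<rparr>"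

definition H0_functor ::
  "('p, 'r, 'n) dgcat \<Rightarrow> ('o, 'm, 'p, 'n) dgfun \<Rightarrow> ('o, 'm set, 'p, 'n set) cat_functor"
  where "H0_functor B F =
    \<lparr>fob = onObj F,
     far = (\<lambda>x y. homology_map (Hom B (onObj F x) (onObj F y)) (onHom F x y) 0)\<rparr>"

definition quasi_equivalence ::
  "('r, 's) ring_scheme \<Rightarrow> ('o, 'r, 'm) dgcat \<Rightarrow> ('p, 'r, 'n) dgcat \<Rightarrow> ('o, 'm, 'p, 'n) dgfun \<Rightarrow> bool"
  where "quasi_equivalence R A B F \<longleftrightarrow> dg_functor R A B F \<and>
    (\<forall>x\<in>Obj A. \<forall>y\<in>Obj A.
      quasi_isomorphism R (Hom A x y) (Hom B (onObj F x) (onObj F y)) (onHom F x y)) \<and>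
    equivalence_of_categories (H0_cat A) (H0_cat B) (H0_functor B F)"

definition homologically_connective :: "('o, 'r, 'm) dgcat \<Rightarrow> bool"
  where "homologically_connective A \<longleftrightarrow>
    (\<forall>x\<in>Obj A. \<forall>y\<in>Obj A. \<forall>i<0. homology_zero (Hom A x y) i)"

definition positively_graded :: "('o, 'r, 'm) dgcat \<Rightarrow> bool"
  where "positively_graded A \<longleftrightarrow>
    (\<forall>x\<in>Obj A. \<forall>y\<in>Obj A. \<forall>i<0. carrier (HomD A x y i) = {\<zero>\<^bsub>HomD A x y i\<^esub>})"

definition tau_ge0 :: "('o, 'r, 'm) dgcat \<Rightarrow> ('o, 'r, 'm) dgcat"
  where "tau_ge0 A = A\<lparr>Hom := (\<lambda>x y. good_truncation (Hom A x y))\<rparr>"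

lemma positively_graded_tau_ge0: "positively_graded (tau_ge0 A)"
  by (auto simp: positively_graded_def tau_ge0_def good_truncation_def)


section \<open>Postnikov towers\<close>

text \<open>\<open>tmap T n\<close> goes from level \<open>n + 1\<close> to level \<open>n\<close>, and \<open>tproj T n\<close> from the dg category to
  level \<open>n\<close>.  All dg categories in sight live over the same types \<open>'o\<close> and \<open>'m\<close>, i.e. they are
  objects of one category of small dg categories.\<close>

record ('o, 'r, 'm) tower =
  level :: "nat \<Rightarrow> ('o, 'r, 'm) dgcat"
  tmap :: "nat \<Rightarrow> ('o, 'm, 'o, 'm) dgfun"
  tproj :: "nat \<Rightarrow> ('o, 'm, 'o, 'm) dgfun"

definition postnikov_tower ::
  "('r, 's) ring_scheme \<Rightarrow> ('o, 'r, 'm) dgcat \<Rightarrow> ('o, 'r, 'm) tower \<Rightarrow> bool"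
  where "postnikov_tower R A T \<longleftrightarrow>
    (\<forall>n. dg_category R (level T n)) \<and>
    (\<forall>n. dg_functor R (level T (Suc n)) (level T n) (tmap T n)) \<and>
    (\<forall>n. dg_functor R A (level T n) (tproj T n)) \<and>
    (\<forall>n. dgfun_eq A (dg_compose (tmap T n) (tproj T (Suc n))) (tproj T n)) \<and>
    (\<forall>n. \<forall>x\<in>Obj A. \<forall>y\<in>Obj A. \<forall>i\<le>int n.
      homology_iso_at R (Hom A x y)
        (Hom (level T n) (onObj (tproj T n) x) (onObj (tproj T n) y)) (onHom (tproj T n) x y) i) \<and>
    (\<forall>n. equivalence_of_categories (H0_cat A) (H0_cat (level T n))
      (H0_functor (level T n) (tproj T n))) \<and>
    (\<forall>n. \<forall>x\<in>Obj (level T n). \<forall>y\<in>Obj (level T n). \<forall>i>int n.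
      homology_zero (Hom (level T n) x y) i)"

definition tower_morphism ::
  "('r, 's) ring_scheme \<Rightarrow> ('o, 'r, 'm) dgcat \<Rightarrow> ('o, 'r, 'm) tower \<Rightarrow> ('o, 'r, 'm) tower \<Rightarrow>
   (nat \<Rightarrow> ('o, 'm, 'o, 'm) dgfun) \<Rightarrow> bool"
  where "tower_morphism R A S T M \<longleftrightarrow>
    (\<forall>n. dg_functor R (level S n) (level T n) (M n)) \<and>
    (\<forall>n. dgfun_eq (level S (Suc n))
      (dg_compose (M n) (tmap S n)) (dg_compose (tmap T n) (M (Suc n)))) \<and>
    (\<forall>n. dgfun_eq A (dg_compose (M n) (tproj S n)) (tproj T n))"

text \<open>For a homologically connective \<open>A\<close>, a Postnikov tower for \<open>A\<close> is by convention one for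
  \<^term>\<open>tau_ge0 A\<close>.\<close>

definition Post :: "('r, 's) ring_scheme \<Rightarrow> ('o, 'r, 'm) dgcat \<Rightarrow> ('o, 'r, 'm) tower set"
  where "Post R A = {T. postnikov_tower R (tau_ge0 A) T}"

definition Post_hom ::
  "('r, 's) ring_scheme \<Rightarrow> ('o, 'r, 'm) dgcat \<Rightarrow> ('o, 'r, 'm) tower \<Rightarrow> ('o, 'r, 'm) tower \<Rightarrow>
   (nat \<Rightarrow> ('o, 'm, 'o, 'm) dgfun) set"
  where "Post_hom R A S T =
    {M. S \<in> Post R A \<and> T \<in> Post R A \<and> tower_morphism R (tau_ge0 A) S T M}"

definition Post_weq ::
  "('r, 's) ring_scheme \<Rightarrow> ('o, 'r, 'm) dgcat \<Rightarrow> ('o, 'r, 'm) tower \<Rightarrow> ('o, 'r, 'm) tower \<Rightarrow>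
   (nat \<Rightarrow> ('o, 'm, 'o, 'm) dgfun) set"
  where "Post_weq R A S T =
    {M \<in> Post_hom R A S T. \<forall>n. quasi_equivalence R (level S n) (level T n) (M n)}"

text \<open>\<^const>\<open>equivclp\<close> is the reflexive-transitive closure of the symmetric closure: its instances
  are finite chains of weak equivalences pointing in either direction, all of whose intermediate
  objects are Postnikov towers for \<open>A\<close>.\<close>

definition Post_zigzag ::
  "('r, 's) ring_scheme \<Rightarrow> ('o, 'r, 'm) dgcat \<Rightarrow> ('o, 'r, 'm) tower \<Rightarrow> ('o, 'r, 'm) tower \<Rightarrow> bool"
  where "Post_zigzag R A = equivclp (\<lambda>S T. Post_weq R A S T \<noteq> {})"

end

theory Submission
  imports Defs
begin

text \<open>Every Postnikov tower \<open>T\<close> for \<open>B = \<tau>\<^sub>\<ge>\<^sub>0 A\<close> is related to the canonical tower \<open>(\<tau>\<^sub>\<le>\<^sub>n B)\<^sub>n\<close> by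
  the zig-zag \<open>T\<^sub>n \<leftarrow> \<tau>\<^sub>\<ge>\<^sub>0 T\<^sub>n \<rightarrow> \<tau>\<^sub>\<le>\<^sub>n \<tau>\<^sub>\<ge>\<^sub>0 T\<^sub>n \<leftarrow> \<tau>\<^sub>\<le>\<^sub>n B\<close>.  The first functor is a quasi-equivalence because
  the levels are homologically connective: every object of \<open>T\<^sub>n\<close> is isomorphic in the homotopy category to one
  coming from \<open>B\<close>, and homology can be transported along such isomorphisms.  The second one is a
  quasi-equivalence by axiom (B) and the third one by axioms (A1) and (A2).

  The truncation \<open>\<tau>\<^sub>\<le>\<^sub>n\<close> is the quotient by the dg ideal of all morphisms of degree above \<open>n\<close> and the
  boundaries of degree \<open>n\<close>; this is an ideal only for positively graded dg categories.\<close>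

section \<open>Modules and cosets\<close>

text \<open>Everything has to be strict: towers and their morphisms commute on the nose, and all dg
  categories of a tower share the types \<open>'o\<close> and \<open>'m\<close>. Hence
  \<open>tau_ge0\<close> shrinks carriers and keeps all operations, while \<open>tau_le\<close>
  keeps one representative per coset. A functor then acts on truncations by the same HOL functions,
  at most followed by a projection, and each commuting square rests on the projection having equal
  values on a morphism and on its representative.

  The passage through \<open>tau_ge0\<close> is forced because a level may have chains in negative
  degrees. There a degree 0 morphism need not be a cycle, and composing a boundary with it may fail
  to give a boundary. In a positively graded dg category degree 0 consists of cycles; this makes
  \<open>trunc_ideal\<close> closed under composition and makes functors out of \<open>B\<close>
  land in \<open>tau_ge0\<close> of the levels.

  Weak equivalences are checked degree by degree: a homology isomorphism in the degrees that the
  truncation preserves, vanishing of both sides in all others.\<close>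

lemma mod_homD:
  assumes "f \<in> mod_hom R M N"
  shows mod_hom_closed: "x \<in> carrier M \<Longrightarrow> f x \<in> carrier N"
    and mod_hom_add: "x \<in> carrier M \<Longrightarrow> y \<in> carrier M \<Longrightarrow> f (x \<oplus>\<^bsub>M\<^esub> y) = f x \<oplus>\<^bsub>N\<^esub> f y"
    and mod_hom_smult: "r \<in> carrier R \<Longrightarrow> x \<in> carrier M \<Longrightarrow> f (r \<odot>\<^bsub>M\<^esub> x) = r \<odot>\<^bsub>N\<^esub> f x"
  using assms by (auto simp: mod_hom_def)

lemma mod_homI:
  assumes "\<And>x. x \<in> carrier M \<Longrightarrow> f x \<in> carrier N"
    and "\<And>x y. x \<in> carrier M \<Longrightarrow> y \<in> carrier M \<Longrightarrow> f (x \<oplus>\<^bsub>M\<^esub> y) = f x \<oplus>\<^bsub>N\<^esub> f y"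
    and "\<And>r x. r \<in> carrier R \<Longrightarrow> x \<in> carrier M \<Longrightarrow> f (r \<odot>\<^bsub>M\<^esub> x) = r \<odot>\<^bsub>N\<^esub> f x"
  shows "f \<in> mod_hom R M N"
  using assms by (auto simp: mod_hom_def)

lemma mod_hom_compose:
  "f \<in> mod_hom R M N \<Longrightarrow> g \<in> mod_hom R N P \<Longrightarrow> (\<lambda>x. g (f x)) \<in> mod_hom R M P"
  by (auto simp: mod_hom_def Pi_def)

lemma mod_hom_zero:
  assumes "f \<in> mod_hom R M N" "module R M" "module R N"
  shows "f \<zero>\<^bsub>M\<^esub> = \<zero>\<^bsub>N\<^esub>"
proof -
  interpret M: module R M by fact
  interpret N: module R N by fact
  have "f \<zero>\<^bsub>M\<^esub> \<oplus>\<^bsub>N\<^esub> f \<zero>\<^bsub>M\<^esub> = f \<zero>\<^bsub>M\<^esub>"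
    using mod_hom_add[OF assms(1), of "\<zero>\<^bsub>M\<^esub>" "\<zero>\<^bsub>M\<^esub>"] by simp
  then show ?thesis
    using mod_hom_closed[OF assms(1)] by (metis M.M.zero_closed N.M.add.r_cancel_one')
qed

lemma mod_hom_neg:
  assumes "f \<in> mod_hom R M N" "module R M" "module R N" "x \<in> carrier M"
  shows "f (\<ominus>\<^bsub>M\<^esub> x) = \<ominus>\<^bsub>N\<^esub> f x"
proof -
  interpret M: module R M by fact
  interpret N: module R N by fact
  have "f (\<ominus>\<^bsub>M\<^esub> x) \<oplus>\<^bsub>N\<^esub> f x = \<zero>\<^bsub>N\<^esub>"
    using mod_hom_add[OF assms(1), of "\<ominus>\<^bsub>M\<^esub> x" x] mod_hom_zero[OF assms(1-3)] assms(4)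
    by (simp add: M.M.l_neg)
  then show ?thesis
    using mod_hom_closed[OF assms(1)] assms(4) by (metis M.M.add.inv_closed N.M.minus_equality)
qed

lemma mod_hom_koszul:
  assumes "f \<in> mod_hom R M N" "module R M" "module R N" "x \<in> carrier M"
  shows "f (koszul M p x) = koszul N p (f x)"
  using mod_hom_neg[OF assms] by (simp add: koszul_def)

lemma koszul_closed: "module R M \<Longrightarrow> x \<in> carrier M \<Longrightarrow> koszul M p x \<in> carrier M"
proof -
  assume "module R M" "x \<in> carrier M"
  then interpret module R M by simp
  show ?thesis using \<open>x \<in> carrier M\<close> by (simp add: koszul_def)
qed

text \<open>\<open>N\<close> is only a record here. Every module law is an equation between elements
  of the form \<open>f u\<close>, so it is inherited from \<open>M\<close>. The zero is matched by
  hypothesis, since additivity determines \<open>f\<close> at zero only once \<open>N\<close> is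
  known to be a group.\<close>

lemma module_surj_image:
  assumes M: "module R M"
    and f: "f \<in> mod_hom R M N" and z: "f \<zero>\<^bsub>M\<^esub> = \<zero>\<^bsub>N\<^esub>" and surj: "f ` carrier M = carrier N"
  shows "module R N"
proof -
  interpret M: module R M by fact
  note cl = mod_hom_closed[OF f]
  have add: "f x \<oplus>\<^bsub>N\<^esub> f y = f (x \<oplus>\<^bsub>M\<^esub> y)" if "x \<in> carrier M" "y \<in> carrier M" for x y
    using mod_hom_add[OF f] that by simp
  have smult: "r \<odot>\<^bsub>N\<^esub> f x = f (r \<odot>\<^bsub>M\<^esub> x)" if "r \<in> carrier R" "x \<in> carrier M" for r x
    using mod_hom_smult[OF f] that by simp
  have rep: "\<exists>u\<in>carrier M. x = f u" if "x \<in> carrier N" for x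
    using that surj by auto
  show ?thesis
  proof (rule moduleI)
    show "cring R" by (rule M.R.is_cring)
    show "abelian_group N"
    proof (rule abelian_groupI)
      fix x y z assume "x \<in> carrier N" "y \<in> carrier N" "z \<in> carrier N"
      then obtain u v w where [simp]: "x = f u" "y = f v" "z = f w"
        and uvw [simp]: "u \<in> carrier M" "v \<in> carrier M" "w \<in> carrier M" using rep by metis
      show "x \<oplus>\<^bsub>N\<^esub> y \<in> carrier N" by (simp add: add cl)
      show "x \<oplus>\<^bsub>N\<^esub> y \<oplus>\<^bsub>N\<^esub> z = x \<oplus>\<^bsub>N\<^esub> (y \<oplus>\<^bsub>N\<^esub> z)" by (simp add: add M.M.a_assoc)
      show "x \<oplus>\<^bsub>N\<^esub> y = y \<oplus>\<^bsub>N\<^esub> x" by (simp add: add M.M.a_comm)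
      show "\<zero>\<^bsub>N\<^esub> \<oplus>\<^bsub>N\<^esub> x = x" by (simp add: add flip: z)
      have "f (\<ominus>\<^bsub>M\<^esub> u) \<oplus>\<^bsub>N\<^esub> x = \<zero>\<^bsub>N\<^esub>" by (simp add: add M.M.l_neg z)
      then show "\<exists>y\<in>carrier N. y \<oplus>\<^bsub>N\<^esub> x = \<zero>\<^bsub>N\<^esub>" using cl uvw(1) by blast
    next
      show "\<zero>\<^bsub>N\<^esub> \<in> carrier N" using cl[of "\<zero>\<^bsub>M\<^esub>"] z by simp
    qed
  next
    fix a b x y assume [simp]: "a \<in> carrier R" "b \<in> carrier R" and "x \<in> carrier N" "y \<in> carrier N"
    then obtain u v where [simp]: "x = f u" "y = f v" "u \<in> carrier M" "v \<in> carrier M"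
      using rep by metis
    show "a \<odot>\<^bsub>N\<^esub> x \<in> carrier N" by (simp add: smult cl)
    show "(a \<oplus>\<^bsub>R\<^esub> b) \<odot>\<^bsub>N\<^esub> x = a \<odot>\<^bsub>N\<^esub> x \<oplus>\<^bsub>N\<^esub> b \<odot>\<^bsub>N\<^esub> x"
      by (simp add: smult add M.smult_l_distr)
    show "a \<odot>\<^bsub>N\<^esub> (x \<oplus>\<^bsub>N\<^esub> y) = a \<odot>\<^bsub>N\<^esub> x \<oplus>\<^bsub>N\<^esub> a \<odot>\<^bsub>N\<^esub> y"
      by (simp add: smult add M.smult_r_distr)
    show "(a \<otimes>\<^bsub>R\<^esub> b) \<odot>\<^bsub>N\<^esub> x = a \<odot>\<^bsub>N\<^esub> (b \<odot>\<^bsub>N\<^esub> x)"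
      by (simp add: smult M.smult_assoc1)
  next
    fix x assume "x \<in> carrier N"
    then obtain u where "x = f u" "u \<in> carrier M" using rep by metis
    then show "\<one>\<^bsub>R\<^esub> \<odot>\<^bsub>N\<^esub> x = x" by (simp add: smult)
  qed
qed

section \<open>Cosets of a submodule and quotient modules\<close>

locale module_with_submodule = module R M
  for R :: "('r, 's) ring_scheme" (structure) and M :: "('r, 'm) module" (structure) +
  fixes H :: "'m set"
  assumes submod: "submodule H R M"
begin

lemma sub_carrier: "h \<in> H \<Longrightarrow> h \<in> carrier M"
  and sub_add: "g \<in> H \<Longrightarrow> h \<in> H \<Longrightarrow> g \<oplus>\<^bsub>M\<^esub> h \<in> H"
  and sub_neg: "h \<in> H \<Longrightarrow> \<ominus>\<^bsub>M\<^esub> h \<in> H"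
  and sub_smult: "r \<in> carrier R \<Longrightarrow> h \<in> H \<Longrightarrow> r \<odot>\<^bsub>M\<^esub> h \<in> H"
  and sub_zero: "\<zero>\<^bsub>M\<^esub> \<in> H"
  using submoduleE[OF submod] subgroup.one_closed[OF submodule.axioms(1)[OF submod]] by auto

lemma mem_coset: "y \<in> H +>\<^bsub>M\<^esub> x \<longleftrightarrow> (\<exists>h\<in>H. y = h \<oplus>\<^bsub>M\<^esub> x)"
  by (auto simp: a_r_coset_def' )

lemma self_mem_coset: "x \<in> carrier M \<Longrightarrow> x \<in> H +>\<^bsub>M\<^esub> x"
  unfolding mem_coset using sub_zero by (metis M.l_zero)

lemma coset_carrier: "x \<in> carrier M \<Longrightarrow> y \<in> H +>\<^bsub>M\<^esub> x \<Longrightarrow> y \<in> carrier M"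
  by (auto simp: mem_coset sub_carrier)

lemma coset_eqI:
  assumes "x \<in> carrier M" "h \<in> H" "y = h \<oplus>\<^bsub>M\<^esub> x"
  shows "H +>\<^bsub>M\<^esub> y = H +>\<^bsub>M\<^esub> x"
proof (rule Set.set_eqI, rule iffI)
  fix z assume "z \<in> H +>\<^bsub>M\<^esub> y"
  then show "z \<in> H +>\<^bsub>M\<^esub> x"
    unfolding mem_coset using assms sub_carrier sub_add by (metis M.a_assoc)
next
  fix z assume "z \<in> H +>\<^bsub>M\<^esub> x"
  then obtain k where k: "k \<in> H" "z = k \<oplus>\<^bsub>M\<^esub> x" unfolding mem_coset by auto
  have "(k \<oplus>\<^bsub>M\<^esub> \<ominus>\<^bsub>M\<^esub> h) \<oplus>\<^bsub>M\<^esub> y = z"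
    using k assms sub_carrier sub_neg by (simp add: M.a_assoc M.r_neg2 M.r_neg1)
  then show "z \<in> H +>\<^bsub>M\<^esub> y"
    unfolding mem_coset using k assms sub_neg sub_add by metis
qed

lemma coset_eq_iff:
  assumes "x \<in> carrier M" "y \<in> carrier M"
  shows "H +>\<^bsub>M\<^esub> y = H +>\<^bsub>M\<^esub> x \<longleftrightarrow> (\<exists>h\<in>H. y = h \<oplus>\<^bsub>M\<^esub> x)"
proof
  assume "H +>\<^bsub>M\<^esub> y = H +>\<^bsub>M\<^esub> x"
  then show "\<exists>h\<in>H. y = h \<oplus>\<^bsub>M\<^esub> x"
    using self_mem_coset[OF assms(2)] by (simp add: mem_coset)
next
  assume "\<exists>h\<in>H. y = h \<oplus>\<^bsub>M\<^esub> x"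
  then show "H +>\<^bsub>M\<^esub> y = H +>\<^bsub>M\<^esub> x"
    by (elim bexE) (rule coset_eqI[OF assms(1)])
qed

lemma coset_of_mem: "x \<in> carrier M \<Longrightarrow> y \<in> H +>\<^bsub>M\<^esub> x \<Longrightarrow> H +>\<^bsub>M\<^esub> y = H +>\<^bsub>M\<^esub> x"
  unfolding mem_coset by (elim bexE) (rule coset_eqI)

lemma coset_zero: "H +>\<^bsub>M\<^esub> \<zero>\<^bsub>M\<^esub> = H"
  using sub_carrier by (auto simp: mem_coset)

lemma coset_eq_sub_iff: "x \<in> carrier M \<Longrightarrow> H +>\<^bsub>M\<^esub> x = H \<longleftrightarrow> x \<in> H"
  using coset_eqI[of "\<zero>\<^bsub>M\<^esub>" x x] self_mem_coset[of x] sub_carrier by (auto simp: coset_zero)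

lemma coset_add:
  assumes "x \<in> carrier M" "y \<in> carrier M" "x' \<in> carrier M" "y' \<in> carrier M"
    "H +>\<^bsub>M\<^esub> x = H +>\<^bsub>M\<^esub> x'" "H +>\<^bsub>M\<^esub> y = H +>\<^bsub>M\<^esub> y'"
  shows "H +>\<^bsub>M\<^esub> (x \<oplus>\<^bsub>M\<^esub> y) = H +>\<^bsub>M\<^esub> (x' \<oplus>\<^bsub>M\<^esub> y')"
proof -
  obtain h k where "h \<in> H" "x = h \<oplus>\<^bsub>M\<^esub> x'" "k \<in> H" "y = k \<oplus>\<^bsub>M\<^esub> y'"
    using assms coset_eq_iff by metis
  then show ?thesis using assms
    by (intro coset_eqI[of _ "h \<oplus>\<^bsub>M\<^esub> k"]) (auto simp: sub_add sub_carrier M.a_ac)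
qed

lemma coset_smult:
  assumes "r \<in> carrier R" "x \<in> carrier M" "x' \<in> carrier M" "H +>\<^bsub>M\<^esub> x = H +>\<^bsub>M\<^esub> x'"
  shows "H +>\<^bsub>M\<^esub> (r \<odot>\<^bsub>M\<^esub> x) = H +>\<^bsub>M\<^esub> (r \<odot>\<^bsub>M\<^esub> x')"
proof -
  obtain h where "h \<in> H" "x = h \<oplus>\<^bsub>M\<^esub> x'"
    using assms coset_eq_iff by metis
  then show ?thesis using assms
    by (intro coset_eqI[of _ "r \<odot>\<^bsub>M\<^esub> h"]) (auto simp: sub_smult sub_carrier smult_r_distr)
qed

text \<open>\<open>homology\<close> adds classes elementwise as sets; this becomes addition of
  representatives. For the inclusion from right to left, the element of \<open>H\<close> is absorbed
  into the first summand and the second summand is \<open>y\<close> itself.\<close>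

lemma set_add_coset:
  assumes "x \<in> carrier M" "y \<in> carrier M"
  shows "(H +>\<^bsub>M\<^esub> x) <+>\<^bsub>M\<^esub> (H +>\<^bsub>M\<^esub> y) = H +>\<^bsub>M\<^esub> (x \<oplus>\<^bsub>M\<^esub> y)"
proof (rule Set.set_eqI, rule iffI)
  fix z assume "z \<in> (H +>\<^bsub>M\<^esub> x) <+>\<^bsub>M\<^esub> (H +>\<^bsub>M\<^esub> y)"
  then obtain u v where "u \<in> H +>\<^bsub>M\<^esub> x" "v \<in> H +>\<^bsub>M\<^esub> y" "z = u \<oplus>\<^bsub>M\<^esub> v"
    by (auto simp: set_add_def')
  then show "z \<in> H +>\<^bsub>M\<^esub> (x \<oplus>\<^bsub>M\<^esub> y)"
    using coset_add[of u v x y] coset_of_mem[of x u] coset_of_mem[of y v] assms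
      self_mem_coset[of z] coset_carrier by auto
next
  fix z assume "z \<in> H +>\<^bsub>M\<^esub> (x \<oplus>\<^bsub>M\<^esub> y)"
  then obtain h where h: "h \<in> H" "z = h \<oplus>\<^bsub>M\<^esub> (x \<oplus>\<^bsub>M\<^esub> y)" by (auto simp: mem_coset)
  then have "z = (h \<oplus>\<^bsub>M\<^esub> x) \<oplus>\<^bsub>M\<^esub> y" using assms sub_carrier by (simp add: M.a_assoc)
  then show "z \<in> (H +>\<^bsub>M\<^esub> x) <+>\<^bsub>M\<^esub> (H +>\<^bsub>M\<^esub> y)"
    unfolding set_add_def' using h(1) self_mem_coset[OF assms(2)] by (force simp: a_r_coset_def')
qed

end

text \<open>Quotient modules are realised on a set of coset representatives, so that they live over
  the same type as the original module.\<close>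

definition coset_rep :: "('r, 'm, 't) module_scheme \<Rightarrow> 'm set \<Rightarrow> 'm \<Rightarrow> 'm"
  where "coset_rep M H x = (SOME y. y \<in> H +>\<^bsub>M\<^esub> x)"

definition quotient_module :: "('r, 'm) module \<Rightarrow> 'm set \<Rightarrow> ('r, 'm) module"
  where "quotient_module M H = M\<lparr>carrier := coset_rep M H ` carrier M,
    zero := coset_rep M H \<zero>\<^bsub>M\<^esub>,
    add := (\<lambda>x y. coset_rep M H (x \<oplus>\<^bsub>M\<^esub> y)),
    smult := (\<lambda>r x. coset_rep M H (r \<odot>\<^bsub>M\<^esub> x))\<rparr>"

context module_with_submodule
begin

lemma coset_rep_mem: "x \<in> carrier M \<Longrightarrow> coset_rep M H x \<in> H +>\<^bsub>M\<^esub> x"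
  unfolding coset_rep_def using self_mem_coset by (rule someI)

lemma coset_rep_closed: "x \<in> carrier M \<Longrightarrow> coset_rep M H x \<in> carrier M"
  using coset_rep_mem coset_carrier by blast

lemma coset_coset_rep: "x \<in> carrier M \<Longrightarrow> H +>\<^bsub>M\<^esub> coset_rep M H x = H +>\<^bsub>M\<^esub> x"
  by (rule coset_of_mem[OF _ coset_rep_mem])

text \<open>The choice in \<open>coset_rep\<close> sees only the coset as a set, so equal cosets
  yield the very same representative. Equations in the quotient thereby become equalities of
  elements of \<open>M\<close>.\<close>

lemma coset_rep_eq_iff:
  assumes "x \<in> carrier M" "y \<in> carrier M"
  shows "coset_rep M H x = coset_rep M H y \<longleftrightarrow> H +>\<^bsub>M\<^esub> x = H +>\<^bsub>M\<^esub> y"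
proof
  assume "coset_rep M H x = coset_rep M H y"
  then show "H +>\<^bsub>M\<^esub> x = H +>\<^bsub>M\<^esub> y"
    using coset_coset_rep[OF assms(1)] coset_coset_rep[OF assms(2)] by metis
qed (simp add: coset_rep_def)

lemma coset_rep_zero_iff:
  "x \<in> carrier M \<Longrightarrow> coset_rep M H x = coset_rep M H \<zero>\<^bsub>M\<^esub> \<longleftrightarrow> x \<in> H"
  by (simp add: coset_rep_eq_iff coset_zero coset_eq_sub_iff)

lemma coset_rep_decomp:
  assumes "x \<in> carrier M"
  obtains h where "h \<in> H" "coset_rep M H x = h \<oplus>\<^bsub>M\<^esub> x"
  using coset_rep_mem[OF assms] that by (auto simp: mem_coset)

text \<open>The operations of the quotient compute in \<open>M\<close> and then pass to the
  representative, so the point is that computing with representatives instead of \<open>x\<close>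
  and \<open>y\<close> stays in the same coset.\<close>

lemma coset_rep_hom: "coset_rep M H \<in> mod_hom R M (quotient_module M H)"
proof (rule mod_homI)
  show "coset_rep M H x \<in> carrier (quotient_module M H)" if "x \<in> carrier M" for x
    using that by (simp add: quotient_module_def)
next
  fix x y assume "x \<in> carrier M" "y \<in> carrier M"
  then have "H +>\<^bsub>M\<^esub> (x \<oplus>\<^bsub>M\<^esub> y) = H +>\<^bsub>M\<^esub> (coset_rep M H x \<oplus>\<^bsub>M\<^esub> coset_rep M H y)"
    by (intro coset_add) (simp_all add: coset_coset_rep coset_rep_closed)
  then show "coset_rep M H (x \<oplus>\<^bsub>M\<^esub> y) = coset_rep M H x \<oplus>\<^bsub>quotient_module M H\<^esub> coset_rep M H y"
    by (simp add: quotient_module_def coset_rep_def)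
next
  fix r x assume "r \<in> carrier R" "x \<in> carrier M"
  then have "H +>\<^bsub>M\<^esub> (r \<odot>\<^bsub>M\<^esub> x) = H +>\<^bsub>M\<^esub> (r \<odot>\<^bsub>M\<^esub> coset_rep M H x)"
    by (intro coset_smult) (simp_all add: coset_coset_rep coset_rep_closed)
  then show "coset_rep M H (r \<odot>\<^bsub>M\<^esub> x) = r \<odot>\<^bsub>quotient_module M H\<^esub> coset_rep M H x"
    by (simp add: quotient_module_def coset_rep_def)
qed

end

section \<open>Homology\<close>

lemma bij_betw_singleton_iff:
  assumes "bij_betw h A B" "a \<in> A"
  shows "A = {a} \<longleftrightarrow> B = {h a}"
proof -
  have B: "B = h ` A" and inj: "inj_on h A" using assms(1) by (auto simp: bij_betw_def)
  have "x = a" if "h ` A = {h a}" "x \<in> A" for x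
    using that assms(2) inj_onD[OF inj, of x a] by blast
  then show ?thesis unfolding B using assms(2) by blast
qed

section \<open>Cycles, boundaries and homology classes of one complex\<close>

context chain_complex
begin

lemma bdry_hom': "bdry C (i + 1) \<in> mod_hom R (chains C (i + 1)) (chains C i)"
  using bdry_hom[of "i + 1"] by simp

lemma bdry_closed: "x \<in> carrier (chains C i) \<Longrightarrow> bdry C i x \<in> carrier (chains C (i - 1))"
  by (rule mod_hom_closed[OF bdry_hom])

lemma bdry_zero: "bdry C i \<zero>\<^bsub>chains C i\<^esub> = \<zero>\<^bsub>chains C (i - 1)\<^esub>"
  by (rule mod_hom_zero[OF bdry_hom chains_module chains_module])

lemma cycles_closed: "x \<in> cycles C i \<Longrightarrow> x \<in> carrier (chains C i)"
  by (simp add: cycles_def)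

lemma boundaries_closed: "x \<in> boundaries C i \<Longrightarrow> x \<in> carrier (chains C i)"
  using mod_hom_closed[OF bdry_hom'] by (auto simp: boundaries_def)

lemma boundaries_subset_cycles: "boundaries C i \<subseteq> cycles C i"
  using bdry_bdry[of _ "i + 1"] boundaries_closed by (force simp: boundaries_def cycles_def)

lemma boundaries_submodule: "submodule (boundaries C i) R (chains C i)"
proof -
  interpret M: module R "chains C i" by (rule chains_module)
  interpret N: module R "chains C (i + 1)" by (rule chains_module)
  note h = bdry_hom'[of i]
  show ?thesis
  proof (rule M.submoduleI)
    show "boundaries C i \<subseteq> carrier (chains C i)" using boundaries_closed by auto
    show "\<zero>\<^bsub>chains C i\<^esub> \<in> boundaries C i"
      unfolding boundaries_def using mod_hom_zero[OF h chains_module chains_module]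
      by (metis N.M.zero_closed imageI)
    show "\<ominus>\<^bsub>chains C i\<^esub> a \<in> boundaries C i" if "a \<in> boundaries C i" for a
      using that unfolding boundaries_def
      by (auto simp flip: mod_hom_neg[OF h chains_module chains_module])
    show "a \<oplus>\<^bsub>chains C i\<^esub> b \<in> boundaries C i"
      if "a \<in> boundaries C i" "b \<in> boundaries C i" for a b
      using that unfolding boundaries_def
      by (auto simp flip: mod_hom_add[OF h])
    show "r \<odot>\<^bsub>chains C i\<^esub> x \<in> boundaries C i"
      if "r \<in> carrier R" "x \<in> boundaries C i" for r x
      using that unfolding boundaries_def
      by (auto simp flip: mod_hom_smult[OF h])
  qed
qed

lemma chains_boundaries: "module_with_submodule R (chains C i) (boundaries C i)"
  by (intro module_with_submodule.intro module_with_submodule_axioms.intro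
      chains_module boundaries_submodule)

lemma cycles_submodule: "submodule (cycles C i) R (chains C i)"
proof (rule module.submoduleI[OF chains_module])
  interpret M: module R "chains C i" by (rule chains_module)
  interpret N: module R "chains C (i - 1)" by (rule chains_module)
  note h = bdry_hom[of i]
  show "cycles C i \<subseteq> carrier (chains C i)" by (auto simp: cycles_def)
  show "\<zero>\<^bsub>chains C i\<^esub> \<in> cycles C i" by (simp add: cycles_def bdry_zero)
  show "\<ominus>\<^bsub>chains C i\<^esub> a \<in> cycles C i" if "a \<in> cycles C i" for a
    using that mod_hom_neg[OF h chains_module chains_module] by (simp add: cycles_def)
  show "a \<oplus>\<^bsub>chains C i\<^esub> b \<in> cycles C i" if "a \<in> cycles C i" "b \<in> cycles C i" for a b
    using that mod_hom_add[OF h] by (simp add: cycles_def)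
  show "r \<odot>\<^bsub>chains C i\<^esub> x \<in> cycles C i" if "r \<in> carrier R" "x \<in> cycles C i" for r x
    using that mod_hom_smult[OF h] by (simp add: cycles_def)
qed

lemma cycles_add: "x \<in> cycles C i \<Longrightarrow> y \<in> cycles C i \<Longrightarrow> x \<oplus>\<^bsub>chains C i\<^esub> y \<in> cycles C i"
  and cycles_smult: "r \<in> carrier R \<Longrightarrow> x \<in> cycles C i \<Longrightarrow> r \<odot>\<^bsub>chains C i\<^esub> x \<in> cycles C i"
  and zero_cycle: "\<zero>\<^bsub>chains C i\<^esub> \<in> cycles C i"
  using module.submoduleE[OF chains_module cycles_submodule] subgroup.one_closed[OF submodule.axioms(1)[OF cycles_submodule]]
  by auto

lemma hclass_eqI:
  assumes "x \<in> carrier (chains C i)" "b \<in> boundaries C i" "y = b \<oplus>\<^bsub>chains C i\<^esub> x"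
  shows "hclass C i y = hclass C i x"
  unfolding hclass_def using assms by (rule module_with_submodule.coset_eqI[OF chains_boundaries])

lemma hclass_mem_cycles: "x \<in> cycles C i \<Longrightarrow> y \<in> hclass C i x \<Longrightarrow> y \<in> cycles C i"
  unfolding hclass_def module_with_submodule.mem_coset[OF chains_boundaries] using boundaries_subset_cycles cycles_add by blast

lemma hclass_mem_closed:
  "x \<in> carrier (chains C i) \<Longrightarrow> y \<in> hclass C i x \<Longrightarrow> y \<in> carrier (chains C i)"
  unfolding hclass_def by (rule module_with_submodule.coset_carrier[OF chains_boundaries])

lemma hclass_of_mem: "x \<in> carrier (chains C i) \<Longrightarrow> y \<in> hclass C i x \<Longrightarrow> hclass C i y = hclass C i x"
  unfolding hclass_def by (rule module_with_submodule.coset_of_mem[OF chains_boundaries])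

lemma self_mem_hclass: "x \<in> carrier (chains C i) \<Longrightarrow> x \<in> hclass C i x"
  unfolding hclass_def by (rule module_with_submodule.self_mem_coset[OF chains_boundaries])

lemma hclass_eqE:
  assumes "hclass C i y = hclass C i x" "x \<in> carrier (chains C i)" "y \<in> carrier (chains C i)"
  obtains b where "b \<in> boundaries C i" "y = b \<oplus>\<^bsub>chains C i\<^esub> x"
proof -
  have "y \<in> hclass C i x" using self_mem_hclass[OF assms(3)] assms(1) by simp
  then show ?thesis using that by (auto simp: hclass_def module_with_submodule.mem_coset[OF chains_boundaries])
qed

lemma hclass_eq_boundaries_iff:
  "x \<in> carrier (chains C i) \<Longrightarrow> hclass C i x = boundaries C i \<longleftrightarrow> x \<in> boundaries C i"
  unfolding hclass_def by (rule module_with_submodule.coset_eq_sub_iff[OF chains_boundaries])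

lemma hclass_zero: "hclass C i \<zero>\<^bsub>chains C i\<^esub> = boundaries C i"
  unfolding hclass_def by (rule module_with_submodule.coset_zero[OF chains_boundaries])

text \<open>\<open>homology_map\<close>, scalar multiplication on homology and composition in
  \<open>H0_cat\<close> are unions over representatives. Once the members are shown to be constant
  on the class, the union over this nonempty set collapses to the common value.\<close>

lemma UN_hclass:
  assumes "x \<in> carrier (chains C i)" "\<And>y. y \<in> hclass C i x \<Longrightarrow> F y = G"
  shows "(\<Union>y\<in>hclass C i x. F y) = G"
  using assms self_mem_hclass[OF assms(1)] by auto

lemma homology_add_hclass:
  assumes "x \<in> carrier (chains C i)" "y \<in> carrier (chains C i)"
  shows "hclass C i x \<oplus>\<^bsub>homology C i\<^esub> hclass C i y = hclass C i (x \<oplus>\<^bsub>chains C i\<^esub> y)"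
  using module_with_submodule.set_add_coset[OF chains_boundaries, OF assms] by (simp add: homology_def hclass_def)

lemma homology_smult_hclass:
  assumes "r \<in> carrier R" "x \<in> carrier (chains C i)"
  shows "r \<odot>\<^bsub>homology C i\<^esub> hclass C i x = hclass C i (r \<odot>\<^bsub>chains C i\<^esub> x)"
proof -
  have "(\<Union>y\<in>hclass C i x. hclass C i (r \<odot>\<^bsub>chains C i\<^esub> y)) = hclass C i (r \<odot>\<^bsub>chains C i\<^esub> x)"
  proof (rule UN_hclass[OF assms(2)])
    fix y assume y: "y \<in> hclass C i x"
    show "hclass C i (r \<odot>\<^bsub>chains C i\<^esub> y) = hclass C i (r \<odot>\<^bsub>chains C i\<^esub> x)"
      unfolding hclass_def using y assms hclass_of_mem[OF assms(2) y] hclass_mem_closed[OF assms(2) y]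
      by (intro module_with_submodule.coset_smult[OF chains_boundaries]) (simp_all add: hclass_def)
  qed
  then show ?thesis by (simp add: homology_def)
qed

lemma carrier_homology: "carrier (homology C i) = hclass C i ` cycles C i"
  by (simp add: homology_def)

text \<open>The zero of homology is the set of boundaries, and the class of \<open>x\<close> equals
  that set exactly when \<open>x\<close> is a boundary. Vanishing can therefore be argued on
  chains.\<close>

lemma homology_zero_iff: "homology_zero C i \<longleftrightarrow> cycles C i \<subseteq> boundaries C i"
proof -
  have "boundaries C i \<in> hclass C i ` cycles C i"
    using hclass_zero zero_cycle by (metis imageI)
  then have "homology_zero C i \<longleftrightarrow> (\<forall>x\<in>cycles C i. hclass C i x = boundaries C i)"
    by (auto simp: homology_zero_def homology_def)
  also have "\<dots> \<longleftrightarrow> cycles C i \<subseteq> boundaries C i"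
    by (auto simp: hclass_eq_boundaries_iff cycles_closed)
  finally show ?thesis .
qed

end

section \<open>Maps induced on homology\<close>

locale complex_hom = C: chain_complex R C + D: chain_complex R D
  for R :: "('r, 's) ring_scheme" (structure) and C :: "('r, 'm) cplx" and D :: "('r, 'n) cplx" +
  fixes f :: "int \<Rightarrow> 'm \<Rightarrow> 'n"
  assumes chain_map: "chain_map R C D f"
begin

lemma hom: "f i \<in> mod_hom R (chains C i) (chains D i)"
  using chain_map by (simp add: chain_map_def)

lemma closed: "x \<in> carrier (chains C i) \<Longrightarrow> f i x \<in> carrier (chains D i)"
  by (rule mod_hom_closed[OF hom])

lemma bdry: "x \<in> carrier (chains C i) \<Longrightarrow> f (i - 1) (bdry C i x) = bdry D i (f i x)"
  using chain_map by (simp add: chain_map_def)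

lemma zero: "f i \<zero>\<^bsub>chains C i\<^esub> = \<zero>\<^bsub>chains D i\<^esub>"
  by (rule mod_hom_zero[OF hom C.chains_module D.chains_module])

lemma cycles: "x \<in> cycles C i \<Longrightarrow> f i x \<in> cycles D i"
  using bdry[of x i] closed zero[of "i - 1"] by (simp add: cycles_def)

lemma boundaries: "x \<in> boundaries C i \<Longrightarrow> f i x \<in> boundaries D i"
  using bdry[of _ "i + 1"] closed by (auto simp: boundaries_def)

lemma hclass_cong:
  assumes "hclass C i x = hclass C i y" "x \<in> carrier (chains C i)" "y \<in> carrier (chains C i)"
  shows "hclass D i (f i x) = hclass D i (f i y)"
  using assms(1)
proof (rule C.hclass_eqE[OF _ assms(3,2)])
  fix b assume "b \<in> boundaries C i" "x = b \<oplus>\<^bsub>chains C i\<^esub> y"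
  then show ?thesis
    using assms closed boundaries C.boundaries_closed mod_hom_add[OF hom]
    by (intro D.hclass_eqI[of _ _ "f i b"]) auto
qed

lemma homology_map_hclass:
  assumes "x \<in> carrier (chains C i)"
  shows "homology_map D f i (hclass C i x) = hclass D i (f i x)"
  unfolding homology_map_def
proof (rule C.UN_hclass[OF assms])
  fix y assume "y \<in> hclass C i x"
  then show "hclass D i (f i y) = hclass D i (f i x)"
    by (intro hclass_cong C.hclass_of_mem[OF assms] C.hclass_mem_closed[OF assms] assms)
qed

lemma homology_map_closed:
  "X \<in> carrier (homology C i) \<Longrightarrow> homology_map D f i X \<in> carrier (homology D i)"
  using cycles C.cycles_closed by (auto simp: C.carrier_homology D.carrier_homology homology_map_hclass)

lemma homology_map_hom: "homology_map D f i \<in> mod_hom R (homology C i) (homology D i)"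
proof (rule mod_homI[OF homology_map_closed])
  interpret M: module R "chains C i" by (rule C.chains_module)
  fix X Y assume "X \<in> carrier (homology C i)" "Y \<in> carrier (homology C i)"
  then show "homology_map D f i (X \<oplus>\<^bsub>homology C i\<^esub> Y)
      = homology_map D f i X \<oplus>\<^bsub>homology D i\<^esub> homology_map D f i Y"
    using C.cycles_closed closed
    by (auto simp: C.carrier_homology C.homology_add_hclass D.homology_add_hclass
        homology_map_hclass mod_hom_add[OF hom])
next
  interpret M: module R "chains C i" by (rule C.chains_module)
  fix r X assume "r \<in> carrier R" "X \<in> carrier (homology C i)"
  then show "homology_map D f i (r \<odot>\<^bsub>homology C i\<^esub> X) = r \<odot>\<^bsub>homology D i\<^esub> homology_map D f i X"
    using C.cycles_closed closed
    by (auto simp: C.carrier_homology C.homology_smult_hclass D.homology_smult_hclass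
        homology_map_hclass mod_hom_smult[OF hom])
qed

lemma homology_iso_at_iff:
  "homology_iso_at R C D f i \<longleftrightarrow>
    bij_betw (homology_map D f i) (carrier (homology C i)) (carrier (homology D i))"
  using homology_map_hom by (simp add: homology_iso_at_def mod_iso_def)

lemma homology_iso_atI:
  assumes inj: "\<And>x. x \<in> cycles C i \<Longrightarrow> f i x \<in> boundaries D i \<Longrightarrow> x \<in> boundaries C i"
    and surj: "\<And>y. y \<in> cycles D i \<Longrightarrow> \<exists>x\<in>cycles C i. hclass D i (f i x) = hclass D i y"
  shows "homology_iso_at R C D f i"
  unfolding homology_iso_at_iff bij_betw_def
proof
  show "inj_on (homology_map D f i) (carrier (homology C i))"
  proof (rule inj_onI)
    fix X Y assume "X \<in> carrier (homology C i)" "Y \<in> carrier (homology C i)"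
      and eq: "homology_map D f i X = homology_map D f i Y"
    then obtain x y where x: "X = hclass C i x" "x \<in> cycles C i" and y: "Y = hclass C i y" "y \<in> cycles C i"
      by (auto simp: C.carrier_homology)
    interpret M: module R "chains C i" by (rule C.chains_module)
    interpret N: module R "chains D i" by (rule D.chains_module)
    note [simp] = C.cycles_closed[OF x(2)] C.cycles_closed[OF y(2)]
    let ?n = "\<ominus>\<^bsub>chains C i\<^esub> y"
    have n: "?n \<in> cycles C i" using module.submoduleE(3)[OF C.chains_module C.cycles_submodule y(2)] .
    have "hclass D i (f i x) = hclass D i (f i y)"
      using eq x y by (simp add: homology_map_hclass)
    then obtain b where b: "b \<in> boundaries D i" "f i x = b \<oplus>\<^bsub>chains D i\<^esub> f i y"
      by (rule D.hclass_eqE) (simp_all add: closed)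
    \<comment> \<open>Injectivity is reduced to the kernel: the difference of the two cycles is sent
      to the boundary \<open>b\<close>, so the hypothesis \<open>inj\<close> makes it a
      boundary.\<close>
    have "f i (x \<oplus>\<^bsub>chains C i\<^esub> ?n) = b"
      using b closed D.boundaries_closed
      by (simp add: mod_hom_add[OF hom] mod_hom_neg[OF hom C.chains_module D.chains_module]
          N.M.a_assoc N.M.r_neg)
    then have "x \<oplus>\<^bsub>chains C i\<^esub> ?n \<in> boundaries C i"
      using b C.cycles_add[OF x(2) n] by (intro inj) auto
    then show "X = Y" unfolding x y
      by (rule C.hclass_eqI[rotated]) (simp_all add: M.M.a_assoc M.M.l_neg)
  qed
  show "homology_map D f i ` carrier (homology C i) = carrier (homology D i)"
  proof
    show "carrier (homology D i) \<subseteq> homology_map D f i ` carrier (homology C i)"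
    proof
      fix Y assume "Y \<in> carrier (homology D i)"
      then obtain y where y: "Y = hclass D i y" "y \<in> cycles D i" by (auto simp: D.carrier_homology)
      then obtain x where "x \<in> cycles C i" "hclass D i (f i x) = hclass D i y" using surj by blast
      then have "Y = homology_map D f i (hclass C i x)" "hclass C i x \<in> carrier (homology C i)"
        using y C.cycles_closed by (auto simp: homology_map_hclass C.carrier_homology)
      then show "Y \<in> homology_map D f i ` carrier (homology C i)" by blast
    qed
  qed (use homology_map_closed in auto)
qed

text \<open>A map between one-element modules is bijective. This settles all degrees in which
  truncation, connectivity or axiom (B) makes both sides vanish.\<close>

lemma homology_iso_at_trivial:
  assumes "homology_zero C i" "homology_zero D i"
  shows "homology_iso_at R C D f i"
  using assms homology_map_closed[of _ i]
  by (auto simp: homology_iso_at_iff homology_zero_def bij_betw_def)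

text \<open>The zero class goes to the zero class, and a bijection matches one-element carriers with
  one-element carriers.\<close>

lemma homology_zero_iso:
  assumes "homology_iso_at R C D f i"
  shows "homology_zero C i \<longleftrightarrow> homology_zero D i"
proof -
  have *: "homology_map D f i (boundaries C i) = boundaries D i"
    using homology_map_hclass[OF C.cycles_closed[OF C.zero_cycle]]
    by (simp add: C.hclass_zero D.hclass_zero zero)
  have "boundaries C i \<in> carrier (homology C i)"
    using C.hclass_zero C.zero_cycle unfolding C.carrier_homology by (metis imageI)
  moreover have bij: "bij_betw (homology_map D f i) (carrier (homology C i)) (carrier (homology D i))"
    using assms homology_iso_at_iff by blast
  ultimately have "carrier (homology C i) = {boundaries C i} \<longleftrightarrow> carrier (homology D i) = {boundaries D i}"
    using bij_betw_singleton_iff[OF bij, of "boundaries C i"] * by simp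
  then show ?thesis by (simp add: homology_zero_def homology_def)
qed

end

lemma chain_map_compose:
  assumes f: "chain_map R C D f" and g: "chain_map R D E g"
  shows "chain_map R C E (\<lambda>i x. g i (f i x))"
  unfolding chain_map_def
proof (intro conjI allI ballI)
  fix i
  have hom: "f i \<in> mod_hom R (chains C i) (chains D i)" using f by (simp add: chain_map_def)
  then show "(\<lambda>x. g i (f i x)) \<in> mod_hom R (chains C i) (chains E i)"
    using g by (auto simp: chain_map_def intro: mod_hom_compose)
  fix x assume x: "x \<in> carrier (chains C i)"
  then show "g (i - 1) (f (i - 1) (bdry C i x)) = bdry E i (g i (f i x))"
    using f g mod_hom_closed[OF hom x] by (simp add: chain_map_def)
qed

lemma homology_map_compose:
  assumes "complex_hom R C D f" "complex_hom R D E g" "X \<in> carrier (homology C i)"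
  shows "homology_map E (\<lambda>i x. g i (f i x)) i X = homology_map E g i (homology_map D f i X)"
proof -
  interpret f: complex_hom R C D f by fact
  interpret g: complex_hom R D E g by fact
  interpret gf: complex_hom R C E "\<lambda>i x. g i (f i x)"
    by unfold_locales (rule chain_map_compose[OF f.chain_map g.chain_map])
  show ?thesis using assms(3) f.C.cycles_closed f.closed
    by (auto simp: f.C.carrier_homology f.homology_map_hclass g.homology_map_hclass gf.homology_map_hclass)
qed

text \<open>Two out of three, the first map being an isomorphism. From right to left it composes
  \<open>tproj\<close> with the projection in \<open>iso_tproj_le\<close>; from left to right it
  cancels the projection of \<open>B\<close> in \<open>quasi_equivalence_comparison\<close>.\<close>

lemma homology_iso_at_compose:
  assumes "complex_hom R C D f" "complex_hom R D E g" "homology_iso_at R C D f i"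
  shows "homology_iso_at R C E (\<lambda>i x. g i (f i x)) i \<longleftrightarrow> homology_iso_at R D E g i"
proof -
  interpret f: complex_hom R C D f by fact
  interpret g: complex_hom R D E g by fact
  interpret gf: complex_hom R C E "\<lambda>i x. g i (f i x)"
    by unfold_locales (rule chain_map_compose[OF f.chain_map g.chain_map])
  have bij: "bij_betw (homology_map D f i) (carrier (homology C i)) (carrier (homology D i))"
    using assms(3) f.homology_iso_at_iff by blast
  have "homology_iso_at R C E (\<lambda>i x. g i (f i x)) i \<longleftrightarrow>
      bij_betw (homology_map E g i \<circ> homology_map D f i) (carrier (homology C i)) (carrier (homology E i))"
    unfolding gf.homology_iso_at_iff
    by (rule bij_betw_cong) (simp add: homology_map_compose[OF assms(1,2)])
  also have "\<dots> \<longleftrightarrow> homology_iso_at R D E g i"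
    unfolding g.homology_iso_at_iff using bij_betw_comp_iff[OF bij, symmetric] .
  finally show ?thesis .
qed

text \<open>A homology class is a set of chains of degree \<open>i\<close>, so the induced map
  evaluates the function only on that carrier. This is the homological counterpart of equality in
  the sense of \<open>dgfun_eq\<close>.\<close>

lemma homology_iso_at_cong:
  assumes "complex_hom R C D f" "\<And>x. x \<in> carrier (chains C i) \<Longrightarrow> f i x = g i x"
  shows "homology_iso_at R C D f i \<longleftrightarrow> homology_iso_at R C D g i"
proof -
  interpret f: complex_hom R C D f by fact
  have eq: "homology_map D f i X = homology_map D g i X" if "X \<in> carrier (homology C i)" for X
    unfolding homology_map_def
    using that assms(2) f.C.hclass_mem_closed f.C.cycles_closed
    by (force simp: f.C.carrier_homology)
  \<comment> \<open>Linearity also evaluates the induced map at sums and multiples of classes; these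
    must lie in the carrier for \<open>eq\<close> to apply.\<close>
  have closed: "X \<oplus>\<^bsub>homology C i\<^esub> Y \<in> carrier (homology C i)"
    if "X \<in> carrier (homology C i)" "Y \<in> carrier (homology C i)" for X Y
    using that f.C.cycles_closed f.C.cycles_add
    by (auto simp: f.C.carrier_homology f.C.homology_add_hclass)
  have closed': "r \<odot>\<^bsub>homology C i\<^esub> X \<in> carrier (homology C i)"
    if "r \<in> carrier R" "X \<in> carrier (homology C i)" for r X
    using that f.C.cycles_closed f.C.cycles_smult
    by (auto simp: f.C.carrier_homology f.C.homology_smult_hclass)
  have "homology_map D f i \<in> mod_hom R (homology C i) (homology D i) \<longleftrightarrow>
        homology_map D g i \<in> mod_hom R (homology C i) (homology D i)"
    using eq closed closed' by (simp add: mod_hom_def Pi_def)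
  moreover have "bij_betw (homology_map D f i) (carrier (homology C i)) (carrier (homology D i)) \<longleftrightarrow>
      bij_betw (homology_map D g i) (carrier (homology C i)) (carrier (homology D i))"
    by (rule bij_betw_cong) (rule eq)
  ultimately show ?thesis by (simp add: homology_iso_at_def mod_iso_def)
qed

section \<open>Equivalences of categories\<close>

lemma is_functorD:
  assumes "is_functor C D F"
  shows "x \<in> obs C \<Longrightarrow> fob F x \<in> obs D"
    and "x \<in> obs C \<Longrightarrow> y \<in> obs C \<Longrightarrow> f \<in> arr C x y \<Longrightarrow> far F x y f \<in> arr D (fob F x) (fob F y)"
    and "x \<in> obs C \<Longrightarrow> y \<in> obs C \<Longrightarrow> z \<in> obs C \<Longrightarrow> g \<in> arr C y z \<Longrightarrow> f \<in> arr C x y \<Longrightarrow>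
      far F x z (cmp C x y z g f) = cmp D (fob F x) (fob F y) (fob F z) (far F y z g) (far F x y f)"
    and "x \<in> obs C \<Longrightarrow> far F x x (idt C x) = idt D (fob F x)"
  using assms by (auto simp: is_functor_def)

lemma functor_isomorphism_in:
  assumes F: "is_functor C D F" and xy: "x \<in> obs C" "y \<in> obs C" and f: "isomorphism_in C x y f"
  shows "isomorphism_in D (fob F x) (fob F y) (far F x y f)"
proof -
  obtain g where g: "g \<in> arr C y x" "cmp C x y x g f = idt C x" "cmp C y x y f g = idt C y"
    and fa: "f \<in> arr C x y"
    using f by (auto simp: isomorphism_in_def)
  note D = is_functorD[OF F]
  have "cmp D (fob F x) (fob F y) (fob F x) (far F y x g) (far F x y f) = idt D (fob F x)"
    using D(3)[OF xy(1) xy(2) xy(1) g(1) fa] g(2) D(4)[OF xy(1)] by simp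
  moreover have "cmp D (fob F y) (fob F x) (fob F y) (far F x y f) (far F y x g) = idt D (fob F y)"
    using D(3)[OF xy(2) xy(1) xy(2) fa g(1)] g(3) D(4)[OF xy(2)] by simp
  ultimately show ?thesis
    unfolding isomorphism_in_def using D(2)[OF xy fa] D(2)[OF xy(2,1) g(1)] by blast
qed

text \<open>The witness is the component at \<open>d\<close> of the natural isomorphism from
  \<open>F\<close> after \<open>G\<close> to the identity, with \<open>c\<close> the object
  \<open>G d\<close>.\<close>

lemma equivalence_essentially_surjective:
  assumes "equivalence_of_categories C D F" "d \<in> obs D"
  shows "\<exists>c\<in>obs C. \<exists>e. isomorphism_in D (fob F c) d e"
proof -
  obtain G where G: "is_functor D C G" "naturally_isomorphic D D (comp_functor F G) id_functor"
    using assms(1) by (auto simp: equivalence_of_categories_def)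
  then obtain \<eta> where "isomorphism_in D (fob F (fob G d)) d (\<eta> d)"
    using assms(2) by (auto simp: naturally_isomorphic_def comp_functor_def id_functor_def)
  then show ?thesis using is_functorD(1)[OF G(1) assms(2)] by blast
qed

text \<open>Choose for each \<open>d\<close> an object \<open>c d\<close> and an isomorphism
  \<open>e d\<close> from \<open>F (c d)\<close> to \<open>d\<close>. The quasi-inverse takes
  \<open>h\<close> to the preimage under \<open>F\<close> of its conjugate by these isomorphisms;
  since \<open>F\<close> is faithful, every identity in \<open>C\<close> may be checked after
  applying \<open>F\<close>.\<close>

lemma equivalence_of_categoriesI:
  assumes "small_category C" "small_category D" and F: "is_functor C D F"
    and ff: "\<And>x y. x \<in> obs C \<Longrightarrow> y \<in> obs C \<Longrightarrow>
      bij_betw (far F x y) (arr C x y) (arr D (fob F x) (fob F y))"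
    and es: "\<And>d. d \<in> obs D \<Longrightarrow> \<exists>c\<in>obs C. \<exists>e. isomorphism_in D (fob F c) d e"
  shows "equivalence_of_categories C D F"
proof -
  interpret C: small_category C by fact
  interpret D: small_category D by fact
  note fn = is_functorD[OF F]
  obtain c e where c: "\<And>d. d \<in> obs D \<Longrightarrow> c d \<in> obs C"
    and iso: "\<And>d. d \<in> obs D \<Longrightarrow> isomorphism_in D (fob F (c d)) d (e d)"
    using es by metis
  then obtain e' where e: "\<And>d. d \<in> obs D \<Longrightarrow> e d \<in> arr D (fob F (c d)) d"
    and e': "\<And>d. d \<in> obs D \<Longrightarrow> e' d \<in> arr D d (fob F (c d))"
    and e'e: "\<And>d. d \<in> obs D \<Longrightarrow> cmp D (fob F (c d)) d (fob F (c d)) (e' d) (e d) = idt D (fob F (c d))"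
    and ee': "\<And>d. d \<in> obs D \<Longrightarrow> cmp D d (fob F (c d)) d (e d) (e' d) = idt D d"
    unfolding isomorphism_in_def by metis
  let ?F = "fob F"
  \<comment> \<open>\<open>K d d' h\<close> is \<open>h\<close> conjugated by the chosen
    isomorphisms. It runs between objects in the image of \<open>F\<close>, so fullness lifts it to
    \<open>C\<close>.\<close>
  define K where "K d d' h = cmp D (?F (c d)) d' (?F (c d')) (e' d') (cmp D (?F (c d)) d d' h (e d))"
    for d d' h
  have K: "K d d' h \<in> arr D (?F (c d)) (?F (c d'))" if "d \<in> obs D" "d' \<in> obs D" "h \<in> arr D d d'" for d d' h
    unfolding K_def using that by (intro D.cmp_closed e e' fn(1) c)
  define pre where "pre x y h = inv_into (arr C x y) (far F x y) h" for x y h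
  have pre: "pre x y h \<in> arr C x y" "far F x y (pre x y h) = h"
    if "x \<in> obs C" "y \<in> obs C" "h \<in> arr D (?F x) (?F y)" for x y h
    using ff[OF that(1,2)] that(3) unfolding pre_def bij_betw_def
    by (simp_all add: inv_into_into f_inv_into_f)
  have inj: "f = g" if "far F x y f = far F x y g" "x \<in> obs C" "y \<in> obs C" "f \<in> arr C x y" "g \<in> arr C x y" for x y f g
    using ff[OF that(2,3)] that by (auto simp: bij_betw_def dest: inj_onD)
  define G where "G = \<lparr>fob = c, far = (\<lambda>d d' h. pre (c d) (c d') (K d d' h))\<rparr>"
  \<comment> \<open>This is the naturality square of \<open>e\<close>, with \<open>K\<close> in the
    place of \<open>F\<close> after \<open>G\<close> on arrows.\<close>
  have eK: "cmp D (?F (c d)) (?F (c d')) d' (e d') (K d d' h) = cmp D (?F (c d)) d d' h (e d)"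
    if d: "d \<in> obs D" "d' \<in> obs D" "h \<in> arr D d d'" for d d' h
  proof -
    note cl = fn(1)[OF c[OF d(1)]] fn(1)[OF c[OF d(2)]] d e[OF d(1)] e[OF d(2)] e'[OF d(2)]
    have he: "cmp D (?F (c d)) d d' h (e d) \<in> arr D (?F (c d)) d'"
      using cl by (intro D.cmp_closed)
    have "cmp D (?F (c d)) (?F (c d')) d' (e d') (K d d' h)
        = cmp D (?F (c d)) d' d' (cmp D d' (?F (c d')) d' (e d') (e' d')) (cmp D (?F (c d)) d d' h (e d))"
      unfolding K_def using cl he by (intro D.cmp_assoc)
    then show ?thesis using cl he by (simp add: ee' D.cmp_idt_left)
  qed
  have K_cmp: "K d d'' (cmp D d d' d'' h' h) = cmp D (?F (c d)) (?F (c d')) (?F (c d'')) (K d' d'' h') (K d d' h)"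
    if d: "d \<in> obs D" "d' \<in> obs D" "d'' \<in> obs D" and h: "h' \<in> arr D d' d''" "h \<in> arr D d d'" for d d' d'' h h'
  proof -
    note cl = fn(1)[OF c[OF d(1)]] fn(1)[OF c[OF d(2)]] fn(1)[OF c[OF d(3)]] d h
      e[OF d(1)] e[OF d(2)] e[OF d(3)] e'[OF d(2)] e'[OF d(3)] K[OF d(1,2) h(2)]
    have he: "cmp D (?F (c d)) d d' h (e d) \<in> arr D (?F (c d)) d'"
      "cmp D (?F (c d')) d' d'' h' (e d') \<in> arr D (?F (c d')) d''"
      using cl by (intro D.cmp_closed; simp)+
    have "cmp D (?F (c d)) (?F (c d')) (?F (c d'')) (K d' d'' h') (K d d' h)
      = cmp D (?F (c d)) d'' (?F (c d'')) (e' d'')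
         (cmp D (?F (c d)) (?F (c d')) d'' (cmp D (?F (c d')) d' d'' h' (e d')) (K d d' h))"
      unfolding K_def[of d' d''] using cl he by (intro D.cmp_assoc[symmetric])
    also have "cmp D (?F (c d)) (?F (c d')) d'' (cmp D (?F (c d')) d' d'' h' (e d')) (K d d' h)
      = cmp D (?F (c d)) d' d'' h' (cmp D (?F (c d)) (?F (c d')) d' (e d') (K d d' h))"
      using cl he by (intro D.cmp_assoc[symmetric])
    also have "\<dots> = cmp D (?F (c d)) d' d'' h' (cmp D (?F (c d)) d d' h (e d))"
      using eK d h by simp
    also have "\<dots> = cmp D (?F (c d)) d d'' (cmp D d d' d'' h' h) (e d)"
      using cl by (intro D.cmp_assoc)
    finally show ?thesis by (simp add: K_def)
  qed
  have K_id: "K d d (idt D d) = idt D (?F (c d))" if "d \<in> obs D" for d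
    unfolding K_def using that e e' c fn(1) by (simp add: D.cmp_idt_left e'e)
  have far_G: "far G d d' h \<in> arr C (c d) (c d')" "far F (c d) (c d') (far G d d' h) = K d d' h"
    if "d \<in> obs D" "d' \<in> obs D" "h \<in> arr D d d'" for d d' h
    unfolding G_def using that by (simp_all add: pre K c)
  have fob_G: "fob G = c" by (simp add: G_def)
  have G: "is_functor D C G"
    unfolding is_functor_def fob_G
  proof (intro conjI ballI Pi_I)
    fix d d' d'' h' h
    assume d: "d \<in> obs D" "d' \<in> obs D" "d'' \<in> obs D" and h: "h' \<in> arr D d' d''" "h \<in> arr D d d'"
    have hh: "cmp D d d' d'' h' h \<in> arr D d d''" using d h by (intro D.cmp_closed)
    show "far G d d'' (cmp D d d' d'' h' h) = cmp C (c d) (c d') (c d'') (far G d' d'' h') (far G d d' h)"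
    proof (rule inj)
      show "far F (c d) (c d'') (far G d d'' (cmp D d d' d'' h' h)) =
        far F (c d) (c d'') (cmp C (c d) (c d') (c d'') (far G d' d'' h') (far G d d' h))"
        using d h hh by (simp add: fn(3) c far_G K_cmp)
    qed (use d h hh in \<open>auto intro!: c far_G C.cmp_closed\<close>)
  next
    fix d assume d: "d \<in> obs D"
    have i: "idt D d \<in> arr D d d" using d by (rule D.idt_closed)
    show "far G d d (idt D d) = idt C (c d)"
    proof (rule inj)
      show "far F (c d) (c d) (far G d d (idt D d)) = far F (c d) (c d) (idt C (c d))"
        using d i by (simp add: far_G K_id fn(4) c)
    qed (use d i in \<open>auto intro!: c far_G C.idt_closed\<close>)
  qed (auto intro: c far_G)
  have FG: "naturally_isomorphic D D (comp_functor F G) id_functor"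
    unfolding naturally_isomorphic_def comp_functor_def id_functor_def
    using iso by (intro exI[of _ e]) (auto simp: fob_G far_G eK)
  have GF: "naturally_isomorphic C C (comp_functor G F) id_functor"
    unfolding naturally_isomorphic_def comp_functor_def id_functor_def cat_functor.simps fob_G
  \<comment> \<open>The isomorphism from \<open>G (F x)\<close> to \<open>x\<close> is the preimage
    under \<open>F\<close> of \<open>e (F x)\<close>; its inverse is the preimage of
    \<open>e' (F x)\<close>.\<close>
  proof (intro exI[of _ "\<lambda>x. pre (c (?F x)) x (e (?F x))"] conjI ballI)
    fix x assume x: "x \<in> obs C"
    note d = fn(1)[OF x]
    let ?u = "pre (c (?F x)) x (e (?F x))" and ?v = "pre x (c (?F x)) (e' (?F x))"
    note u = pre[OF c[OF d] x e[OF d]] and v = pre[OF x c[OF d] e'[OF d]]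
    have "cmp C (c (?F x)) x (c (?F x)) ?v ?u = idt C (c (?F x))"
      by (rule inj[of "c (?F x)" "c (?F x)"]) (use x d u v in \<open>auto simp: fn(3,4) c e'e intro!: c C.cmp_closed C.idt_closed\<close>)
    moreover have "cmp C x (c (?F x)) x ?u ?v = idt C x"
      by (rule inj[of x x]) (use x d u v in \<open>auto simp: fn(3,4) c ee' intro!: c C.cmp_closed C.idt_closed\<close>)
    ultimately show "isomorphism_in C (c (?F x)) x ?u"
      unfolding isomorphism_in_def using u v by blast
  next
    fix x y f assume x: "x \<in> obs C" and y: "y \<in> obs C" and f: "f \<in> arr C x y"
    note d = fn(1)[OF x] fn(1)[OF y]
    note Ff = fn(2)[OF x y f]
    note u = pre[OF c[OF d(1)] x e[OF d(1)]] pre[OF c[OF d(2)] y e[OF d(2)]]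
    show "cmp C (c (?F x)) (c (?F y)) y (pre (c (?F y)) y (e (?F y))) (far G (?F x) (?F y) (far F x y f)) =
       cmp C (c (?F x)) x y f (pre (c (?F x)) x (e (?F x)))"
      by (rule inj[of "c (?F x)" y]) (use x y f d u Ff in \<open>auto simp: fn(3) c far_G eK intro!: c far_G C.cmp_closed\<close>)
  qed
  show ?thesis
    unfolding equivalence_of_categories_def using F G FG GF by blast
qed

section \<open>The homotopy category of a dg category\<close>

context dg_category
begin

lemma Hom_module: "x \<in> Obj A \<Longrightarrow> y \<in> Obj A \<Longrightarrow> module R (HomD A x y i)"
  by (rule chain_complex.chains_module[OF Hom_complex])

lemma Cmp_closed:
  assumes "x \<in> Obj A" "y \<in> Obj A" "z \<in> Obj A" "g \<in> carrier (HomD A y z p)" "f \<in> carrier (HomD A x y q)"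
  shows "Cmp A x y z p q g f \<in> carrier (HomD A x z (p + q))"
  using mod_hom_closed[OF Cmp_linear_left[OF assms(1-3,5)] assms(4)] .

lemma Cmp_zero_left:
  assumes "x \<in> Obj A" "y \<in> Obj A" "z \<in> Obj A" "f \<in> carrier (HomD A x y q)"
  shows "Cmp A x y z p q \<zero>\<^bsub>HomD A y z p\<^esub> f = \<zero>\<^bsub>HomD A x z (p + q)\<^esub>"
  using mod_hom_zero[OF Cmp_linear_left[OF assms]] Hom_module assms by simp

lemma Cmp_zero_right:
  assumes "x \<in> Obj A" "y \<in> Obj A" "z \<in> Obj A" "g \<in> carrier (HomD A y z p)"
  shows "Cmp A x y z p q g \<zero>\<^bsub>HomD A x y q\<^esub> = \<zero>\<^bsub>HomD A x z (p + q)\<^esub>"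
  using mod_hom_zero[OF Cmp_linear_right[OF assms]] Hom_module assms by simp

lemma koszul_zero: "x \<in> Obj A \<Longrightarrow> y \<in> Obj A \<Longrightarrow> koszul (HomD A x y i) p \<zero>\<^bsub>HomD A x y i\<^esub> = \<zero>\<^bsub>HomD A x y i\<^esub>"
proof -
  assume "x \<in> Obj A" "y \<in> Obj A"
  then interpret M: module R "HomD A x y i" by (rule Hom_module)
  show ?thesis by (simp add: koszul_def)
qed

lemma Cmp_cycles:
  assumes xyz: "x \<in> Obj A" "y \<in> Obj A" "z \<in> Obj A"
    and "g \<in> cycles (Hom A y z) p" "f \<in> cycles (Hom A x y) q"
  shows "Cmp A x y z p q g f \<in> cycles (Hom A x z) (p + q)"
proof -
  have g: "g \<in> carrier (HomD A y z p)" "dif A y z p g = \<zero>\<^bsub>HomD A y z (p - 1)\<^esub>"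
    and f: "f \<in> carrier (HomD A x y q)" "dif A x y q f = \<zero>\<^bsub>HomD A x y (q - 1)\<^esub>"
    using assms by (auto simp: cycles_def)
  interpret M: module R "HomD A x z (p + q - 1)" using xyz by (rule_tac Hom_module)
  \<comment> \<open>Degrees are arguments of \<open>Cmp\<close> and \<open>HomD\<close>, so the two
    ways in which the total degree drops by one must be brought to the form used in the Leibniz
    rule.\<close>
  have *: "p - 1 + q = p + q - 1" "p + (q - 1) = p + q - 1" by auto
  have "Cmp A x y z (p - 1) q \<zero>\<^bsub>HomD A y z (p - 1)\<^esub> f = \<zero>\<^bsub>HomD A x z (p + q - 1)\<^esub>"
    "Cmp A x y z p (q - 1) g \<zero>\<^bsub>HomD A x y (q - 1)\<^esub> = \<zero>\<^bsub>HomD A x z (p + q - 1)\<^esub>"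
    using Cmp_zero_left[OF xyz f(1), of "p - 1"] Cmp_zero_right[OF xyz g(1), of "q - 1"]
    unfolding * by auto
  then show ?thesis
    using Leibniz[OF xyz g(1) f(1)] g f Cmp_closed[OF xyz g(1) f(1)] koszul_zero[OF xyz(1,3)]
    by (simp add: cycles_def)
qed

text \<open>If \<open>g\<close> is the differential of \<open>e\<close>, the Leibniz rule turns
  \<open>g f\<close> into the differential of \<open>e f\<close>: the term with the differential of
  \<open>f\<close> vanishes.\<close>

lemma Cmp_boundaries_left:
  assumes xyz: "x \<in> Obj A" "y \<in> Obj A" "z \<in> Obj A"
    and g: "g \<in> boundaries (Hom A y z) p" and f: "f \<in> cycles (Hom A x y) q"
  shows "Cmp A x y z p q g f \<in> boundaries (Hom A x z) (p + q)"
proof -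
  obtain e where e: "e \<in> carrier (HomD A y z (p + 1))" "g = dif A y z (p + 1) e"
    using g by (auto simp: boundaries_def)
  have gc: "g \<in> carrier (HomD A y z p)"
    using chain_complex.boundaries_closed[OF Hom_complex[OF xyz(2,3)] g] .
  have f: "f \<in> carrier (HomD A x y q)" "dif A x y q f = \<zero>\<^bsub>HomD A x y (q - 1)\<^esub>"
    using f by (auto simp: cycles_def)
  interpret M: module R "HomD A x z (p + q)" using xyz by (rule_tac Hom_module)
  have *: "p + 1 + q = p + q + 1" "p + 1 + (q - 1) = p + q" by auto
  have z: "Cmp A x y z (p + 1) (q - 1) e \<zero>\<^bsub>HomD A x y (q - 1)\<^esub> = \<zero>\<^bsub>HomD A x z (p + q)\<^esub>"
    using Cmp_zero_right[OF xyz e(1), of "q - 1"] unfolding * .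
  have "dif A x z (p + q + 1) (Cmp A x y z (p + 1) q e f) = Cmp A x y z p q g f"
    using Leibniz[OF xyz e(1) f(1)] f e(2) z koszul_zero[OF xyz(1,3)] Cmp_closed[OF xyz gc f(1)]
    by (simp add: *)
  then show ?thesis
    using Cmp_closed[OF xyz e(1) f(1)] unfolding boundaries_def * by (metis imageI)
qed

text \<open>Here the Leibniz rule yields the composite only up to the sign given by the degree
  \<open>p\<close> of \<open>g\<close>; boundaries are closed under negation, so the sign is
  harmless.\<close>

lemma Cmp_boundaries_right:
  assumes xyz: "x \<in> Obj A" "y \<in> Obj A" "z \<in> Obj A"
    and g: "g \<in> cycles (Hom A y z) p" and f: "f \<in> boundaries (Hom A x y) q"
  shows "Cmp A x y z p q g f \<in> boundaries (Hom A x z) (p + q)"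
proof -
  obtain e where e: "e \<in> carrier (HomD A x y (q + 1))" "f = dif A x y (q + 1) e"
    using f by (auto simp: boundaries_def)
  have fc: "f \<in> carrier (HomD A x y q)"
    using chain_complex.boundaries_closed[OF Hom_complex[OF xyz(1,2)] f] .
  have g: "g \<in> carrier (HomD A y z p)" "dif A y z p g = \<zero>\<^bsub>HomD A y z (p - 1)\<^esub>"
    using g by (auto simp: cycles_def)
  interpret M: module R "HomD A x z (p + q)" using xyz by (rule_tac Hom_module)
  interpret X: chain_complex R "Hom A x z" using xyz by (rule_tac Hom_complex)
  have *: "p + (q + 1) = p + q + 1" "p - 1 + (q + 1) = p + q" by auto
  have z: "Cmp A x y z (p - 1) (q + 1) \<zero>\<^bsub>HomD A y z (p - 1)\<^esub> e = \<zero>\<^bsub>HomD A x z (p + q)\<^esub>"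
    using Cmp_zero_left[OF xyz e(1), of "p - 1"] unfolding * .
  have c: "Cmp A x y z p q g f \<in> carrier (HomD A x z (p + q))"
    using Cmp_closed[OF xyz g(1) fc] .
  have "dif A x z (p + q + 1) (Cmp A x y z p (q + 1) g e) = koszul (HomD A x z (p + q)) p (Cmp A x y z p q g f)"
    using Leibniz[OF xyz g(1) e(1)] g e(2) z koszul_closed[OF M.module_axioms c]
    by (simp add: *)
  then have "koszul (HomD A x z (p + q)) p (Cmp A x y z p q g f) \<in> boundaries (Hom A x z) (p + q)"
    using Cmp_closed[OF xyz g(1) e(1)] unfolding boundaries_def * by (metis imageI)
  then show ?thesis
    using M.submoduleE(3)[OF X.boundaries_submodule] c
    by (auto simp: koszul_def split: if_splits) (metis M.M.minus_minus)
qed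

text \<open>One factor is replaced at a time: changing \<open>g\<close> by a boundary uses that
  \<open>f\<close> is a cycle, changing \<open>f\<close> uses that \<open>g'\<close> is one. The
  degrees are arbitrary because homology of degree \<open>i\<close> is later multiplied by classes
  of degree 0.\<close>

lemma hclass_Cmp_cong:
  assumes xyz: "x \<in> Obj A" "y \<in> Obj A" "z \<in> Obj A"
    and g: "g \<in> cycles (Hom A y z) p" "g' \<in> cycles (Hom A y z) p" "hclass (Hom A y z) p g = hclass (Hom A y z) p g'"
    and f: "f \<in> cycles (Hom A x y) q" "f' \<in> cycles (Hom A x y) q" "hclass (Hom A x y) q f = hclass (Hom A x y) q f'"
  shows "hclass (Hom A x z) (p + q) (Cmp A x y z p q g f) = hclass (Hom A x z) (p + q) (Cmp A x y z p q g' f')"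
proof -
  interpret X: chain_complex R "Hom A x z" using xyz by (rule_tac Hom_complex)
  interpret Y: chain_complex R "Hom A y z" using xyz by (rule_tac Hom_complex)
  interpret Z: chain_complex R "Hom A x y" using xyz by (rule_tac Hom_complex)
  note cl = g(1,2)[THEN Y.cycles_closed] f(1,2)[THEN Z.cycles_closed]
  obtain b where b: "b \<in> boundaries (Hom A y z) p" "g = b \<oplus>\<^bsub>HomD A y z p\<^esub> g'"
    using g(3) cl by (elim Y.hclass_eqE)
  obtain k where k: "k \<in> boundaries (Hom A x y) q" "f = k \<oplus>\<^bsub>HomD A x y q\<^esub> f'"
    using f(3) cl by (elim Z.hclass_eqE)
  note bk = Y.boundaries_closed[OF b(1)] Z.boundaries_closed[OF k(1)]
  have "hclass (Hom A x z) (p + q) (Cmp A x y z p q g f) = hclass (Hom A x z) (p + q) (Cmp A x y z p q g' f)"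
    using mod_hom_add[OF Cmp_linear_left[OF xyz cl(3)] bk(1) cl(2)] b(2)
    by (intro X.hclass_eqI[OF Cmp_closed[OF xyz cl(2,3)] Cmp_boundaries_left[OF xyz b(1) f(1)]]) simp
  also have "\<dots> = hclass (Hom A x z) (p + q) (Cmp A x y z p q g' f')"
    using mod_hom_add[OF Cmp_linear_right[OF xyz cl(2)] bk(2) cl(4)] k(2)
    by (intro X.hclass_eqI[OF Cmp_closed[OF xyz cl(2,4)] Cmp_boundaries_right[OF xyz g(2) k(1)]]) simp
  finally show ?thesis .
qed

lemma H0_cmp_hclass:
  assumes xyz: "x \<in> Obj A" "y \<in> Obj A" "z \<in> Obj A"
    and g: "g \<in> cycles (Hom A y z) 0" and f: "f \<in> cycles (Hom A x y) 0"
  shows "cmp (H0_cat A) x y z (hclass (Hom A y z) 0 g) (hclass (Hom A x y) 0 f)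
    = hclass (Hom A x z) 0 (Cmp A x y z 0 0 g f)"
proof -
  interpret Y: chain_complex R "Hom A y z" using xyz by (rule_tac Hom_complex)
  interpret Z: chain_complex R "Hom A x y" using xyz by (rule_tac Hom_complex)
  have "(\<Union>g'\<in>hclass (Hom A y z) 0 g. \<Union>f'\<in>hclass (Hom A x y) 0 f. hclass (Hom A x z) 0 (Cmp A x y z 0 0 g' f'))
    = hclass (Hom A x z) 0 (Cmp A x y z 0 0 g f)"
  proof (intro Y.UN_hclass Z.UN_hclass Y.cycles_closed Z.cycles_closed g f)
    fix g' f' assume *: "g' \<in> hclass (Hom A y z) 0 g" "f' \<in> hclass (Hom A x y) 0 f"
    show "hclass (Hom A x z) 0 (Cmp A x y z 0 0 g' f') = hclass (Hom A x z) 0 (Cmp A x y z 0 0 g f)"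
      using hclass_Cmp_cong[OF xyz Y.hclass_mem_cycles[OF g *(1)] g Y.hclass_of_mem[OF Y.cycles_closed[OF g] *(1)]
          Z.hclass_mem_cycles[OF f *(2)] f Z.hclass_of_mem[OF Z.cycles_closed[OF f] *(2)]]
      by simp
  qed
  then show ?thesis by (simp add: H0_cat_def)
qed

lemma obs_H0_cat [simp]: "obs (H0_cat B) = Obj B"
  and idt_H0_cat: "idt (H0_cat B) x = hclass (Hom B x x) 0 (Idt B x)"
  and arr_H0_cat: "arr (H0_cat B) x y = hclass (Hom B x y) 0 ` cycles (Hom B x y) 0"
  by (simp_all add: H0_cat_def homology_def)

lemma small_category_H0: "small_category (H0_cat A)"
proof
  fix x y z G F
  assume "x \<in> obs (H0_cat A)" "y \<in> obs (H0_cat A)" "z \<in> obs (H0_cat A)"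
    "G \<in> arr (H0_cat A) y z" "F \<in> arr (H0_cat A) x y"
  then show "cmp (H0_cat A) x y z G F \<in> arr (H0_cat A) x z"
    using Cmp_cycles[of x y z _ 0 _ 0] by (auto simp: arr_H0_cat H0_cmp_hclass)
next
  fix x assume "x \<in> obs (H0_cat A)"
  then show "idt (H0_cat A) x \<in> arr (H0_cat A) x x"
    using Idt_cycle by (simp add: arr_H0_cat idt_H0_cat)
next
  fix w x y z H G F
  assume "w \<in> obs (H0_cat A)" "x \<in> obs (H0_cat A)" "y \<in> obs (H0_cat A)" "z \<in> obs (H0_cat A)"
    "H \<in> arr (H0_cat A) y z" "G \<in> arr (H0_cat A) x y" "F \<in> arr (H0_cat A) w x"
  then show "cmp (H0_cat A) w y z H (cmp (H0_cat A) w x y G F) = cmp (H0_cat A) w x z (cmp (H0_cat A) x y z H G) F"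
    using Cmp_cycles[of _ _ _ _ 0 _ 0] Cmp_assoc[of w x y z _ 0 _ 0 _ 0]
    by (auto simp: arr_H0_cat H0_cmp_hclass cycles_def)
next
  fix x y F assume "x \<in> obs (H0_cat A)" "y \<in> obs (H0_cat A)" "F \<in> arr (H0_cat A) x y"
  then show "cmp (H0_cat A) x x y F (idt (H0_cat A) x) = F"
    and "cmp (H0_cat A) x y y (idt (H0_cat A) y) F = F"
    using Idt_cycle Cmp_Idt_left Cmp_Idt_right
    by (auto simp: arr_H0_cat idt_H0_cat H0_cmp_hclass cycles_def)
qed

text \<open>Let cycles \<open>a\<close>, \<open>b\<close> lead from the primed objects to
  \<open>x\<close>, \<open>y\<close>, and \<open>a'\<close>, \<open>b'\<close> back, with
  \<open>a a'\<close> and \<open>b b'\<close> homologous to identities. A cycle \<open>c\<close>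
  from \<open>x\<close> to \<open>y\<close> is homologous to \<open>b (b' c a) a'\<close>. The inner
  cycle runs from \<open>x'\<close> to \<open>y'\<close>, so it is a boundary, and composing with
  cycles keeps it one.\<close>

lemma homology_zero_transport:
  assumes obj: "x \<in> Obj A" "y \<in> Obj A" "x' \<in> Obj A" "y' \<in> Obj A"
    and "isomorphism_in (H0_cat A) x' x \<alpha>" "isomorphism_in (H0_cat A) y' y \<beta>"
    and van: "homology_zero (Hom A x' y') i"
  shows "homology_zero (Hom A x y) i"
proof -
  obtain a a' where a: "a \<in> cycles (Hom A x' x) 0" "a' \<in> cycles (Hom A x x') 0"
    "hclass (Hom A x x) 0 (Cmp A x x' x 0 0 a a') = hclass (Hom A x x) 0 (Idt A x)"
    using assms(5) obj by (auto simp: isomorphism_in_def arr_H0_cat idt_H0_cat H0_cmp_hclass)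
  obtain b b' where b: "b \<in> cycles (Hom A y' y) 0" "b' \<in> cycles (Hom A y y') 0"
    "hclass (Hom A y y) 0 (Cmp A y y' y 0 0 b b') = hclass (Hom A y y) 0 (Idt A y)"
    using assms(6) obj by (auto simp: isomorphism_in_def arr_H0_cat idt_H0_cat H0_cmp_hclass)
  interpret X: chain_complex R "Hom A x y" using obj by (rule_tac Hom_complex)
  interpret X': chain_complex R "Hom A x' y'" using obj by (rule_tac Hom_complex)
  show ?thesis
    unfolding X.homology_zero_iff
  proof
    fix c assume c: "c \<in> cycles (Hom A x y) i"
    note [simp] = obj
    have carr: "\<And>x y f i. f \<in> cycles (Hom A x y) i \<Longrightarrow> f \<in> carrier (HomD A x y i)" by (simp add: cycles_def)
    let ?ca = "Cmp A x' x y i 0 c a"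
    let ?m = "Cmp A x' y y' 0 i b' ?ca"
    have ca: "?ca \<in> cycles (Hom A x' y) i" using Cmp_cycles[of x' x y c i a 0] c a by simp
    have m: "?m \<in> cycles (Hom A x' y') i" using Cmp_cycles[of x' y y' b' 0 ?ca i] ca b by simp
    then have "?m \<in> boundaries (Hom A x' y') i" using van X'.homology_zero_iff by blast
    then have "Cmp A x' y' y 0 i b ?m \<in> boundaries (Hom A x' y) i"
      using Cmp_boundaries_right[of x' y' y b 0 ?m i] b by simp
    then have bd: "Cmp A x x' y i 0 (Cmp A x' y' y 0 i b ?m) a' \<in> boundaries (Hom A x y) i"
      using Cmp_boundaries_left[of x x' y _ i a' 0] a by simp
    \<comment> \<open>Reassociation turns the boundary just found into
      \<open>(b b') (c (a a'))\<close>, where both inner composites can be replaced by identities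
      without changing the class.\<close>
    let ?bb = "Cmp A y y' y 0 0 b b'" and ?aa = "Cmp A x x' x 0 0 a a'"
    have bb: "?bb \<in> cycles (Hom A y y) 0" and aa: "?aa \<in> cycles (Hom A x x) 0"
      using Cmp_cycles[of y y' y b 0 b' 0] Cmp_cycles[of x x' x a 0 a' 0] a b by simp_all
    have "Cmp A x' y' y 0 i b ?m = Cmp A x' y y 0 i ?bb ?ca"
      using Cmp_assoc[of x' y y' y b 0 b' 0 ?ca i] a b ca carr by simp
    also have "Cmp A x x' y i 0 \<dots> a' = Cmp A x y y 0 i ?bb (Cmp A x x' y i 0 ?ca a')"
      using Cmp_assoc[of x x' y y ?bb 0 ?ca i a' 0] a bb ca carr by simp
    also have "Cmp A x x' y i 0 ?ca a' = Cmp A x x y i 0 c ?aa"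
      using Cmp_assoc[of x x' x y c i a 0 a' 0] a c carr by simp
    finally have eq: "Cmp A x x' y i 0 (Cmp A x' y' y 0 i b ?m) a' = Cmp A x y y 0 i ?bb (Cmp A x x y i 0 c ?aa)" .
    have caa: "Cmp A x x y i 0 c ?aa \<in> cycles (Hom A x y) i"
      using Cmp_cycles[of x x y c i ?aa 0] c aa by simp
    have "hclass (Hom A x y) i (Cmp A x x y i 0 c ?aa) = hclass (Hom A x y) i (Cmp A x x y i 0 c (Idt A x))"
      using hclass_Cmp_cong[of x x y c i c ?aa 0 "Idt A x"] c aa a Idt_cycle by simp
    then have "hclass (Hom A x y) i (Cmp A x x y i 0 c ?aa) = hclass (Hom A x y) i c"
      using Cmp_Idt_right[of x y c i] c carr by simp
    moreover have "hclass (Hom A x y) i (Cmp A x y y 0 i ?bb (Cmp A x x y i 0 c ?aa)) =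
      hclass (Hom A x y) i (Cmp A x y y 0 i (Idt A y) c)"
      using hclass_Cmp_cong[of x y y ?bb 0 "Idt A y" "Cmp A x x y i 0 c ?aa" i c] c caa bb b Idt_cycle calculation by simp
    ultimately have "hclass (Hom A x y) i (Cmp A x y y 0 i ?bb (Cmp A x x y i 0 c ?aa)) = hclass (Hom A x y) i c"
      using Cmp_Idt_left[of x y c i] c carr by simp
    moreover have "hclass (Hom A x y) i (Cmp A x y y 0 i ?bb (Cmp A x x y i 0 c ?aa)) = boundaries (Hom A x y) i"
      using bd[unfolded eq] X.hclass_eq_boundaries_iff X.boundaries_closed by blast
    ultimately show "c \<in> boundaries (Hom A x y) i"
      using X.hclass_eq_boundaries_iff[of c i] c carr by simp
  qed
qed

end

section \<open>dg functors and the functors they induce on homotopy categories\<close>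

locale dg_hom = A: dg_category R A + B: dg_category R B
  for R :: "('r, 's) ring_scheme" (structure)
    and A :: "('o, 'r, 'm) dgcat" and B :: "('p, 'r, 'n) dgcat" +
  fixes F :: "('o, 'm, 'p, 'n) dgfun"
  assumes dg_functor: "dg_functor R A B F"
begin

lemma obj: "x \<in> Obj A \<Longrightarrow> onObj F x \<in> Obj B"
  using dg_functor by (simp add: dg_functor_def)

lemma complex_hom:
  assumes "x \<in> Obj A" "y \<in> Obj A"
  shows "complex_hom R (Hom A x y) (Hom B (onObj F x) (onObj F y)) (onHom F x y)"
  using assms dg_functor
  by (intro complex_hom.intro complex_hom_axioms.intro A.Hom_complex B.Hom_complex obj)
    (auto simp: dg_functor_def)

lemma hom:
  assumes "x \<in> Obj A" "y \<in> Obj A"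
  shows "onHom F x y i \<in> mod_hom R (HomD A x y i) (HomD B (onObj F x) (onObj F y) i)"
  by (rule complex_hom.hom[OF complex_hom[OF assms]])

lemma closed:
  assumes "x \<in> Obj A" "y \<in> Obj A" "f \<in> carrier (HomD A x y i)"
  shows "onHom F x y i f \<in> carrier (HomD B (onObj F x) (onObj F y) i)"
  by (rule mod_hom_closed[OF hom[OF assms(1,2)] assms(3)])

lemma dif:
  assumes "x \<in> Obj A" "y \<in> Obj A" "f \<in> carrier (HomD A x y i)"
  shows "onHom F x y (i - 1) (dif A x y i f) = dif B (onObj F x) (onObj F y) i (onHom F x y i f)"
  by (rule complex_hom.bdry[OF complex_hom[OF assms(1,2)] assms(3)])

lemma Cmp:
  assumes "x \<in> Obj A" "y \<in> Obj A" "z \<in> Obj A" "g \<in> carrier (HomD A y z p)" "f \<in> carrier (HomD A x y q)"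
  shows "onHom F x z (p + q) (Cmp A x y z p q g f) =
    Cmp B (onObj F x) (onObj F y) (onObj F z) p q (onHom F y z p g) (onHom F x y q f)"
  using dg_functor assms by (simp add: dg_functor_def)

lemma Idt: "x \<in> Obj A \<Longrightarrow> onHom F x x 0 (Idt A x) = Idt B (onObj F x)"
  using dg_functor by (simp add: dg_functor_def)

lemma far_H0_hclass:
  assumes "x \<in> Obj A" "y \<in> Obj A" "f \<in> cycles (Hom A x y) 0"
  shows "far (H0_functor B F) x y (hclass (Hom A x y) 0 f)
    = hclass (Hom B (onObj F x) (onObj F y)) 0 (onHom F x y 0 f)"
  using complex_hom.homology_map_hclass[OF complex_hom[OF assms(1,2)], of f 0] assms(3)
  by (simp add: H0_functor_def cycles_def)

lemma fob_H0 [simp]: "fob (H0_functor B F) = onObj F"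
  by (simp add: H0_functor_def)

lemma is_functor_H0: "is_functor (H0_cat A) (H0_cat B) (H0_functor B F)"
  unfolding is_functor_def fob_H0 A.obs_H0_cat
proof (intro conjI ballI Pi_I)
  fix x assume x: "x \<in> Obj A"
  then show "onObj F x \<in> Obj B" by (rule obj)
  show "far (H0_functor B F) x x (idt (H0_cat A) x) = idt (H0_cat B) (onObj F x)"
    using x by (simp add: A.idt_H0_cat far_H0_hclass A.Idt_cycle Idt)
next
  fix x y f assume xy: "x \<in> Obj A" "y \<in> Obj A" "f \<in> arr (H0_cat A) x y"
  then show "far (H0_functor B F) x y f \<in> arr (H0_cat B) (onObj F x) (onObj F y)"
    using complex_hom.cycles[OF complex_hom] by (auto simp: A.arr_H0_cat far_H0_hclass)
next
  fix x y z G H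
  assume xyz: "x \<in> Obj A" "y \<in> Obj A" "z \<in> Obj A" "G \<in> arr (H0_cat A) y z" "H \<in> arr (H0_cat A) x y"
  then obtain g h where gh: "G = hclass (Hom A y z) 0 g" "H = hclass (Hom A x y) 0 h"
    "g \<in> cycles (Hom A y z) 0" "h \<in> cycles (Hom A x y) 0"
    by (auto simp: A.arr_H0_cat)
  have "Cmp A x y z 0 0 g h \<in> cycles (Hom A x z) 0" using A.Cmp_cycles[of x y z g 0 h 0] xyz gh by simp
  moreover have "onHom F y z 0 g \<in> cycles (Hom B (onObj F y) (onObj F z)) 0"
    "onHom F x y 0 h \<in> cycles (Hom B (onObj F x) (onObj F y)) 0"
    using complex_hom.cycles[OF complex_hom] xyz gh by auto
  ultimately show "far (H0_functor B F) x z (cmp (H0_cat A) x y z G H) =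
     cmp (H0_cat B) (onObj F x) (onObj F y) (onObj F z) (far (H0_functor B F) y z G) (far (H0_functor B F) x y H)"
    using xyz gh Cmp[of x y z g 0 h 0]
    by (simp add: A.H0_cmp_hclass B.H0_cmp_hclass far_H0_hclass obj cycles_def)
qed

text \<open>By definition of \<open>H0_cat\<close>, a homology isomorphism in degree 0 is a
  bijection on arrows of the homotopy categories, that is, full faithfulness.\<close>

lemma equivalence_H0I:
  assumes "\<And>x y. x \<in> Obj A \<Longrightarrow> y \<in> Obj A \<Longrightarrow>
      homology_iso_at R (Hom A x y) (Hom B (onObj F x) (onObj F y)) (onHom F x y) 0"
    and "\<And>y. y \<in> Obj B \<Longrightarrow> \<exists>x\<in>Obj A. \<exists>e. isomorphism_in (H0_cat B) (onObj F x) y e"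
  shows "equivalence_of_categories (H0_cat A) (H0_cat B) (H0_functor B F)"
proof (rule equivalence_of_categoriesI[OF A.small_category_H0 B.small_category_H0 is_functor_H0])
  fix x y assume "x \<in> obs (H0_cat A)" "y \<in> obs (H0_cat A)"
  then show "bij_betw (far (H0_functor B F) x y) (arr (H0_cat A) x y)
       (arr (H0_cat B) (fob (H0_functor B F) x) (fob (H0_functor B F) y))"
    using assms(1) by (simp add: H0_functor_def H0_cat_def homology_iso_at_def mod_iso_def)
qed (use assms(2) in auto)

lemma isomorphism_H0:
  "x \<in> Obj A \<Longrightarrow> y \<in> Obj A \<Longrightarrow> isomorphism_in (H0_cat A) x y e \<Longrightarrow>
    \<exists>e'. isomorphism_in (H0_cat B) (onObj F x) (onObj F y) e'"
  using functor_isomorphism_in[OF is_functor_H0, of x y e] by auto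

end

section \<open>Quotients of dg categories\<close>

definition dg_id :: "('o, 'm, 'o, 'm) dgfun"
  where "dg_id = \<lparr>onObj = (\<lambda>x. x), onHom = (\<lambda>x y i f. f)\<rparr>"

lemma dg_compose_dg_id [simp]: "dg_compose F dg_id = F" "dg_compose dg_id F = F"
  by (simp_all add: dg_compose_def dg_id_def)

lemma dg_hom_compose:
  assumes F: "dg_hom R A B F" and G: "dg_hom R B C G"
  shows "dg_hom R A C (dg_compose G F)"
proof -
  interpret F: dg_hom R A B F by fact
  interpret G: dg_hom R B C G by fact
  show ?thesis
  proof
    show "dg_functor R A C (dg_compose G F)"
      unfolding dg_functor_def dg_compose_def dgfun.simps
      using chain_map_compose[OF complex_hom.chain_map[OF F.complex_hom] complex_hom.chain_map[OF G.complex_hom]]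
      by (auto simp: F.obj G.obj F.closed F.Cmp G.Cmp F.Idt G.Idt)
  qed
qed

text \<open>\<open>B\<close> is only a record. Each axiom speaks about elements that are images
  under \<open>Q\<close>, and \<open>Q\<close> respects all the structure, so \<open>B\<close>
  inherits the axioms from \<open>A\<close>. Showing that a quotient is a dg category thus comes
  down to its operations being well defined on cosets.\<close>

lemma dg_category_surj_image:
  assumes "dg_category R A" and Obj: "Obj B = Obj A"
    and hom: "\<And>x y i. x \<in> Obj A \<Longrightarrow> y \<in> Obj A \<Longrightarrow> Q x y i \<in> mod_hom R (HomD A x y i) (HomD B x y i)"
    and zero: "\<And>x y i. x \<in> Obj A \<Longrightarrow> y \<in> Obj A \<Longrightarrow> Q x y i \<zero>\<^bsub>HomD A x y i\<^esub> = \<zero>\<^bsub>HomD B x y i\<^esub>"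
    and surj: "\<And>x y i. x \<in> Obj A \<Longrightarrow> y \<in> Obj A \<Longrightarrow> Q x y i ` carrier (HomD A x y i) = carrier (HomD B x y i)"
    and dif: "\<And>x y i f. x \<in> Obj A \<Longrightarrow> y \<in> Obj A \<Longrightarrow> f \<in> carrier (HomD A x y i) \<Longrightarrow>
      Q x y (i - 1) (dif A x y i f) = dif B x y i (Q x y i f)"
    and Cmp: "\<And>x y z p q g f. x \<in> Obj A \<Longrightarrow> y \<in> Obj A \<Longrightarrow> z \<in> Obj A \<Longrightarrow>
      g \<in> carrier (HomD A y z p) \<Longrightarrow> f \<in> carrier (HomD A x y q) \<Longrightarrow>
      Q x z (p + q) (Cmp A x y z p q g f) = Cmp B x y z p q (Q y z p g) (Q x y q f)"
    and Idt: "\<And>x. x \<in> Obj A \<Longrightarrow> Q x x 0 (Idt A x) = Idt B x"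
  shows "dg_hom R A B \<lparr>onObj = (\<lambda>x. x), onHom = Q\<rparr>"
proof -
  interpret A: dg_category R A by fact
  have mod: "module R (HomD B x y i)" if "x \<in> Obj A" "y \<in> Obj A" for x y i
    using module_surj_image[OF A.Hom_module hom zero surj] that by blast
  have cl: "Q x y i f \<in> carrier (HomD B x y i)" if "x \<in> Obj A" "y \<in> Obj A" "f \<in> carrier (HomD A x y i)" for x y i f
    using mod_hom_closed[OF hom] that by blast
  have rep: "\<exists>u\<in>carrier (HomD A x y i). f = Q x y i u"
    if "x \<in> Obj A" "y \<in> Obj A" "f \<in> carrier (HomD B x y i)" for x y i f
    using surj[OF that(1,2)] that(3) by auto
  have add: "Q x y i f \<oplus>\<^bsub>HomD B x y i\<^esub> Q x y i g = Q x y i (f \<oplus>\<^bsub>HomD A x y i\<^esub> g)"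
    if "x \<in> Obj A" "y \<in> Obj A" "f \<in> carrier (HomD A x y i)" "g \<in> carrier (HomD A x y i)" for x y i f g
    using mod_hom_add[OF hom[OF that(1,2)]] that by simp
  have smult: "r \<odot>\<^bsub>HomD B x y i\<^esub> Q x y i f = Q x y i (r \<odot>\<^bsub>HomD A x y i\<^esub> f)"
    if "x \<in> Obj A" "y \<in> Obj A" "f \<in> carrier (HomD A x y i)" "r \<in> carrier R" for x y i f r
    using mod_hom_smult[OF hom[OF that(1,2)]] that by simp
  have cx: "chain_complex R (Hom B x y)" if xy: "x \<in> Obj A" "y \<in> Obj A" for x y
  proof -
    interpret C: chain_complex R "Hom A x y" using xy by (rule A.Hom_complex)
    show ?thesis
    proof (intro chain_complex.intro chain_complex_axioms.intro)
      show "cring R" by (rule A.is_cring)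
      show "module R (HomD B x y i)" for i by (rule mod[OF xy])
      show "dif B x y i \<in> mod_hom R (HomD B x y i) (HomD B x y (i - 1))" for i
      proof (rule mod_homI)
        interpret M: module R "HomD A x y i" by (rule C.chains_module)
        fix f assume "f \<in> carrier (HomD B x y i)"
        then obtain u where u: "u \<in> carrier (HomD A x y i)" "f = Q x y i u" using rep xy by blast
        then show "dif B x y i f \<in> carrier (HomD B x y (i - 1))"
          using cl[OF xy C.bdry_closed[OF u(1)]] by (simp add: dif xy)
        fix r assume r: "r \<in> carrier R"
        show "dif B x y i (r \<odot>\<^bsub>HomD B x y i\<^esub> f) = r \<odot>\<^bsub>HomD B x y (i - 1)\<^esub> dif B x y i f"
          using u r xy C.bdry_closed
          by (simp add: smult mod_hom_smult[OF C.bdry_hom] flip: dif)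
      next
        interpret M: module R "HomD A x y i" by (rule C.chains_module)
        fix f g assume "f \<in> carrier (HomD B x y i)" "g \<in> carrier (HomD B x y i)"
        then obtain u v where "u \<in> carrier (HomD A x y i)" "f = Q x y i u"
          "v \<in> carrier (HomD A x y i)" "g = Q x y i v" using rep xy by metis
        then show "dif B x y i (f \<oplus>\<^bsub>HomD B x y i\<^esub> g) = dif B x y i f \<oplus>\<^bsub>HomD B x y (i - 1)\<^esub> dif B x y i g"
          using xy C.bdry_closed
          by (simp add: add mod_hom_add[OF C.bdry_hom] flip: dif)
      qed
      fix i f assume "f \<in> carrier (HomD B x y i)"
      then obtain u where u: "u \<in> carrier (HomD A x y i)" "f = Q x y i u" using rep xy by blast
      have "dif B x y (i - 1) (dif B x y i f) = Q x y (i - 1 - 1) (dif A x y (i - 1) (dif A x y i u))"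
        using u xy C.bdry_closed by (simp flip: dif)
      then show "dif B x y (i - 1) (dif B x y i f) = \<zero>\<^bsub>HomD B x y (i - 2)\<^esub>"
        using C.bdry_bdry[OF u(1)] zero[OF xy, of "i - 2"] by simp
    qed
  qed
  have kos: "koszul (HomD B x y i) p (Q x y i f) = Q x y i (koszul (HomD A x y i) p f)"
    if "x \<in> Obj A" "y \<in> Obj A" "f \<in> carrier (HomD A x y i)" for x y i p f
    using mod_hom_koszul[OF hom A.Hom_module mod] that by simp
  have "dg_category R B"
  proof (intro dg_category.intro dg_category_axioms.intro)
    show "cring R" by (rule A.is_cring)
    show "chain_complex R (Hom B x y)" if "x \<in> Obj B" "y \<in> Obj B" for x y
      using cx that Obj by simp
  next
    fix x y z p q f assume "x \<in> Obj B" "y \<in> Obj B" "z \<in> Obj B" and f: "f \<in> carrier (HomD B x y q)"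
    then have xyz: "x \<in> Obj A" "y \<in> Obj A" "z \<in> Obj A" by (simp_all add: Obj)
    obtain u where u: "u \<in> carrier (HomD A x y q)" "f = Q x y q u" using rep xyz f by blast
    interpret M: module R "HomD A y z p" using xyz by (rule_tac A.Hom_module)
    show "(\<lambda>g. Cmp B x y z p q g f) \<in> mod_hom R (HomD B y z p) (HomD B x z (p + q))"
    proof (rule mod_homI)
      fix g assume "g \<in> carrier (HomD B y z p)"
      then obtain v where v: "v \<in> carrier (HomD A y z p)" "g = Q y z p v" using rep xyz by blast
      show "Cmp B x y z p q g f \<in> carrier (HomD B x z (p + q))"
        using u v xyz cl A.Cmp_closed by (simp flip: Cmp)
      fix r assume r: "r \<in> carrier R"
      show "Cmp B x y z p q (r \<odot>\<^bsub>HomD B y z p\<^esub> g) f = r \<odot>\<^bsub>HomD B x z (p + q)\<^esub> Cmp B x y z p q g f"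
        using u v r xyz A.Cmp_closed
        by (simp add: smult mod_hom_smult[OF A.Cmp_linear_left] flip: Cmp)
    next
      fix g h assume "g \<in> carrier (HomD B y z p)" "h \<in> carrier (HomD B y z p)"
      then obtain v w where v: "v \<in> carrier (HomD A y z p)" "g = Q y z p v"
        "w \<in> carrier (HomD A y z p)" "h = Q y z p w" using rep xyz by metis
      show "Cmp B x y z p q (g \<oplus>\<^bsub>HomD B y z p\<^esub> h) f =
          Cmp B x y z p q g f \<oplus>\<^bsub>HomD B x z (p + q)\<^esub> Cmp B x y z p q h f"
        using u v xyz A.Cmp_closed
        by (simp add: add mod_hom_add[OF A.Cmp_linear_left] flip: Cmp)
    qed
  next
    fix x y z p q f assume "x \<in> Obj B" "y \<in> Obj B" "z \<in> Obj B" and f: "f \<in> carrier (HomD B y z p)"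
    then have xyz: "x \<in> Obj A" "y \<in> Obj A" "z \<in> Obj A" by (simp_all add: Obj)
    obtain u where u: "u \<in> carrier (HomD A y z p)" "f = Q y z p u" using rep xyz f by blast
    interpret M: module R "HomD A x y q" using xyz by (rule_tac A.Hom_module)
    show "(\<lambda>g. Cmp B x y z p q f g) \<in> mod_hom R (HomD B x y q) (HomD B x z (p + q))"
    proof (rule mod_homI)
      fix g assume "g \<in> carrier (HomD B x y q)"
      then obtain v where v: "v \<in> carrier (HomD A x y q)" "g = Q x y q v" using rep xyz by blast
      show "Cmp B x y z p q f g \<in> carrier (HomD B x z (p + q))"
        using u v xyz cl A.Cmp_closed by (simp flip: Cmp)
      fix r assume r: "r \<in> carrier R"
      show "Cmp B x y z p q f (r \<odot>\<^bsub>HomD B x y q\<^esub> g) = r \<odot>\<^bsub>HomD B x z (p + q)\<^esub> Cmp B x y z p q f g"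
        using u v r xyz A.Cmp_closed
        by (simp add: smult mod_hom_smult[OF A.Cmp_linear_right] flip: Cmp)
    next
      fix g h assume "g \<in> carrier (HomD B x y q)" "h \<in> carrier (HomD B x y q)"
      then obtain v w where v: "v \<in> carrier (HomD A x y q)" "g = Q x y q v"
        "w \<in> carrier (HomD A x y q)" "h = Q x y q w" using rep xyz by metis
      show "Cmp B x y z p q f (g \<oplus>\<^bsub>HomD B x y q\<^esub> h) =
          Cmp B x y z p q f g \<oplus>\<^bsub>HomD B x z (p + q)\<^esub> Cmp B x y z p q f h"
        using u v xyz A.Cmp_closed
        by (simp add: add mod_hom_add[OF A.Cmp_linear_right] flip: Cmp)
    qed
  next
    fix x y z p q g f assume "x \<in> Obj B" "y \<in> Obj B" "z \<in> Obj B"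
      and gf: "g \<in> carrier (HomD B y z p)" "f \<in> carrier (HomD B x y q)"
    then have xyz: "x \<in> Obj A" "y \<in> Obj A" "z \<in> Obj A" by (simp_all add: Obj)
    obtain u v where u: "u \<in> carrier (HomD A x y q)" "f = Q x y q u"
      and v: "v \<in> carrier (HomD A y z p)" "g = Q y z p v" using rep xyz gf by metis
    have d: "dif A x y q u \<in> carrier (HomD A x y (q - 1))" "dif A y z p v \<in> carrier (HomD A y z (p - 1))"
      using chain_complex.bdry_closed[OF A.Hom_complex] u v xyz by blast+
    have 1: "Cmp B x y z (p - 1) q (dif B y z p g) f = Q x z (p + q - 1) (Cmp A x y z (p - 1) q (dif A y z p v) u)"
      using Cmp[OF xyz d(2) u(1)] xyz u v by (simp add: dif algebra_simps)
    have 2: "Cmp B x y z p (q - 1) g (dif B x y q f) = Q x z (p + q - 1) (Cmp A x y z p (q - 1) v (dif A x y q u))"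
      using Cmp[OF xyz v(1) d(1)] xyz u v by (simp add: dif algebra_simps)
    have 3: "dif B x z (p + q) (Cmp B x y z p q g f) = Q x z (p + q - 1) (dif A x z (p + q) (Cmp A x y z p q v u))"
      using xyz u v A.Cmp_closed by (simp add: dif Cmp)
    have cls: "Cmp A x y z (p - 1) q (dif A y z p v) u \<in> carrier (HomD A x z (p + q - 1))"
      "Cmp A x y z p (q - 1) v (dif A x y q u) \<in> carrier (HomD A x z (p + q - 1))"
      using A.Cmp_closed[OF xyz d(2) u(1)] A.Cmp_closed[OF xyz v(1) d(1)] by (simp_all add: algebra_simps)
    show "dif B x z (p + q) (Cmp B x y z p q g f) =
            Cmp B x y z (p - 1) q (dif B y z p g) f \<oplus>\<^bsub>HomD B x z (p + q - 1)\<^esub>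
            koszul (HomD B x z (p + q - 1)) p (Cmp B x y z p (q - 1) g (dif B x y q f))"
      unfolding 1 2 3 A.Leibniz[OF xyz v(1) u(1)]
      using xyz cls koszul_closed[OF A.Hom_module] by (simp add: kos add)
  next
    fix w x y z p q r h g f assume "w \<in> Obj B" "x \<in> Obj B" "y \<in> Obj B" "z \<in> Obj B"
      and hgf: "h \<in> carrier (HomD B y z p)" "g \<in> carrier (HomD B x y q)" "f \<in> carrier (HomD B w x r)"
    then have o: "w \<in> Obj A" "x \<in> Obj A" "y \<in> Obj A" "z \<in> Obj A" by (simp_all add: Obj)
    obtain u v t where u: "u \<in> carrier (HomD A y z p)" "h = Q y z p u"
      "v \<in> carrier (HomD A x y q)" "g = Q x y q v" "t \<in> carrier (HomD A w x r)" "f = Q w x r t"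
      using rep o hgf by metis
    have "Cmp B w y z p (q + r) h (Cmp B w x y q r g f) = Q w z (p + (q + r)) (Cmp A w y z p (q + r) u (Cmp A w x y q r v t))"
      using u o A.Cmp_closed by (simp add: Cmp)
    also have "\<dots> = Q w z (p + q + r) (Cmp A w x z (p + q) r (Cmp A x y z p q u v) t)"
      using A.Cmp_assoc[OF o u(1,3,5)] by (simp add: add.assoc)
    also have "\<dots> = Cmp B w x z (p + q) r (Cmp B x y z p q h g) f"
      using u o A.Cmp_closed by (simp add: Cmp)
    finally show "Cmp B w y z p (q + r) h (Cmp B w x y q r g f) = Cmp B w x z (p + q) r (Cmp B x y z p q h g) f" .
  next
    fix x assume "x \<in> Obj B"
    then have x: "x \<in> Obj A" by (simp add: Obj)
    have "Idt A x \<in> carrier (HomD A x x 0)" "dif A x x 0 (Idt A x) = \<zero>\<^bsub>HomD A x x (0 - 1)\<^esub>"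
      using A.Idt_cycle[OF x] by (auto simp: cycles_def)
    then show "Idt B x \<in> cycles (Hom B x x) 0"
      using dif[OF x x, of "Idt A x" 0] zero[OF x x, of "0 - 1"] cl[OF x x, of "Idt A x" 0] Idt[OF x]
      by (simp add: cycles_def)
  next
    fix x y p f assume "x \<in> Obj B" "y \<in> Obj B" "f \<in> carrier (HomD B x y p)"
    then have xy: "x \<in> Obj A" "y \<in> Obj A" "f \<in> carrier (HomD B x y p)" by (simp_all add: Obj)
    obtain u where u: "u \<in> carrier (HomD A x y p)" "f = Q x y p u" using rep xy by blast
    have i: "Idt A x \<in> carrier (HomD A x x 0)" "Idt A y \<in> carrier (HomD A y y 0)"
      using A.Idt_cycle xy by (auto simp: cycles_def)
    show "Cmp B x x y p 0 f (Idt B x) = f"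
      using Cmp[of x x y u p "Idt A x" 0] xy u i A.Cmp_Idt_right[of x y u p] by (simp add: Idt)
    show "Cmp B x y y 0 p (Idt B y) f = f"
      using Cmp[of x y y "Idt A y" 0 u p] xy u i A.Cmp_Idt_left[of x y u p] by (simp add: Idt)
  qed
  then show ?thesis
    by (intro dg_hom.intro dg_hom_axioms.intro A.dg_category_axioms)
      (auto simp: dg_functor_def chain_map_def Obj hom dif Cmp Idt)
qed

section \<open>dg ideals and quotient dg categories\<close>

locale dg_ideal = dg_category R A
  for R :: "('r, 's) ring_scheme" (structure) and A :: "('o, 'r, 'm) dgcat" +
  fixes I :: "'o \<Rightarrow> 'o \<Rightarrow> int \<Rightarrow> 'm set"
  assumes ideal_submodule: "\<And>x y i. x \<in> Obj A \<Longrightarrow> y \<in> Obj A \<Longrightarrow> submodule (I x y i) R (HomD A x y i)"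
    and ideal_dif: "\<And>x y i f. x \<in> Obj A \<Longrightarrow> y \<in> Obj A \<Longrightarrow> f \<in> I x y i \<Longrightarrow> dif A x y i f \<in> I x y (i - 1)"
    and ideal_Cmp_left: "\<And>x y z p q g f. x \<in> Obj A \<Longrightarrow> y \<in> Obj A \<Longrightarrow> z \<in> Obj A \<Longrightarrow>
      g \<in> I y z p \<Longrightarrow> f \<in> carrier (HomD A x y q) \<Longrightarrow> Cmp A x y z p q g f \<in> I x z (p + q)"
    and ideal_Cmp_right: "\<And>x y z p q g f. x \<in> Obj A \<Longrightarrow> y \<in> Obj A \<Longrightarrow> z \<in> Obj A \<Longrightarrow>
      g \<in> carrier (HomD A y z p) \<Longrightarrow> f \<in> I x y q \<Longrightarrow> Cmp A x y z p q g f \<in> I x z (p + q)"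

definition dg_rep ::
  "('o, 'r, 'm) dgcat \<Rightarrow> ('o \<Rightarrow> 'o \<Rightarrow> int \<Rightarrow> 'm set) \<Rightarrow> 'o \<Rightarrow> 'o \<Rightarrow> int \<Rightarrow> 'm \<Rightarrow> 'm"
  where "dg_rep A I x y i = coset_rep (HomD A x y i) (I x y i)"

definition dg_quotient :: "('o, 'r, 'm) dgcat \<Rightarrow> ('o \<Rightarrow> 'o \<Rightarrow> int \<Rightarrow> 'm set) \<Rightarrow> ('o, 'r, 'm) dgcat"
  where "dg_quotient A I =
    \<lparr>Obj = Obj A,
     Hom = (\<lambda>x y. \<lparr>chains = (\<lambda>i. quotient_module (HomD A x y i) (I x y i)),
       bdry = (\<lambda>i f. dg_rep A I x y (i - 1) (dif A x y i f))\<rparr>),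
     Cmp = (\<lambda>x y z p q g f. dg_rep A I x z (p + q) (Cmp A x y z p q g f)),
     Idt = (\<lambda>x. dg_rep A I x x 0 (Idt A x))\<rparr>"

definition dg_proj ::
  "('o, 'r, 'm) dgcat \<Rightarrow> ('o \<Rightarrow> 'o \<Rightarrow> int \<Rightarrow> 'm set) \<Rightarrow> ('o, 'm, 'o, 'm) dgfun"
  where "dg_proj A I = \<lparr>onObj = (\<lambda>x. x), onHom = dg_rep A I\<rparr>"

lemma dg_quotient_simps [simp]:
  "Obj (dg_quotient A I) = Obj A"
  "HomD (dg_quotient A I) x y i = quotient_module (HomD A x y i) (I x y i)"
  "carrier (quotient_module M H) = coset_rep M H ` carrier M"
  "\<zero>\<^bsub>quotient_module M H\<^esub> = coset_rep M H \<zero>\<^bsub>M\<^esub>"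
  "onObj (dg_proj A I) = (\<lambda>x. x)"
  "onHom (dg_proj A I) = dg_rep A I"
  by (simp_all add: dg_quotient_def quotient_module_def dg_proj_def)

context dg_ideal
begin

lemma chains_ideal:
  "x \<in> Obj A \<Longrightarrow> y \<in> Obj A \<Longrightarrow> module_with_submodule R (HomD A x y i) (I x y i)"
  by (intro module_with_submodule.intro module_with_submodule_axioms.intro Hom_module ideal_submodule)

lemma dg_rep_decomp:
  assumes "x \<in> Obj A" "y \<in> Obj A" "f \<in> carrier (HomD A x y i)"
  obtains h where "h \<in> I x y i" "dg_rep A I x y i f = h \<oplus>\<^bsub>HomD A x y i\<^esub> f"
  using module_with_submodule.coset_rep_decomp[OF chains_ideal[OF assms(1,2)] assms(3)]
  unfolding dg_rep_def by blast

lemma dg_rep_eqI: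
  assumes "x \<in> Obj A" "y \<in> Obj A" "f \<in> carrier (HomD A x y i)" "h \<in> I x y i"
  shows "dg_rep A I x y i (h \<oplus>\<^bsub>HomD A x y i\<^esub> f) = dg_rep A I x y i f"
  using module_with_submodule.coset_eqI[OF chains_ideal[OF assms(1,2)] assms(3,4) refl]
  unfolding dg_rep_def coset_rep_def by simp

lemma dg_rep_eqE:
  assumes "dg_rep A I x y i g = dg_rep A I x y i f"
    "x \<in> Obj A" "y \<in> Obj A" "f \<in> carrier (HomD A x y i)" "g \<in> carrier (HomD A x y i)"
  obtains h where "h \<in> I x y i" "g = h \<oplus>\<^bsub>HomD A x y i\<^esub> f"
proof -
  interpret M: module_with_submodule R "HomD A x y i" "I x y i" using assms(2,3) by (rule chains_ideal)
  have "g \<in> I x y i +>\<^bsub>HomD A x y i\<^esub> f"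
    using M.self_mem_coset[OF assms(5)] assms(1) M.coset_rep_eq_iff[OF assms(5,4)] by (simp add: dg_rep_def)
  then show ?thesis using that by (auto simp: M.mem_coset)
qed

lemma dg_rep_closed:
  assumes "x \<in> Obj A" "y \<in> Obj A" "f \<in> carrier (HomD A x y i)"
  shows "dg_rep A I x y i f \<in> carrier (HomD A x y i)"
  using module_with_submodule.coset_rep_closed[OF chains_ideal[OF assms(1,2)] assms(3)]
  unfolding dg_rep_def .

lemma ideal_carrier:
  "x \<in> Obj A \<Longrightarrow> y \<in> Obj A \<Longrightarrow> h \<in> I x y i \<Longrightarrow> h \<in> carrier (HomD A x y i)"
  using module_with_submodule.sub_carrier[OF chains_ideal] .

text \<open>A representative differs from \<open>f\<close> by an element of the ideal. By the ideal
  axioms, differentials and composites then change by elements of the ideal, which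
  \<open>dg_rep\<close> does not see.\<close>

lemma dg_hom_proj: "dg_hom R A (dg_quotient A I) (dg_proj A I)"
  unfolding dg_proj_def
proof (rule dg_category_surj_image[OF dg_category_axioms])
  fix x y i assume xy: "x \<in> Obj A" "y \<in> Obj A"
  show "dg_rep A I x y i \<in> mod_hom R (HomD A x y i) (HomD (dg_quotient A I) x y i)"
    using module_with_submodule.coset_rep_hom[OF chains_ideal[OF xy]] by (simp add: dg_rep_def)
  fix f assume f: "f \<in> carrier (HomD A x y i)"
  interpret C: chain_complex R "Hom A x y" using xy by (rule Hom_complex)
  obtain h where h: "h \<in> I x y i" "dg_rep A I x y i f = h \<oplus>\<^bsub>HomD A x y i\<^esub> f"
    using dg_rep_decomp[OF xy f] .
  show "dg_rep A I x y (i - 1) (dif A x y i f) = dif (dg_quotient A I) x y i (dg_rep A I x y i f)"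
    using dg_rep_eqI[OF xy C.bdry_closed[OF f] ideal_dif[OF xy h(1)]] h(2)
      mod_hom_add[OF C.bdry_hom ideal_carrier[OF xy h(1)] f]
    by (simp add: dg_quotient_def)
next
  fix x y z p q g f
  assume xyz: "x \<in> Obj A" "y \<in> Obj A" "z \<in> Obj A"
    and g: "g \<in> carrier (HomD A y z p)" and f: "f \<in> carrier (HomD A x y q)"
  obtain h where h: "h \<in> I x y q" "dg_rep A I x y q f = h \<oplus>\<^bsub>HomD A x y q\<^esub> f"
    using dg_rep_decomp[OF xyz(1,2) f] .
  obtain k where k: "k \<in> I y z p" "dg_rep A I y z p g = k \<oplus>\<^bsub>HomD A y z p\<^esub> g"
    using dg_rep_decomp[OF xyz(2,3) g] .
  have f': "dg_rep A I x y q f \<in> carrier (HomD A x y q)" by (rule dg_rep_closed[OF xyz(1,2) f])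
  \<comment> \<open>The left factor is exchanged while the right one is still a representative, then
    the right one; each step uses linearity in one argument.\<close>
  have "dg_rep A I x z (p + q) (Cmp A x y z p q (dg_rep A I y z p g) (dg_rep A I x y q f))
    = dg_rep A I x z (p + q) (Cmp A x y z p q g (dg_rep A I x y q f))"
    using dg_rep_eqI[OF xyz(1,3) Cmp_closed[OF xyz g f'] ideal_Cmp_left[OF xyz k(1) f']] k(2)
      mod_hom_add[OF Cmp_linear_left[OF xyz f'] ideal_carrier[OF xyz(2,3) k(1)] g]
    by simp
  also have "\<dots> = dg_rep A I x z (p + q) (Cmp A x y z p q g f)"
    using dg_rep_eqI[OF xyz(1,3) Cmp_closed[OF xyz g f] ideal_Cmp_right[OF xyz g h(1)]] h(2)
      mod_hom_add[OF Cmp_linear_right[OF xyz g] ideal_carrier[OF xyz(1,2) h(1)] f]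
    by simp
  finally show "dg_rep A I x z (p + q) (Cmp A x y z p q g f) =
    Cmp (dg_quotient A I) x y z p q (dg_rep A I y z p g) (dg_rep A I x y q f)"
    by (simp add: dg_quotient_def)
qed (auto simp: dg_rep_def dg_quotient_def)

lemma dg_category_quotient: "dg_category R (dg_quotient A I)"
  using dg_hom_proj by (simp add: dg_hom_def)

text \<open>Universal property in a form suited to representatives: \<open>F\<close> must take at
  the representative of \<open>f\<close> the value of \<open>G\<close> at \<open>f\<close>. Every
  morphism of the quotient is the representative of some \<open>u\<close>, so each law for
  \<open>F\<close> is the law for \<open>G\<close> at \<open>u\<close>.\<close>

lemma dg_hom_descend:
  assumes G: "dg_hom R A B G" and "onObj F = onObj G"
    and eq: "\<And>x y i f. x \<in> Obj A \<Longrightarrow> y \<in> Obj A \<Longrightarrow> f \<in> carrier (HomD A x y i) \<Longrightarrow>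
      onHom F x y i (dg_rep A I x y i f) = onHom G x y i f"
  shows "dg_hom R (dg_quotient A I) B F"
proof -
  interpret G: dg_hom R A B G by fact
  interpret P: dg_hom R A "dg_quotient A I" "dg_proj A I" by (rule dg_hom_proj)
  note obj = assms(2)
  have rep: "\<exists>u\<in>carrier (HomD A x y i). f = dg_rep A I x y i u"
    if "f \<in> carrier (HomD (dg_quotient A I) x y i)" for x y i f
    using that by (auto simp: dg_rep_def)
  have "dg_functor R (dg_quotient A I) B F"
    unfolding dg_functor_def chain_map_def
  proof (intro conjI ballI allI)
    fix x assume "x \<in> Obj (dg_quotient A I)"
    then have x: "x \<in> Obj A" by simp
    then show "onObj F x \<in> Obj B" by (simp add: obj G.obj)
    show "onHom F x x 0 (Idt (dg_quotient A I) x) = Idt B (onObj F x)"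
      using x eq[OF x x, of "Idt A x" 0] Idt_cycle[OF x] G.Idt[OF x] P.Idt[OF x] obj
      by (simp add: cycles_def)
  next
    fix x y i assume "x \<in> Obj (dg_quotient A I)" "y \<in> Obj (dg_quotient A I)"
    then have xy: "x \<in> Obj A" "y \<in> Obj A" by simp_all
    interpret M: module R "HomD A x y i" using xy by (rule Hom_module)
    show "onHom F x y i \<in> mod_hom R (HomD (dg_quotient A I) x y i) (HomD B (onObj F x) (onObj F y) i)"
    proof (rule mod_homI)
      fix f assume "f \<in> carrier (HomD (dg_quotient A I) x y i)"
      then obtain u where u: "u \<in> carrier (HomD A x y i)" "f = dg_rep A I x y i u" using rep by blast
      then show "onHom F x y i f \<in> carrier (HomD B (onObj F x) (onObj F y) i)"
        using xy by (simp add: eq G.closed obj)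
      fix r assume r: "r \<in> carrier R"
      have "r \<odot>\<^bsub>HomD (dg_quotient A I) x y i\<^esub> f = dg_rep A I x y i (r \<odot>\<^bsub>HomD A x y i\<^esub> u)"
        using mod_hom_smult[OF P.hom[OF xy] r u(1)] u by simp
      then show "onHom F x y i (r \<odot>\<^bsub>HomD (dg_quotient A I) x y i\<^esub> f) =
          r \<odot>\<^bsub>HomD B (onObj F x) (onObj F y) i\<^esub> onHom F x y i f"
        using u r xy eq mod_hom_smult[OF G.hom[OF xy] r u(1)] by (simp add: obj)
    next
      fix f g assume "f \<in> carrier (HomD (dg_quotient A I) x y i)" "g \<in> carrier (HomD (dg_quotient A I) x y i)"
      then obtain u v where u: "u \<in> carrier (HomD A x y i)" "f = dg_rep A I x y i u"
        and v: "v \<in> carrier (HomD A x y i)" "g = dg_rep A I x y i v" using rep by meson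
      have "f \<oplus>\<^bsub>HomD (dg_quotient A I) x y i\<^esub> g = dg_rep A I x y i (u \<oplus>\<^bsub>HomD A x y i\<^esub> v)"
        using mod_hom_add[OF P.hom[OF xy] u(1) v(1)] u v by simp
      then show "onHom F x y i (f \<oplus>\<^bsub>HomD (dg_quotient A I) x y i\<^esub> g) =
          onHom F x y i f \<oplus>\<^bsub>HomD B (onObj F x) (onObj F y) i\<^esub> onHom F x y i g"
        using u v xy eq mod_hom_add[OF G.hom[OF xy] u(1) v(1)] by (simp add: obj)
    qed
    fix f assume "f \<in> carrier (HomD (dg_quotient A I) x y i)"
    then obtain u where u: "u \<in> carrier (HomD A x y i)" "f = dg_rep A I x y i u" using rep by blast
    have "dif (dg_quotient A I) x y i f = dg_rep A I x y (i - 1) (dif A x y i u)"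
      using P.dif[OF xy u(1)] u by simp
    then show "onHom F x y (i - 1) (dif (dg_quotient A I) x y i f) =
        dif B (onObj F x) (onObj F y) i (onHom F x y i f)"
      using xy u eq G.dif[OF xy u(1)] chain_complex.bdry_closed[OF Hom_complex[OF xy] u(1)]
      by (simp add: obj)
  next
    fix x y z p q g f
    assume "x \<in> Obj (dg_quotient A I)" "y \<in> Obj (dg_quotient A I)" "z \<in> Obj (dg_quotient A I)"
      and gf: "g \<in> carrier (HomD (dg_quotient A I) y z p)" "f \<in> carrier (HomD (dg_quotient A I) x y q)"
    then have xyz: "x \<in> Obj A" "y \<in> Obj A" "z \<in> Obj A" by simp_all
    obtain u v where u: "u \<in> carrier (HomD A x y q)" "f = dg_rep A I x y q u"
      and v: "v \<in> carrier (HomD A y z p)" "g = dg_rep A I y z p v" using rep gf by meson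
    have "Cmp (dg_quotient A I) x y z p q g f = dg_rep A I x z (p + q) (Cmp A x y z p q v u)"
      using P.Cmp[OF xyz v(1) u(1)] u v by simp
    then show "onHom F x z (p + q) (Cmp (dg_quotient A I) x y z p q g f) =
        Cmp B (onObj F x) (onObj F y) (onObj F z) p q (onHom F y z p g) (onHom F x y q f)"
      using xyz u v eq G.Cmp[OF xyz v(1) u(1)] Cmp_closed[OF xyz v(1) u(1)] by (simp add: obj)
  qed
  then show ?thesis
    by (intro dg_hom.intro dg_hom_axioms.intro dg_category_quotient G.B.dg_category_axioms)
qed

text \<open>Since classes are represented by morphisms, the functor induced on quotients is literally
  the composite with the projection, restricted to representatives.\<close>

lemma induced_rep:
  assumes F: "dg_hom R A B F" and J: "dg_ideal R B J"
    and IJ: "\<And>x y i f. x \<in> Obj A \<Longrightarrow> y \<in> Obj A \<Longrightarrow> f \<in> I x y i \<Longrightarrow> onHom F x y i f \<in> J (onObj F x) (onObj F y) i"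
    and f: "x \<in> Obj A" "y \<in> Obj A" "f \<in> carrier (HomD A x y i)"
  shows "onHom (dg_compose (dg_proj B J) F) x y i (dg_rep A I x y i f) = onHom (dg_compose (dg_proj B J) F) x y i f"
proof -
  interpret F: dg_hom R A B F by fact
  interpret J: dg_ideal R B J by fact
  obtain h where h: "h \<in> I x y i" "dg_rep A I x y i f = h \<oplus>\<^bsub>HomD A x y i\<^esub> f"
    using dg_rep_decomp[OF f] .
  show ?thesis
    using J.dg_rep_eqI[OF F.obj[OF f(1)] F.obj[OF f(2)] F.closed[OF f] IJ[OF f(1,2) h(1)]] h(2)
      mod_hom_add[OF F.hom[OF f(1,2)] ideal_carrier[OF f(1,2) h(1)] f(3)]
    by (simp add: dg_compose_def)
qed

text \<open>In \<open>dg_hom_descend\<close> both functors are \<open>F\<close> followed by the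
  projection, regarded once on \<open>A\<close> and once on the quotient; \<open>induced_rep\<close>
  says that they match.\<close>

lemma dg_hom_induced:
  assumes F: "dg_hom R A B F" and J: "dg_ideal R B J"
    and IJ: "\<And>x y i f. x \<in> Obj A \<Longrightarrow> y \<in> Obj A \<Longrightarrow> f \<in> I x y i \<Longrightarrow> onHom F x y i f \<in> J (onObj F x) (onObj F y) i"
  shows "dg_hom R (dg_quotient A I) (dg_quotient B J) (dg_compose (dg_proj B J) F)"
  using induced_rep[OF assms]
  by (intro dg_hom_descend[OF dg_hom_compose[OF F dg_ideal.dg_hom_proj[OF J]]]) auto

end

section \<open>Truncations\<close>

lemma good_truncation_simps:
  "add (chains (good_truncation C) i) = add (chains C i)"
  "zero (chains (good_truncation C) i) = zero (chains C i)"
  "smult (chains (good_truncation C) i) = smult (chains C i)"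
  "bdry (good_truncation C) = bdry C"
  "carrier (chains (good_truncation C) i) =
    (if i > 0 then carrier (chains C i) else if i = 0 then cycles C 0 else {\<zero>\<^bsub>chains C i\<^esub>})"
  by (simp_all add: good_truncation_def)

text \<open>Degree 0 is the critical case: there the truncated carrier is by definition the set of
  cycles.\<close>

lemma cycles_good_truncation: "i \<ge> 0 \<Longrightarrow> cycles (good_truncation C) i = cycles C i"
  by (auto simp: cycles_def good_truncation_simps)

text \<open>Boundaries of degree \<open>i\<close> come from degree \<open>i + 1 > 0\<close>, where
  the truncation changes nothing.\<close>

lemma boundaries_good_truncation: "i \<ge> 0 \<Longrightarrow> boundaries (good_truncation C) i = boundaries C i"
  by (simp add: boundaries_def good_truncation_simps)

lemma hclass_good_truncation: "i \<ge> 0 \<Longrightarrow> hclass (good_truncation C) i = hclass C i"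
  by (rule ext) (simp add: hclass_def boundaries_good_truncation a_r_coset_def' good_truncation_simps)

text \<open>The two homology records are equal, not merely isomorphic, which makes the homotopy
  categories before and after truncation literally the same in
  \<open>H0_cat_tau_ge0\<close>.\<close>

lemma homology_good_truncation:
  assumes "i \<ge> 0"
  shows "homology (good_truncation C) i = homology C i"
proof -
  have "set_add (chains (good_truncation C) i) = set_add (chains C i)"
    by (intro ext) (simp add: set_add_def' good_truncation_simps)
  then show ?thesis
    using assms by (simp add: homology_def cycles_good_truncation boundaries_good_truncation
        hclass_good_truncation good_truncation_simps)
qed

lemma homology_iso_at_good_truncation:
  assumes "i \<ge> 0"
  shows "homology_iso_at R (good_truncation C) D f i \<longleftrightarrow> homology_iso_at R C D f i"
    and "homology_iso_at R E (good_truncation C) f i \<longleftrightarrow> homology_iso_at R E C f i"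
proof -
  have "homology_map (good_truncation C) f i = homology_map C f i"
    by (rule ext) (simp add: homology_map_def hclass_good_truncation assms)
  then show "homology_iso_at R E (good_truncation C) f i \<longleftrightarrow> homology_iso_at R E C f i"
    by (simp add: homology_iso_at_def homology_good_truncation assms)
qed (simp add: homology_iso_at_def homology_good_truncation assms)

lemma homology_zero_good_truncation:
  "i \<ge> 0 \<Longrightarrow> homology_zero (good_truncation C) i \<longleftrightarrow> homology_zero C i"
  by (simp add: homology_zero_def homology_good_truncation)

lemma (in chain_complex) submodule_good_truncation:
  "submodule (carrier (chains (good_truncation C) i)) R (chains C i)"
proof -
  interpret M: module R "chains C i" by (rule chains_module)
  have "submodule {\<zero>\<^bsub>chains C i\<^esub>} R (chains C i)"
    by (rule M.submoduleI) auto
  then show ?thesis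
    using cycles_submodule M.carrier_is_submodule by (auto simp: good_truncation_simps)
qed

lemma (in chain_complex) chains_good_truncation:
  "chains (good_truncation C) i = (chains C i)\<lparr>carrier := carrier (chains (good_truncation C) i)\<rparr>"
  by (simp add: good_truncation_def)

lemma (in chain_complex) module_good_truncation: "module R (chains (good_truncation C) i)"
  using submodule.submodule_is_module[OF submodule_good_truncation chains_module]
  by (simp flip: chains_good_truncation)

lemma (in chain_complex) good_truncation_closed:
  "x \<in> carrier (chains (good_truncation C) i) \<Longrightarrow> x \<in> carrier (chains C i)"
  using module.submoduleE(1)[OF chains_module submodule_good_truncation] by blast

lemma (in chain_complex) inclusion_hom:
  "(\<lambda>x. x) \<in> mod_hom R (chains (good_truncation C) i) (chains C i)"
  by (rule mod_homI) (simp_all add: good_truncation_closed good_truncation_simps(1-3))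

text \<open>Negation is a definite description over the carrier, so shrinking the carrier could
  change it; linearity of the inclusion shows that it does not.\<close>

lemma (in chain_complex) koszul_good_truncation:
  "x \<in> carrier (chains (good_truncation C) i) \<Longrightarrow>
    koszul (chains (good_truncation C) i) p x = koszul (chains C i) p x"
  using mod_hom_koszul[OF inclusion_hom module_good_truncation chains_module] .

lemma (in chain_complex) bdry_good_truncation:
  assumes "x \<in> carrier (chains (good_truncation C) i)"
  shows "bdry C i x \<in> carrier (chains (good_truncation C) (i - 1))"
proof -
  consider "i > 1" | "i = 1" | "i = 0" | "i < 0" by linarith
  then show ?thesis
  proof cases
    \<comment> \<open>From degree 1 to degree 0 the target contains cycles only; here it matters
      that the differential squares to zero.\<close>
    case 2
    then show ?thesis
      using assms boundaries_subset_cycles[of 0] by (auto simp: good_truncation_simps boundaries_def)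
  qed (use assms bdry_closed bdry_zero in \<open>auto simp: good_truncation_simps cycles_def\<close>)
qed

lemma (in chain_complex) chain_complex_good_truncation: "chain_complex R (good_truncation C)"
proof (intro chain_complex.intro chain_complex_axioms.intro)
  show "cring R" by (rule is_cring)
  show "module R (chains (good_truncation C) i)" for i by (rule module_good_truncation)
  show "bdry (good_truncation C) i \<in> mod_hom R (chains (good_truncation C) i) (chains (good_truncation C) (i - 1))" for i
    by (rule mod_homI)
      (simp_all add: bdry_good_truncation good_truncation_simps(1-4) good_truncation_closed
        mod_hom_add[OF bdry_hom] mod_hom_smult[OF bdry_hom])
  show "bdry (good_truncation C) (i - 1) (bdry (good_truncation C) i x) = \<zero>\<^bsub>chains (good_truncation C) (i - 2)\<^esub>"
    if "x \<in> carrier (chains (good_truncation C) i)" for i x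
    using that bdry_bdry[of x i] by (simp add: good_truncation_simps(2,4) good_truncation_closed)
qed

lemma tau_ge0_simps [simp]:
  "Obj (tau_ge0 A) = Obj A"
  "Hom (tau_ge0 A) x y = good_truncation (Hom A x y)"
  "Cmp (tau_ge0 A) = Cmp A"
  "Idt (tau_ge0 A) = Idt A"
  by (simp_all add: tau_ge0_def)

lemma H0_cat_tau_ge0: "H0_cat (tau_ge0 A) = H0_cat A"
  by (simp add: H0_cat_def homology_good_truncation hclass_good_truncation)

lemma H0_functor_tau_ge0: "H0_functor (tau_ge0 B) F = H0_functor B F"
  by (simp add: H0_functor_def homology_map_def hclass_good_truncation fun_eq_iff)

context dg_category
begin

lemma tau_closed:
  "x \<in> Obj A \<Longrightarrow> y \<in> Obj A \<Longrightarrow> f \<in> carrier (HomD (tau_ge0 A) x y i) \<Longrightarrow> f \<in> carrier (HomD A x y i)"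
  using chain_complex.good_truncation_closed[OF Hom_complex] by simp

lemma tau_Cmp_closed:
  assumes xyz: "x \<in> Obj A" "y \<in> Obj A" "z \<in> Obj A"
    and g: "g \<in> carrier (HomD (tau_ge0 A) y z p)" and f: "f \<in> carrier (HomD (tau_ge0 A) x y q)"
  shows "Cmp A x y z p q g f \<in> carrier (HomD (tau_ge0 A) x z (p + q))"
proof -
  note cl = tau_closed[OF xyz(2,3) g] tau_closed[OF xyz(1,2) f]
  interpret M: module R "HomD (tau_ge0 A) x z (p + q)"
    using chain_complex.module_good_truncation[OF Hom_complex[OF xyz(1,3)]] by simp
  have z: "\<zero>\<^bsub>HomD A x z (p + q)\<^esub> \<in> carrier (HomD (tau_ge0 A) x z (p + q))"
    using M.M.zero_closed by (simp add: good_truncation_simps(2))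
  \<comment> \<open>A factor of negative degree is zero. If both degrees are 0, composites of cycles
    are cycles. If both are nonnegative with positive sum, the truncated carrier is the full
    one.\<close>
  consider "p < 0" | "q < 0" | "p = 0" "q = 0" | "p \<ge> 0" "q \<ge> 0" "p + q > 0" by linarith
  then show ?thesis
  proof cases
    case 1
    then show ?thesis using g z Cmp_zero_left[OF xyz cl(2), of p] by (simp add: good_truncation_simps(5))
  next
    case 2
    then show ?thesis using f z Cmp_zero_right[OF xyz cl(1), of q] by (simp add: good_truncation_simps(5))
  next
    case 3
    then show ?thesis using g f Cmp_cycles[OF xyz, of g 0 f 0] by (simp add: good_truncation_simps(5))
  next
    case 4
    then show ?thesis using Cmp_closed[OF xyz cl] by (simp add: good_truncation_simps(5))
  qed
qed

lemma dg_category_tau: "dg_category R (tau_ge0 A)"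
proof (intro dg_category.intro dg_category_axioms.intro)
  show "cring R" by (rule is_cring)
  show "chain_complex R (Hom (tau_ge0 A) x y)" if "x \<in> Obj (tau_ge0 A)" "y \<in> Obj (tau_ge0 A)" for x y
    using that chain_complex.chain_complex_good_truncation[OF Hom_complex] by simp
next
  fix x y z p q f
  assume "x \<in> Obj (tau_ge0 A)" "y \<in> Obj (tau_ge0 A)" "z \<in> Obj (tau_ge0 A)"
    and f: "f \<in> carrier (HomD (tau_ge0 A) x y q)"
  then have xyz: "x \<in> Obj A" "y \<in> Obj A" "z \<in> Obj A" by simp_all
  show "(\<lambda>g. Cmp (tau_ge0 A) x y z p q g f) \<in> mod_hom R (HomD (tau_ge0 A) y z p) (HomD (tau_ge0 A) x z (p + q))"
    using tau_Cmp_closed[OF xyz _ f] tau_closed[OF xyz(2,3)]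
      mod_hom_add[OF Cmp_linear_left[OF xyz tau_closed[OF xyz(1,2) f]]]
      mod_hom_smult[OF Cmp_linear_left[OF xyz tau_closed[OF xyz(1,2) f]]]
    by (intro mod_homI) (simp_all add: good_truncation_simps(1-3))
next
  fix x y z p q g
  assume "x \<in> Obj (tau_ge0 A)" "y \<in> Obj (tau_ge0 A)" "z \<in> Obj (tau_ge0 A)"
    and g: "g \<in> carrier (HomD (tau_ge0 A) y z p)"
  then have xyz: "x \<in> Obj A" "y \<in> Obj A" "z \<in> Obj A" by simp_all
  show "(\<lambda>f. Cmp (tau_ge0 A) x y z p q g f) \<in> mod_hom R (HomD (tau_ge0 A) x y q) (HomD (tau_ge0 A) x z (p + q))"
    using tau_Cmp_closed[OF xyz g] tau_closed[OF xyz(1,2)]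
      mod_hom_add[OF Cmp_linear_right[OF xyz tau_closed[OF xyz(2,3) g]]]
      mod_hom_smult[OF Cmp_linear_right[OF xyz tau_closed[OF xyz(2,3) g]]]
    by (intro mod_homI) (simp_all add: good_truncation_simps(1-3))
next
  fix x y z p q g f
  assume "x \<in> Obj (tau_ge0 A)" "y \<in> Obj (tau_ge0 A)" "z \<in> Obj (tau_ge0 A)"
    and g: "g \<in> carrier (HomD (tau_ge0 A) y z p)" and f: "f \<in> carrier (HomD (tau_ge0 A) x y q)"
  then have xyz: "x \<in> Obj A" "y \<in> Obj A" "z \<in> Obj A" by simp_all
  interpret C: chain_complex R "Hom A x z" using xyz by (rule_tac Hom_complex)
  have "dif A x y q f \<in> carrier (HomD (tau_ge0 A) x y (q - 1))"
    using chain_complex.bdry_good_truncation[OF Hom_complex[OF xyz(1,2)]] f by simp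
  then have "Cmp A x y z p (q - 1) g (dif A x y q f) \<in> carrier (chains (good_truncation (Hom A x z)) (p + q - 1))"
    using tau_Cmp_closed[OF xyz g, of "dif A x y q f" "q - 1"] by (simp add: algebra_simps)
  then show "dif (tau_ge0 A) x z (p + q) (Cmp (tau_ge0 A) x y z p q g f) =
            Cmp (tau_ge0 A) x y z (p - 1) q (dif (tau_ge0 A) y z p g) f \<oplus>\<^bsub>HomD (tau_ge0 A) x z (p + q - 1)\<^esub>
            koszul (HomD (tau_ge0 A) x z (p + q - 1)) p (Cmp (tau_ge0 A) x y z p (q - 1) g (dif (tau_ge0 A) x y q f))"
    using Leibniz[OF xyz tau_closed[OF xyz(2,3) g] tau_closed[OF xyz(1,2) f]]
    by (simp add: good_truncation_simps(1,4) C.koszul_good_truncation)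
next
  show "Idt (tau_ge0 A) x \<in> cycles (Hom (tau_ge0 A) x x) 0" if "x \<in> Obj (tau_ge0 A)" for x
    using that Idt_cycle by (simp add: cycles_good_truncation)
qed (simp_all add: Cmp_assoc Cmp_Idt_left Cmp_Idt_right chain_complex.good_truncation_closed[OF Hom_complex])

lemma dg_hom_tau_inclusion: "dg_hom R (tau_ge0 A) A dg_id"
  using chain_complex.inclusion_hom[OF Hom_complex]
  by (intro dg_hom.intro dg_hom_axioms.intro dg_category_tau dg_category_axioms)
    (simp add: dg_functor_def dg_id_def chain_map_def good_truncation_simps(4))

end

lemma positively_gradedD:
  "positively_graded A \<Longrightarrow> x \<in> Obj A \<Longrightarrow> y \<in> Obj A \<Longrightarrow> i < 0 \<Longrightarrow> carrier (HomD A x y i) = {\<zero>\<^bsub>HomD A x y i\<^esub>}"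
  by (auto simp: positively_graded_def)

text \<open>The differential of a degree 0 morphism lies in degree -1, hence is zero. Both
  \<open>dg_ideal_trunc\<close> and \<open>dg_hom_to_tau\<close> rest on this.\<close>

lemma (in dg_category) positively_graded_cycles:
  assumes "positively_graded A" "x \<in> Obj A" "y \<in> Obj A"
  shows "cycles (Hom A x y) 0 = carrier (HomD A x y 0)"
  using chain_complex.bdry_closed[OF Hom_complex[OF assms(2,3)], of _ 0]
    positively_gradedD[OF assms, of "- 1"]
  by (auto simp: cycles_def)

lemma positively_graded_homology_zero:
  assumes "dg_category R A" "positively_graded A" "x \<in> Obj A" "y \<in> Obj A" "i < 0"
  shows "homology_zero (Hom A x y) i"
proof -
  interpret A: dg_category R A by fact
  interpret C: chain_complex R "Hom A x y" using assms(3,4) by (rule A.Hom_complex)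
  have "\<zero>\<^bsub>HomD A x y i\<^esub> \<in> boundaries (Hom A x y) i"
    using module_with_submodule.sub_zero[OF C.chains_boundaries] .
  then show ?thesis
    using positively_gradedD[OF assms(2-5)] by (auto simp: C.homology_zero_iff cycles_def)
qed

text \<open>Degree 0 morphisms of \<open>A\<close> are cycles and chain maps preserve cycles, so
  \<open>F\<close> itself already takes values in the truncation.\<close>

lemma dg_hom_to_tau:
  assumes F: "dg_hom R A B F" and pos: "positively_graded A"
  shows "dg_hom R A (tau_ge0 B) F"
proof -
  interpret F: dg_hom R A B F by fact
  have cl: "onHom F x y i f \<in> carrier (chains (good_truncation (Hom B (onObj F x) (onObj F y))) i)"
    if "x \<in> Obj A" "y \<in> Obj A" "f \<in> carrier (HomD A x y i)" for x y i f
  proof -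
    interpret C: complex_hom R "Hom A x y" "Hom B (onObj F x) (onObj F y)" "onHom F x y"
      using that by (rule_tac F.complex_hom)
    consider "i > 0" | "i = 0" | "i < 0" by linarith
    then show ?thesis
      using that C.closed[OF that(3)] C.zero[of i] C.cycles[of f 0]
        F.A.positively_graded_cycles[OF pos that(1,2)] positively_gradedD[OF pos that(1,2), of i]
      by cases (auto simp: good_truncation_simps(5))
  qed
  have "dg_functor R A (tau_ge0 B) F"
    unfolding dg_functor_def chain_map_def
  proof (intro conjI ballI allI)
    fix x y i assume xy: "x \<in> Obj A" "y \<in> Obj A"
    show "onHom F x y i \<in> mod_hom R (HomD A x y i) (HomD (tau_ge0 B) (onObj F x) (onObj F y) i)"
      by (rule mod_homI) (simp_all add: cl xy good_truncation_simps(1-3)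
          mod_hom_add[OF F.hom[OF xy]] mod_hom_smult[OF F.hom[OF xy]])
  qed (simp_all add: F.obj F.dif F.Cmp F.Idt good_truncation_simps(4))
  then show ?thesis
    by (intro dg_hom.intro dg_hom_axioms.intro F.A.dg_category_axioms F.B.dg_category_tau)
qed

section \<open>The truncation above degree n as a quotient\<close>

definition trunc_ideal :: "nat \<Rightarrow> ('o, 'r, 'm) dgcat \<Rightarrow> 'o \<Rightarrow> 'o \<Rightarrow> int \<Rightarrow> 'm set"
  where "trunc_ideal n A x y i =
    (if i < int n then {\<zero>\<^bsub>HomD A x y i\<^esub>}
     else if i = int n then boundaries (Hom A x y) i else carrier (HomD A x y i))"

abbreviation tau_le :: "nat \<Rightarrow> ('o, 'r, 'm) dgcat \<Rightarrow> ('o, 'r, 'm) dgcat"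
  where "tau_le n A \<equiv> dg_quotient A (trunc_ideal n A)"

abbreviation tau_le_proj :: "nat \<Rightarrow> ('o, 'r, 'm) dgcat \<Rightarrow> ('o, 'm, 'o, 'm) dgfun"
  where "tau_le_proj n A \<equiv> dg_proj A (trunc_ideal n A)"

lemma dg_ideal_trunc:
  assumes "dg_category R A" and pos: "positively_graded A"
  shows "dg_ideal R A (trunc_ideal n A)"
proof -
  interpret dg_category R A by fact
  have zero: "\<zero>\<^bsub>HomD A x y i\<^esub> \<in> trunc_ideal n A x y i" if "x \<in> Obj A" "y \<in> Obj A" for x y i
  proof -
    interpret C: chain_complex R "Hom A x y" using that by (rule Hom_complex)
    interpret M: module_with_submodule R "HomD A x y i" "boundaries (Hom A x y) i"
      by (rule C.chains_boundaries)
    show ?thesis using M.sub_zero by (auto simp: trunc_ideal_def)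
  qed
  show ?thesis
  proof (intro dg_ideal.intro dg_ideal_axioms.intro)
    show "dg_category R A" by fact
  next
    fix x y i assume xy: "x \<in> Obj A" "y \<in> Obj A"
    interpret C: chain_complex R "Hom A x y" using xy by (rule Hom_complex)
    interpret M: module R "HomD A x y i" by (rule C.chains_module)
    have "submodule {\<zero>\<^bsub>HomD A x y i\<^esub>} R (HomD A x y i)"
      by (rule M.submoduleI) auto
    then show "submodule (trunc_ideal n A x y i) R (HomD A x y i)"
      using C.boundaries_submodule M.carrier_is_submodule by (simp add: trunc_ideal_def)
    fix f assume f: "f \<in> trunc_ideal n A x y i"
    \<comment> \<open>The threshold fits the differential: from degree \<open>n + 1\<close> it lands
      in the boundaries of degree \<open>n\<close>, and on these the next differential is
      zero.\<close>
    have "dif A x y i f \<in> boundaries (Hom A x y) (i - 1)" if "f \<in> carrier (HomD A x y i)"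
      using that by (simp add: boundaries_def)
    moreover have "dif A x y i f = \<zero>\<^bsub>HomD A x y (i - 1)\<^esub>" if "f \<in> boundaries (Hom A x y) i"
      using that C.boundaries_subset_cycles by (auto simp: cycles_def)
    ultimately show "dif A x y i f \<in> trunc_ideal n A x y (i - 1)"
      using f C.bdry_zero[of i] C.bdry_closed[of f i]
      by (auto simp: trunc_ideal_def split: if_splits)
  next
    fix x y z p q g f
    assume xyz: "x \<in> Obj A" "y \<in> Obj A" "z \<in> Obj A"
      and g: "g \<in> trunc_ideal n A y z p" and f: "f \<in> carrier (HomD A x y q)"
    have gc: "g \<in> carrier (HomD A y z p)"
      using g chain_complex.boundaries_closed[OF Hom_complex[OF xyz(2,3)]] Hom_module[OF xyz(2,3), of p]
      by (auto simp: trunc_ideal_def module_def abelian_group_def intro: abelian_monoid.zero_closed split: if_splits)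
    \<comment> \<open>If \<open>q \<ge> 0\<close> and \<open>p \<ge> n\<close>, the total degree
      exceeds \<open>n\<close> unless \<open>p = n\<close> and \<open>q = 0\<close>. In that
      critical case a boundary is composed with a degree 0 morphism, which is a cycle by
      positivity.\<close>
    consider "q < 0" | "p < int n" | "p = int n" "q = 0" | "p + q > int n" by linarith
    then show "Cmp A x y z p q g f \<in> trunc_ideal n A x z (p + q)"
    proof cases
      case 1
      then have "f = \<zero>\<^bsub>HomD A x y q\<^esub>" using positively_gradedD[OF pos xyz(1,2)] f by auto
      then show ?thesis using Cmp_zero_right[OF xyz gc] zero xyz by simp
    next
      case 2
      then show ?thesis using g Cmp_zero_left[OF xyz f] zero xyz by (simp add: trunc_ideal_def)
    next
      case 3
      then show ?thesis
        using g f Cmp_boundaries_left[OF xyz, of g p f q] positively_graded_cycles[OF pos xyz(1,2)]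
        by (simp add: trunc_ideal_def)
    next
      case 4
      then show ?thesis using Cmp_closed[OF xyz gc f] by (simp add: trunc_ideal_def)
    qed
  next
    fix x y z p q g f
    assume xyz: "x \<in> Obj A" "y \<in> Obj A" "z \<in> Obj A"
      and g: "g \<in> carrier (HomD A y z p)" and f: "f \<in> trunc_ideal n A x y q"
    have fc: "f \<in> carrier (HomD A x y q)"
      using f chain_complex.boundaries_closed[OF Hom_complex[OF xyz(1,2)]] Hom_module[OF xyz(1,2), of q]
      by (auto simp: trunc_ideal_def module_def abelian_group_def intro: abelian_monoid.zero_closed split: if_splits)
    consider "p < 0" | "q < int n" | "q = int n" "p = 0" | "p + q > int n" by linarith
    then show "Cmp A x y z p q g f \<in> trunc_ideal n A x z (p + q)"
    proof cases
      case 1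
      then have "g = \<zero>\<^bsub>HomD A y z p\<^esub>" using positively_gradedD[OF pos xyz(2,3)] g by auto
      then show ?thesis using Cmp_zero_left[OF xyz fc] zero xyz by simp
    next
      case 2
      then show ?thesis using f Cmp_zero_right[OF xyz g] zero xyz by (simp add: trunc_ideal_def)
    next
      case 3
      then show ?thesis
        using g f Cmp_boundaries_right[OF xyz, of g p f q] positively_graded_cycles[OF pos xyz(2,3)]
        by (simp add: trunc_ideal_def)
    next
      case 4
      then show ?thesis using Cmp_closed[OF xyz g fc] by (simp add: trunc_ideal_def)
    qed
  qed
qed

text \<open>Raising the threshold shrinks the ideal, so \<open>m \<ge> n\<close> suffices: below
  \<open>m\<close> the source ideal is zero, in degree \<open>m\<close> boundaries go to boundaries,
  above \<open>m\<close> the target ideal is everything. The case \<open>m = n\<close> serves the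
  comparison functors, \<open>m = n + 1\<close> the tower maps.\<close>

lemma trunc_ideal_hom:
  assumes F: "dg_hom R A B F" and "m \<ge> n" and xy: "x \<in> Obj A" "y \<in> Obj A"
    and f: "f \<in> trunc_ideal m A x y i"
  shows "onHom F x y i f \<in> trunc_ideal n B (onObj F x) (onObj F y) i"
proof -
  interpret F: dg_hom R A B F by fact
  interpret C: complex_hom R "Hom A x y" "Hom B (onObj F x) (onObj F y)" "onHom F x y"
    using xy by (rule F.complex_hom)
  interpret M: module_with_submodule R "HomD B (onObj F x) (onObj F y) i" "boundaries (Hom B (onObj F x) (onObj F y)) i"
    by (rule C.D.chains_boundaries)
  show ?thesis
    using f \<open>m \<ge> n\<close> C.zero[of i] C.boundaries[of f i] C.closed[of f i] C.C.boundaries_closed[of f i] M.sub_zero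
    by (auto simp: trunc_ideal_def split: if_splits)
qed

context
  fixes R :: "('r, 's) ring_scheme" and A :: "('o, 'r, 'm) dgcat"
  assumes dg: "dg_category R A" and pos: "positively_graded A"
begin

interpretation A: dg_category R A by (rule dg)

lemma dg_hom_tau_le_proj: "dg_hom R A (tau_le n A) (tau_le_proj n A)"
  by (rule dg_ideal.dg_hom_proj[OF dg_ideal_trunc[OF dg pos]])

text \<open>Above degree \<open>n\<close> the ideal is the whole module, so every representative is
  that of zero.\<close>

lemma homology_tau_le_zero:
  assumes xy: "x \<in> Obj A" "y \<in> Obj A" and "i > int n"
  shows "homology_zero (Hom (tau_le n A) x y) i"
proof -
  interpret P: dg_hom R A "tau_le n A" "tau_le_proj n A" by (rule dg_hom_tau_le_proj)
  interpret C: chain_complex R "Hom (tau_le n A) x y" using xy by (rule_tac P.B.Hom_complex) simp_all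
  interpret M: module_with_submodule R "HomD A x y i" "trunc_ideal n A x y i"
    using dg_ideal.chains_ideal[OF dg_ideal_trunc[OF dg pos] xy] .
  have "u = \<zero>\<^bsub>HomD (tau_le n A) x y i\<^esub>" if u: "u \<in> carrier (HomD (tau_le n A) x y i)" for u
  proof -
    obtain v where v: "v \<in> carrier (HomD A x y i)" "u = coset_rep (HomD A x y i) (trunc_ideal n A x y i) v"
      using u unfolding dg_quotient_simps by (elim imageE)
    have "v \<in> trunc_ideal n A x y i"
      using v(1) \<open>i > int n\<close> by (simp add: trunc_ideal_def)
    then show ?thesis
      unfolding v(2) dg_quotient_simps by (rule M.coset_rep_zero_iff[THEN iffD2, OF v(1)])
  qed
  moreover have "\<zero>\<^bsub>HomD (tau_le n A) x y i\<^esub> \<in> boundaries (Hom (tau_le n A) x y) i"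
    using module_with_submodule.sub_zero[OF C.chains_boundaries] .
  ultimately show ?thesis
    unfolding C.homology_zero_iff cycles_def by blast
qed

lemma homology_iso_tau_le_proj:
  assumes xy: "x \<in> Obj A" "y \<in> Obj A" and "i \<le> int n"
  shows "homology_iso_at R (Hom A x y) (Hom (tau_le n A) x y) (onHom (tau_le_proj n A) x y) i"
proof -
  interpret P: dg_hom R A "tau_le n A" "tau_le_proj n A" by (rule dg_hom_tau_le_proj)
  interpret I: dg_ideal R A "trunc_ideal n A" by (rule dg_ideal_trunc[OF dg pos])
  interpret C: complex_hom R "Hom A x y" "Hom (tau_le n A) x y" "onHom (tau_le_proj n A) x y"
    using P.complex_hom[OF xy] by simp
  interpret M: module_with_submodule R "HomD A x y i" "boundaries (Hom A x y) i"
    by (rule C.C.chains_boundaries)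
  have rep: "\<exists>v\<in>carrier (HomD A x y j). u = dg_rep A (trunc_ideal n A) x y j v"
    if "u \<in> carrier (HomD (tau_le n A) x y j)" for u j
    using that by (auto simp: dg_rep_def)
  show ?thesis
  proof (rule C.homology_iso_atI)
    fix f assume f: "f \<in> cycles (Hom A x y) i"
      and "onHom (tau_le_proj n A) x y i f \<in> boundaries (Hom (tau_le n A) x y) i"
    then obtain u where u: "u \<in> carrier (HomD (tau_le n A) x y (i + 1))"
      "dg_rep A (trunc_ideal n A) x y i f = dif (tau_le n A) x y (i + 1) u"
      by (auto simp: boundaries_def)
    obtain v where v: "v \<in> carrier (HomD A x y (i + 1))" "u = dg_rep A (trunc_ideal n A) x y (i + 1) v"
      using rep[OF u(1)] by blast
    have "dg_rep A (trunc_ideal n A) x y i f = dg_rep A (trunc_ideal n A) x y i (dif A x y (i + 1) v)"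
      using u(2) P.dif[OF xy v(1)] v(2) by simp
    moreover have dv: "dif A x y (i + 1) v \<in> boundaries (Hom A x y) i"
      using v(1) by (simp add: boundaries_def)
    ultimately obtain h where h: "h \<in> trunc_ideal n A x y i" "f = h \<oplus>\<^bsub>HomD A x y i\<^esub> dif A x y (i + 1) v"
      using I.dg_rep_eqE[OF _ xy C.C.boundaries_closed C.C.cycles_closed[OF f]] by blast
    \<comment> \<open>In degrees at most \<open>n\<close> the ideal consists of boundaries: zero
      alone below \<open>n\<close>, all boundaries in degree \<open>n\<close>.\<close>
    have "h \<in> boundaries (Hom A x y) i"
      using h(1) \<open>i \<le> int n\<close> M.sub_zero by (auto simp: trunc_ideal_def split: if_splits)
    then show "f \<in> boundaries (Hom A x y) i" unfolding h(2) using dv by (rule M.sub_add)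
  next
    fix u assume u: "u \<in> cycles (Hom (tau_le n A) x y) i"
    then obtain v where v: "v \<in> carrier (HomD A x y i)" "u = dg_rep A (trunc_ideal n A) x y i v"
      using rep C.D.cycles_closed by blast
    interpret N: module_with_submodule R "HomD A x y (i - 1)" "trunc_ideal n A x y (i - 1)"
      by (rule I.chains_ideal[OF xy])
    have dv: "dif A x y i v \<in> carrier (HomD A x y (i - 1))" by (rule C.C.bdry_closed[OF v(1)])
    have "dg_rep A (trunc_ideal n A) x y (i - 1) (dif A x y i v) = \<zero>\<^bsub>HomD (tau_le n A) x y (i - 1)\<^esub>"
      using u P.dif[OF xy v(1)] v(2) by (simp add: cycles_def)
    then have "dif A x y i v \<in> trunc_ideal n A x y (i - 1)"
      using N.coset_rep_zero_iff[OF dv] by (simp add: dg_rep_def)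
    \<comment> \<open>Since \<open>i - 1 < n\<close>, the ideal is zero in that degree, so the lift
      \<open>v\<close> of the cycle \<open>u\<close> is itself a cycle.\<close>
    then have "v \<in> cycles (Hom A x y) i"
      using v(1) \<open>i \<le> int n\<close> by (simp add: trunc_ideal_def cycles_def)
    then show "\<exists>f\<in>cycles (Hom A x y) i. hclass (Hom (tau_le n A) x y) i (onHom (tau_le_proj n A) x y i f) =
        hclass (Hom (tau_le n A) x y) i u"
      using v(2) by (intro bexI[of _ v]) simp_all
  qed
qed

end

section \<open>Comparison of Postnikov towers\<close>

lemma (in dg_category) isomorphism_in_H0_refl:
  assumes "x \<in> Obj A"
  shows "\<exists>e. isomorphism_in (H0_cat A) x x e"
proof -
  interpret H: small_category "H0_cat A" by (rule small_category_H0)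
  have x: "x \<in> obs (H0_cat A)" using assms by simp
  show ?thesis
    unfolding isomorphism_in_def using H.idt_closed[OF x] H.cmp_idt_left[OF x x H.idt_closed[OF x]]
    by blast
qed

lemma (in dg_hom) quasi_equivalenceI:
  assumes "\<And>x y i. x \<in> Obj A \<Longrightarrow> y \<in> Obj A \<Longrightarrow>
      homology_iso_at R (Hom A x y) (Hom B (onObj F x) (onObj F y)) (onHom F x y) i"
    and "\<And>y. y \<in> Obj B \<Longrightarrow> \<exists>x\<in>Obj A. \<exists>e. isomorphism_in (H0_cat B) (onObj F x) y e"
  shows "quasi_equivalence R A B F"
  unfolding quasi_equivalence_def quasi_isomorphism_def
  using dg_functor complex_hom.chain_map[OF complex_hom] assms equivalence_H0I by blast

lemma homology_iso_at_id:
  assumes "chain_complex R C"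
  shows "homology_iso_at R C C (\<lambda>i x. x) i"
proof -
  interpret C: chain_complex R C by fact
  interpret complex_hom R C C "\<lambda>i x. x"
    by (intro complex_hom.intro complex_hom_axioms.intro assms) (simp add: chain_map_def mod_hom_def)
  show ?thesis by (rule homology_iso_atI) auto
qed

text \<open>Axiom (B) is left out so that the constant tower on \<open>B\<close> is an instance.\<close>

locale truncation_system =
  fixes R :: "('r, 's) ring_scheme" and B :: "('o, 'r, 'm) dgcat" and T :: "('o, 'r, 'm) tower"
  assumes posB: "positively_graded B"
    and level_pos: "\<And>n. positively_graded (level T n)"
    and dg_hom_tmap: "\<And>n. dg_hom R (level T (Suc n)) (level T n) (tmap T n)"
    and dg_hom_tproj: "\<And>n. dg_hom R B (level T n) (tproj T n)"
    and tmap_tproj: "\<And>n. dgfun_eq B (dg_compose (tmap T n) (tproj T (Suc n))) (tproj T n)"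
    and iso_tproj: "\<And>n x y i. x \<in> Obj B \<Longrightarrow> y \<in> Obj B \<Longrightarrow> i \<le> int n \<Longrightarrow>
      homology_iso_at R (Hom B x y)
        (Hom (level T n) (onObj (tproj T n) x) (onObj (tproj T n) y)) (onHom (tproj T n) x y) i"
    and surj_tproj: "\<And>n y. y \<in> Obj (level T n) \<Longrightarrow>
      \<exists>x\<in>Obj B. \<exists>e. isomorphism_in (H0_cat (level T n)) (onObj (tproj T n) x) y e"

section \<open>Truncated towers and the comparison with the canonical tower\<close>

definition tower_tau_le :: "('o, 'r, 'm) tower \<Rightarrow> ('o, 'r, 'm) tower"
  where "tower_tau_le T =
    \<lparr>level = (\<lambda>n. tau_le n (level T n)),
     tmap = (\<lambda>n. dg_compose (tau_le_proj n (level T n)) (tmap T n)),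
     tproj = (\<lambda>n. dg_compose (tau_le_proj n (level T n)) (tproj T n))\<rparr>"

text \<open>The functors are kept unchanged: morphisms of the truncation are morphisms of the level,
  and \<open>dg_hom_tmap_ge0\<close> and \<open>dg_hom_tproj_ge0\<close> show that the functors
  restrict.\<close>

definition tower_tau_ge0 :: "('o, 'r, 'm) tower \<Rightarrow> ('o, 'r, 'm) tower"
  where "tower_tau_ge0 T = T\<lparr>level := (\<lambda>n. tau_ge0 (level T n))\<rparr>"

text \<open>Auxiliary: \<open>tower_tau_le (const_tower B)\<close> is the canonical tower of
  truncations of \<open>B\<close>, so that it is a Postnikov tower by the general result on
  \<open>tower_tau_le\<close>.\<close>

definition const_tower :: "('o, 'r, 'm) dgcat \<Rightarrow> ('o, 'r, 'm) tower"
  where "const_tower B = \<lparr>level = (\<lambda>n. B), tmap = (\<lambda>n. dg_id), tproj = (\<lambda>n. dg_id)\<rparr>"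

context truncation_system
begin

lemma dg_category_B: "dg_category R B"
  and dg_category_level: "dg_category R (level T n)"
  using dg_hom_tproj[of n] by (simp_all add: dg_hom_def)

lemma tmap_tproj_simps:
  "x \<in> Obj B \<Longrightarrow> onObj (tmap T n) (onObj (tproj T (Suc n)) x) = onObj (tproj T n) x"
  "x \<in> Obj B \<Longrightarrow> y \<in> Obj B \<Longrightarrow> f \<in> carrier (HomD B x y i) \<Longrightarrow>
    onHom (tmap T n) (onObj (tproj T (Suc n)) x) (onObj (tproj T (Suc n)) y) i
      (onHom (tproj T (Suc n)) x y i f) = onHom (tproj T n) x y i f"
  using tmap_tproj[of n] by (simp_all add: dgfun_eq_def dg_compose_def)

lemma dg_ideal_level: "dg_ideal R (level T n) (trunc_ideal m (level T n))"
  by (rule dg_ideal_trunc[OF dg_category_level level_pos])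

lemma dg_ideal_B: "dg_ideal R B (trunc_ideal m B)"
  by (rule dg_ideal_trunc[OF dg_category_B posB])

lemma dg_hom_proj: "dg_hom R (level T n) (tau_le n (level T n)) (tau_le_proj n (level T n))"
  by (rule dg_hom_tau_le_proj[OF dg_category_level level_pos])

lemma dg_hom_tproj_le:
  "dg_hom R B (tau_le n (level T n)) (dg_compose (tau_le_proj n (level T n)) (tproj T n))"
  by (rule dg_hom_compose[OF dg_hom_tproj dg_hom_proj])

lemma dg_hom_tmap_le:
  "dg_hom R (tau_le (Suc n) (level T (Suc n))) (tau_le n (level T n))
    (dg_compose (tau_le_proj n (level T n)) (tmap T n))"
  by (rule dg_ideal.dg_hom_induced[OF dg_ideal_level dg_hom_tmap dg_ideal_level])
    (rule trunc_ideal_hom[OF dg_hom_tmap], simp_all)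

text \<open>This is \<open>induced_rep\<close> for the tower map, in the shape that appears once
  functors are unfolded: the square between the projections of levels \<open>n + 1\<close> and
  \<open>n\<close>.\<close>

lemma tmap_le_rep:
  assumes "x \<in> Obj (level T (Suc n))" "y \<in> Obj (level T (Suc n))" "f \<in> carrier (HomD (level T (Suc n)) x y i)"
  shows "dg_rep (level T n) (trunc_ideal n (level T n)) (onObj (tmap T n) x) (onObj (tmap T n) y) i
      (onHom (tmap T n) x y i (dg_rep (level T (Suc n)) (trunc_ideal (Suc n) (level T (Suc n))) x y i f)) =
    dg_rep (level T n) (trunc_ideal n (level T n)) (onObj (tmap T n) x) (onObj (tmap T n) y) i
      (onHom (tmap T n) x y i f)"
proof -
  have "onHom (dg_compose (tau_le_proj n (level T n)) (tmap T n)) x y i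
      (dg_rep (level T (Suc n)) (trunc_ideal (Suc n) (level T (Suc n))) x y i f) =
    onHom (dg_compose (tau_le_proj n (level T n)) (tmap T n)) x y i f"
    by (rule dg_ideal.induced_rep[OF dg_ideal_level dg_hom_tmap dg_ideal_level trunc_ideal_hom[OF dg_hom_tmap]])
      (use assms in simp_all)
  then show ?thesis by (simp add: dg_compose_def)
qed

text \<open>The triangle of the truncated tower on morphisms: \<open>tmap_le_rep\<close> removes the
  inner projection, then the triangle of \<open>T\<close> applies.\<close>

lemma tmap_tproj_le_rep:
  assumes "x \<in> Obj B" "y \<in> Obj B" "f \<in> carrier (HomD B x y i)"
  shows "dg_rep (level T n) (trunc_ideal n (level T n)) (onObj (tproj T n) x) (onObj (tproj T n) y) i
      (onHom (tmap T n) (onObj (tproj T (Suc n)) x) (onObj (tproj T (Suc n)) y) i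
        (dg_rep (level T (Suc n)) (trunc_ideal (Suc n) (level T (Suc n)))
          (onObj (tproj T (Suc n)) x) (onObj (tproj T (Suc n)) y) i (onHom (tproj T (Suc n)) x y i f))) =
    dg_rep (level T n) (trunc_ideal n (level T n)) (onObj (tproj T n) x) (onObj (tproj T n) y) i
      (onHom (tproj T n) x y i f)"
  using tmap_le_rep[OF dg_hom.obj[OF dg_hom_tproj assms(1)] dg_hom.obj[OF dg_hom_tproj assms(2)]
      dg_hom.closed[OF dg_hom_tproj assms]]
  by (simp add: tmap_tproj_simps assms)

text \<open>Passing first to the representative in \<open>tau_le n B\<close> makes no difference,
  because \<open>tproj\<close> maps the ideal of \<open>B\<close> into that of the level.\<close>

lemma tproj_le_rep:
  assumes "x \<in> Obj B" "y \<in> Obj B" "f \<in> carrier (HomD B x y i)"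
  shows "dg_rep (level T n) (trunc_ideal n (level T n)) (onObj (tproj T n) x) (onObj (tproj T n) y) i
      (onHom (tproj T n) x y i (dg_rep B (trunc_ideal n B) x y i f)) =
    dg_rep (level T n) (trunc_ideal n (level T n)) (onObj (tproj T n) x) (onObj (tproj T n) y) i
      (onHom (tproj T n) x y i f)"
proof -
  have "onHom (dg_compose (tau_le_proj n (level T n)) (tproj T n)) x y i (dg_rep B (trunc_ideal n B) x y i f) =
    onHom (dg_compose (tau_le_proj n (level T n)) (tproj T n)) x y i f"
    by (rule dg_ideal.induced_rep[OF dg_ideal_B dg_hom_tproj dg_ideal_level trunc_ideal_hom[OF dg_hom_tproj]])
      (use assms in simp_all)
  then show ?thesis by (simp add: dg_compose_def)
qed

lemma dg_hom_comparison:
  "dg_hom R (tau_le n B) (tau_le n (level T n)) (dg_compose (tau_le_proj n (level T n)) (tproj T n))"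
  by (rule dg_ideal.dg_hom_induced[OF dg_ideal_B dg_hom_tproj dg_ideal_level])
    (rule trunc_ideal_hom[OF dg_hom_tproj], simp_all)

lemma iso_tproj_le:
  assumes xy: "x \<in> Obj B" "y \<in> Obj B" and "i \<le> int n"
  shows "homology_iso_at R (Hom B x y)
    (Hom (tau_le n (level T n)) (onObj (tproj T n) x) (onObj (tproj T n) y))
    (onHom (dg_compose (tau_le_proj n (level T n)) (tproj T n)) x y) i"
proof -
  interpret P: dg_hom R B "level T n" "tproj T n" by (rule dg_hom_tproj)
  interpret Q: dg_hom R "level T n" "tau_le n (level T n)" "tau_le_proj n (level T n)" by (rule dg_hom_proj)
  note obj = P.obj[OF xy(1)] P.obj[OF xy(2)]
  show ?thesis
    using homology_iso_at_compose[OF P.complex_hom[OF xy] Q.complex_hom[OF obj] iso_tproj[OF assms]]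
      homology_iso_tau_le_proj[OF dg_category_level level_pos obj assms(3)]
    by (simp add: dg_compose_def)
qed

lemma surj_tproj_le:
  assumes "y \<in> Obj (tau_le n (level T n))"
  shows "\<exists>x\<in>Obj B. \<exists>e. isomorphism_in (H0_cat (tau_le n (level T n))) (onObj (tproj T n) x) y e"
proof -
  interpret P: dg_hom R B "level T n" "tproj T n" by (rule dg_hom_tproj)
  interpret Q: dg_hom R "level T n" "tau_le n (level T n)" "tau_le_proj n (level T n)" by (rule dg_hom_proj)
  have y: "y \<in> Obj (level T n)" using assms by simp
  obtain x e where x: "x \<in> Obj B" and e: "isomorphism_in (H0_cat (level T n)) (onObj (tproj T n) x) y e"
    using surj_tproj[OF y] by blast
  show ?thesis using Q.isomorphism_H0[OF P.obj[OF x] y e] x by auto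
qed

lemma postnikov_tower_tau_le: "postnikov_tower R B (tower_tau_le T)"
  unfolding postnikov_tower_def
proof (intro conjI allI ballI impI)
  fix n
  interpret P: dg_hom R B "tau_le n (level T n)" "dg_compose (tau_le_proj n (level T n)) (tproj T n)"
    by (rule dg_hom_tproj_le)
  show "dg_category R (level (tower_tau_le T) n)"
    using P.B.dg_category_axioms by (simp add: tower_tau_le_def)
  show "dg_functor R (level (tower_tau_le T) (Suc n)) (level (tower_tau_le T) n) (tmap (tower_tau_le T) n)"
    using dg_hom.dg_functor[OF dg_hom_tmap_le] by (simp add: tower_tau_le_def)
  show "dg_functor R B (level (tower_tau_le T) n) (tproj (tower_tau_le T) n)"
    using P.dg_functor by (simp add: tower_tau_le_def)
  \<comment> \<open>Degree 0 always lies in the range \<open>i \<le> n\<close>, which gives full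
    faithfulness on homotopy categories.\<close>
  show "equivalence_of_categories (H0_cat B) (H0_cat (level (tower_tau_le T) n))
      (H0_functor (level (tower_tau_le T) n) (tproj (tower_tau_le T) n))"
    using P.equivalence_H0I iso_tproj_le[of _ _ 0 n] surj_tproj_le[of _ n]
    by (simp add: tower_tau_le_def dg_compose_def)
  show "dgfun_eq B (dg_compose (tmap (tower_tau_le T) n) (tproj (tower_tau_le T) (Suc n))) (tproj (tower_tau_le T) n)"
    by (simp add: dgfun_eq_def tower_tau_le_def dg_compose_def tmap_tproj_simps(1) tmap_tproj_le_rep)
  show "homology_iso_at R (Hom B x y)
      (Hom (level (tower_tau_le T) n) (onObj (tproj (tower_tau_le T) n) x) (onObj (tproj (tower_tau_le T) n) y))
      (onHom (tproj (tower_tau_le T) n) x y) i"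
    if "x \<in> Obj B" "y \<in> Obj B" "i \<le> int n" for x y i
    using iso_tproj_le[OF that] by (simp add: tower_tau_le_def dg_compose_def)
  show "homology_zero (Hom (level (tower_tau_le T) n) x y) i"
    if "x \<in> Obj (level (tower_tau_le T) n)" "y \<in> Obj (level (tower_tau_le T) n)" "int n < i" for x y i
    using homology_tau_le_zero[OF dg_category_level level_pos] that by (simp add: tower_tau_le_def)
qed

lemma tower_morphism_proj:
  "tower_morphism R B T (tower_tau_le T) (\<lambda>n. tau_le_proj n (level T n))"
  unfolding tower_morphism_def
proof (intro conjI allI)
  fix n
  show "dg_functor R (level T n) (level (tower_tau_le T) n) (tau_le_proj n (level T n))"
    using dg_hom.dg_functor[OF dg_hom_proj] by (simp add: tower_tau_le_def)
  show "dgfun_eq (level T (Suc n)) (dg_compose (tau_le_proj n (level T n)) (tmap T n))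
      (dg_compose (tmap (tower_tau_le T) n) (tau_le_proj (Suc n) (level T (Suc n))))"
    by (simp add: dgfun_eq_def tower_tau_le_def dg_compose_def tmap_le_rep)
  show "dgfun_eq B (dg_compose (tau_le_proj n (level T n)) (tproj T n)) (tproj (tower_tau_le T) n)"
    by (simp add: dgfun_eq_def tower_tau_le_def)
qed

text \<open>Homology in degrees up to \<open>n\<close> is unaffected by the truncation. Above
  \<open>n\<close> both sides vanish, the source by \<open>van\<close>, which for a tower is axiom
  (B). On objects the functor is the identity.\<close>

lemma quasi_equivalence_proj:
  assumes van: "\<And>x y i. x \<in> Obj (level T n) \<Longrightarrow> y \<in> Obj (level T n) \<Longrightarrow> i > int n \<Longrightarrow>
    homology_zero (Hom (level T n) x y) i"
  shows "quasi_equivalence R (level T n) (tau_le n (level T n)) (tau_le_proj n (level T n))"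
proof -
  interpret Q: dg_hom R "level T n" "tau_le n (level T n)" "tau_le_proj n (level T n)" by (rule dg_hom_proj)
  show ?thesis
  proof (rule Q.quasi_equivalenceI)
    fix x y i assume xy: "x \<in> Obj (level T n)" "y \<in> Obj (level T n)"
    show "homology_iso_at R (Hom (level T n) x y)
      (Hom (tau_le n (level T n)) (onObj (tau_le_proj n (level T n)) x) (onObj (tau_le_proj n (level T n)) y))
      (onHom (tau_le_proj n (level T n)) x y) i"
    proof (cases "i \<le> int n")
      case True
      then show ?thesis
        using homology_iso_tau_le_proj[OF dg_category_level level_pos xy] by simp
    next
      case False
      then show ?thesis
        using homology_tau_le_zero[OF dg_category_level level_pos xy] van[OF xy]
        by (intro complex_hom.homology_iso_at_trivial[OF Q.complex_hom[OF xy]]) simp_all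
    qed
  next
    fix y assume "y \<in> Obj (tau_le n (level T n))"
    then show "\<exists>x\<in>Obj (level T n). \<exists>e. isomorphism_in (H0_cat (tau_le n (level T n))) (onObj (tau_le_proj n (level T n)) x) y e"
      using Q.B.isomorphism_in_H0_refl[of y] by (intro bexI[of _ y]) simp_all
  qed
qed

lemma tower_morphism_comparison:
  "tower_morphism R B (tower_tau_le (const_tower B)) (tower_tau_le T)
    (\<lambda>n. dg_compose (tau_le_proj n (level T n)) (tproj T n))"
  unfolding tower_morphism_def
proof (intro conjI allI)
  fix n
  show "dg_functor R (level (tower_tau_le (const_tower B)) n) (level (tower_tau_le T) n)
      (dg_compose (tau_le_proj n (level T n)) (tproj T n))"
    using dg_hom.dg_functor[OF dg_hom_comparison] by (simp add: tower_tau_le_def const_tower_def)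
  \<comment> \<open>A morphism of the quotient is itself a morphism of \<open>B\<close>, namely a
    chosen representative, so the lemmas on morphisms of \<open>B\<close> apply to it.\<close>
  have cl: "f \<in> carrier (HomD B x y i)"
    if xy: "x \<in> Obj B" "y \<in> Obj B" and f: "f \<in> carrier (HomD (tau_le (Suc n) B) x y i)" for x y i f
  proof -
    obtain v where v: "v \<in> carrier (HomD B x y i)" "f = coset_rep (HomD B x y i) (trunc_ideal (Suc n) B x y i) v"
      using f unfolding dg_quotient_simps by (elim imageE)
    show ?thesis
      using dg_ideal.dg_rep_closed[OF dg_ideal_B xy v(1), of "Suc n"] v(2) by (simp add: dg_rep_def)
  qed
  show "dgfun_eq (level (tower_tau_le (const_tower B)) (Suc n))
      (dg_compose (dg_compose (tau_le_proj n (level T n)) (tproj T n)) (tmap (tower_tau_le (const_tower B)) n))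
      (dg_compose (tmap (tower_tau_le T) n) (dg_compose (tau_le_proj (Suc n) (level T (Suc n))) (tproj T (Suc n))))"
    unfolding dgfun_eq_def
  proof (intro conjI ballI allI)
    fix x y i f
    assume "x \<in> Obj (level (tower_tau_le (const_tower B)) (Suc n))" "y \<in> Obj (level (tower_tau_le (const_tower B)) (Suc n))"
      "f \<in> carrier (HomD (level (tower_tau_le (const_tower B)) (Suc n)) x y i)"
    then have xy: "x \<in> Obj B" "y \<in> Obj B" and f: "f \<in> carrier (HomD B x y i)"
      using cl by (simp_all add: tower_tau_le_def const_tower_def)
    \<comment> \<open>Both sides reduce to the representative of
      \<open>onHom (tproj T n) x y i f\<close> in \<open>tau_le n (level T n)\<close>.\<close>
    show "onHom (dg_compose (dg_compose (tau_le_proj n (level T n)) (tproj T n)) (tmap (tower_tau_le (const_tower B)) n)) x y i f =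
      onHom (dg_compose (tmap (tower_tau_le T) n) (dg_compose (tau_le_proj (Suc n) (level T (Suc n))) (tproj T (Suc n)))) x y i f"
      using tproj_le_rep[OF xy f] tmap_tproj_le_rep[OF xy f]
      by (simp add: tower_tau_le_def const_tower_def dg_compose_def dg_id_def tmap_tproj_simps(1) xy)
  qed (simp add: tower_tau_le_def const_tower_def dg_compose_def dg_id_def tmap_tproj_simps)
  show "dgfun_eq B (dg_compose (dg_compose (tau_le_proj n (level T n)) (tproj T n)) (tproj (tower_tau_le (const_tower B)) n))
      (tproj (tower_tau_le T) n)"
    by (simp add: dgfun_eq_def tower_tau_le_def const_tower_def dg_compose_def dg_id_def tproj_le_rep)
qed

text \<open>In degrees at most \<open>n\<close> the projection of \<open>B\<close> is cancelled:
  followed by the comparison functor it gives the map treated in \<open>iso_tproj_le\<close>. Above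
  \<open>n\<close> neither truncation has homology.\<close>

lemma quasi_equivalence_comparison:
  "quasi_equivalence R (tau_le n B) (tau_le n (level T n)) (dg_compose (tau_le_proj n (level T n)) (tproj T n))"
proof -
  let ?M = "dg_compose (tau_le_proj n (level T n)) (tproj T n)"
  interpret M: dg_hom R "tau_le n B" "tau_le n (level T n)" ?M by (rule dg_hom_comparison)
  interpret P: dg_hom R B "tau_le n B" "tau_le_proj n B" by (rule dg_hom_tau_le_proj[OF dg_category_B posB])
  interpret N: dg_hom R B "tau_le n (level T n)" ?M by (rule dg_hom_tproj_le)
  interpret Q: dg_hom R B "level T n" "tproj T n" by (rule dg_hom_tproj)
  have M_obj: "onObj ?M = onObj (tproj T n)" by (simp add: dg_compose_def)
  show ?thesis
  proof (rule M.quasi_equivalenceI)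
    fix x y i assume "x \<in> Obj (tau_le n B)" "y \<in> Obj (tau_le n B)"
    then have xy: "x \<in> Obj B" "y \<in> Obj B" and xy': "x \<in> Obj (tau_le n B)" "y \<in> Obj (tau_le n B)" by simp_all
    show "homology_iso_at R (Hom (tau_le n B) x y) (Hom (tau_le n (level T n)) (onObj ?M x) (onObj ?M y)) (onHom ?M x y) i"
    proof (cases "i \<le> int n")
      case True
      have Pc: "complex_hom R (Hom B x y) (Hom (tau_le n B) x y) (onHom (tau_le_proj n B) x y)"
        using P.complex_hom[OF xy] by simp
      have "homology_iso_at R (Hom B x y) (Hom (tau_le n (level T n)) (onObj ?M x) (onObj ?M y)) (onHom ?M x y) i"
        using iso_tproj_le[OF xy True] by (simp add: M_obj)
      \<comment> \<open>\<open>?M\<close> and its composite with the projection of \<open>B\<close>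
        are known to agree only on morphisms of \<open>B\<close>, by \<open>tproj_le_rep\<close>;
        hence the passage through \<open>homology_iso_at_cong\<close>.\<close>
      then have "homology_iso_at R (Hom B x y) (Hom (tau_le n (level T n)) (onObj ?M x) (onObj ?M y))
          (\<lambda>i f. onHom ?M x y i (onHom (tau_le_proj n B) x y i f)) i"
        using tproj_le_rep[OF xy]
        by (subst (asm) homology_iso_at_cong[OF N.complex_hom[OF xy]]) (auto simp: dg_compose_def)
      then show ?thesis
        using homology_iso_at_compose[OF Pc M.complex_hom[OF xy'] homology_iso_tau_le_proj[OF dg_category_B posB xy True]]
        by blast
    next
      case False
      then show ?thesis
        using homology_tau_le_zero[OF dg_category_B posB xy]
          homology_tau_le_zero[OF dg_category_level level_pos Q.obj[OF xy(1)] Q.obj[OF xy(2)]]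
        by (intro complex_hom.homology_iso_at_trivial[OF M.complex_hom[OF xy']]) (simp_all add: M_obj)
    qed
  next
    fix y assume "y \<in> Obj (tau_le n (level T n))"
    then show "\<exists>x\<in>Obj (tau_le n B). \<exists>e. isomorphism_in (H0_cat (tau_le n (level T n))) (onObj ?M x) y e"
      using surj_tproj_le by (simp add: M_obj)
  qed
qed

end

lemma truncation_system_const:
  assumes "dg_category R B" "positively_graded B"
  shows "truncation_system R B (const_tower B)"
proof -
  interpret B: dg_category R B by fact
  have "dg_hom R B B dg_id"
    by (intro dg_hom.intro dg_hom_axioms.intro assms(1))
      (simp add: dg_functor_def dg_id_def chain_map_def mod_hom_def)
  then show ?thesis
  proof (intro truncation_system.intro, simp_all add: const_tower_def assms(2))
    show "dgfun_eq B dg_id dg_id" by (simp add: dgfun_eq_def)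
    show "homology_iso_at R (Hom B x y) (Hom B (onObj dg_id x) (onObj dg_id y)) (onHom dg_id x y) i"
      if "x \<in> Obj B" "y \<in> Obj B" for x y i
      using homology_iso_at_id[OF B.Hom_complex[OF that]] by (simp add: dg_id_def)
    show "\<exists>x\<in>Obj B. \<exists>e. isomorphism_in (H0_cat B) (onObj dg_id x) y e" if "y \<in> Obj B" for y
      using that B.isomorphism_in_H0_refl[OF that] by (intro bexI[of _ y]) (simp_all add: dg_id_def)
  qed
qed

section \<open>Connectivity of the levels of a tower and their positive truncations\<close>

locale postnikov =
  fixes R :: "('r, 's) ring_scheme" and B :: "('o, 'r, 'm) dgcat" and T :: "('o, 'r, 'm) tower"
  assumes dg_category_B: "dg_category R B" and posB: "positively_graded B"
    and tower: "postnikov_tower R B T"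
begin

lemma dg_category_level: "dg_category R (level T n)"
  using tower by (simp add: postnikov_tower_def)

lemma dg_hom_tmap: "dg_hom R (level T (Suc n)) (level T n) (tmap T n)"
  using tower
  by (intro dg_hom.intro dg_hom_axioms.intro dg_category_level) (simp add: postnikov_tower_def)

lemma dg_hom_tproj: "dg_hom R B (level T n) (tproj T n)"
  using tower
  by (intro dg_hom.intro dg_hom_axioms.intro dg_category_B dg_category_level) (simp add: postnikov_tower_def)

lemma iso_tproj:
  "x \<in> Obj B \<Longrightarrow> y \<in> Obj B \<Longrightarrow> i \<le> int n \<Longrightarrow>
    homology_iso_at R (Hom B x y)
      (Hom (level T n) (onObj (tproj T n) x) (onObj (tproj T n) y)) (onHom (tproj T n) x y) i"
  using tower by (simp add: postnikov_tower_def)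

lemma surj_tproj:
  "y \<in> Obj (level T n) \<Longrightarrow> \<exists>x\<in>Obj B. \<exists>e. isomorphism_in (H0_cat (level T n)) (onObj (tproj T n) x) y e"
  using tower equivalence_essentially_surjective[of "H0_cat B" "H0_cat (level T n)" "H0_functor (level T n) (tproj T n)" y]
  by (simp add: postnikov_tower_def H0_functor_def H0_cat_def)

lemma level_homology_zero_above:
  "x \<in> Obj (level T n) \<Longrightarrow> y \<in> Obj (level T n) \<Longrightarrow> i > int n \<Longrightarrow> homology_zero (Hom (level T n) x y) i"
  using tower by (simp add: postnikov_tower_def)

lemma level_homology_zero_below:
  assumes "x \<in> Obj (level T n)" "y \<in> Obj (level T n)" "i < 0"
  shows "homology_zero (Hom (level T n) x y) i"
proof -
  interpret P: dg_hom R B "level T n" "tproj T n" by (rule dg_hom_tproj)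
  obtain x' a where x': "x' \<in> Obj B" "isomorphism_in (H0_cat (level T n)) (onObj (tproj T n) x') x a"
    using surj_tproj[OF assms(1)] by blast
  obtain y' b where y': "y' \<in> Obj B" "isomorphism_in (H0_cat (level T n)) (onObj (tproj T n) y') y b"
    using surj_tproj[OF assms(2)] by blast
  \<comment> \<open>As \<open>i < 0 \<le> n\<close>, axiom (A1) covers negative degrees, where
    \<open>B\<close> has only zero chains; this yields vanishing between objects coming from
    \<open>B\<close>.\<close>
  have "homology_zero (Hom (level T n) (onObj (tproj T n) x') (onObj (tproj T n) y')) i"
    using complex_hom.homology_zero_iso[OF P.complex_hom[OF x'(1) y'(1)] iso_tproj[OF x'(1) y'(1)]]
      positively_graded_homology_zero[OF dg_category_B posB x'(1) y'(1) assms(3)] assms(3) by simp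
  then show ?thesis
    using P.B.homology_zero_transport[OF assms(1,2) P.obj[OF x'(1)] P.obj[OF y'(1)] x'(2) y'(2)] by blast
qed

lemma dg_hom_inclusion: "dg_hom R (tau_ge0 (level T n)) (level T n) dg_id"
  by (rule dg_category.dg_hom_tau_inclusion[OF dg_category_level])

text \<open>Precompose with the inclusion, whose source is positively graded, and corestrict by
  \<open>dg_hom_to_tau\<close>. As the inclusion is \<open>dg_id\<close>, the functor is still
  \<open>tmap T n\<close>.\<close>

lemma dg_hom_tmap_ge0: "dg_hom R (tau_ge0 (level T (Suc n))) (tau_ge0 (level T n)) (tmap T n)"
  using dg_hom_to_tau[OF dg_hom_compose[OF dg_hom_inclusion dg_hom_tmap] positively_graded_tau_ge0] by simp

lemma dg_hom_tproj_ge0: "dg_hom R B (tau_ge0 (level T n)) (tproj T n)"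
  by (rule dg_hom_to_tau[OF dg_hom_tproj posB])

lemma iso_tproj_ge0:
  assumes "x \<in> Obj B" "y \<in> Obj B" "i \<le> int n"
  shows "homology_iso_at R (Hom B x y)
      (Hom (tau_ge0 (level T n)) (onObj (tproj T n) x) (onObj (tproj T n) y)) (onHom (tproj T n) x y) i"
proof (cases "i \<ge> 0")
  case True
  then show ?thesis using iso_tproj[OF assms] by (simp add: homology_iso_at_good_truncation)
next
  \<comment> \<open>In negative degrees both \<open>B\<close> and the truncated level are zero
    already on chains.\<close>
  case False
  interpret P: dg_hom R B "tau_ge0 (level T n)" "tproj T n" by (rule dg_hom_tproj_ge0)
  have pos: "positively_graded (tau_ge0 (level T n))" by (rule positively_graded_tau_ge0)
  show ?thesis
  proof (rule complex_hom.homology_iso_at_trivial[OF P.complex_hom[OF assms(1,2)]])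
    show "homology_zero (Hom B x y) i"
      using positively_graded_homology_zero[OF dg_category_B posB assms(1,2)] False by simp
    show "homology_zero (Hom (tau_ge0 (level T n)) (onObj (tproj T n) x) (onObj (tproj T n) y)) i"
      using positively_graded_homology_zero[OF P.B.dg_category_axioms pos P.obj[OF assms(1)] P.obj[OF assms(2)]] False
      by simp
  qed
qed

text \<open>Axiom (A2) survives verbatim since the homotopy categories are equal, and (B) because it
  concerns degrees \<open>i > n \<ge> 0\<close>, where truncation leaves homology unchanged.\<close>

lemma postnikov_tower_tau_ge0: "postnikov_tower R B (tower_tau_ge0 T)"
  using tower dg_hom.dg_functor[OF dg_hom_tmap_ge0] dg_hom.dg_functor[OF dg_hom_tproj_ge0] iso_tproj_ge0
    dg_category.dg_category_tau[OF dg_category_level]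
  by (simp add: postnikov_tower_def tower_tau_ge0_def H0_cat_tau_ge0 H0_functor_tau_ge0
      homology_zero_good_truncation)

lemma truncation_system_tau_ge0: "truncation_system R B (tower_tau_ge0 T)"
  using posB dg_hom_tmap_ge0 dg_hom_tproj_ge0 iso_tproj_ge0 surj_tproj tower
  by (intro truncation_system.intro)
    (simp_all add: tower_tau_ge0_def positively_graded_tau_ge0 H0_cat_tau_ge0 postnikov_tower_def)

lemma tower_morphism_inclusion: "tower_morphism R B (tower_tau_ge0 T) T (\<lambda>n. dg_id)"
  using dg_hom.dg_functor[OF dg_hom_inclusion]
  by (simp add: tower_morphism_def tower_tau_ge0_def dgfun_eq_def)

text \<open>In degrees \<open>i \<ge> 0\<close> the inclusion is the identity on homology; in
  negative degrees the level has none by \<open>level_homology_zero_below\<close>.\<close>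

lemma quasi_equivalence_inclusion: "quasi_equivalence R (tau_ge0 (level T n)) (level T n) dg_id"
proof -
  interpret X: dg_category R "level T n" by (rule dg_category_level)
  interpret P: dg_hom R "tau_ge0 (level T n)" "level T n" dg_id by (rule dg_hom_inclusion)
  let ?I = "dg_id :: ('o, 'm, 'o, 'm) dgfun"
  show ?thesis
  proof (rule P.quasi_equivalenceI)
    fix x y i assume xy: "x \<in> Obj (tau_ge0 (level T n))" "y \<in> Obj (tau_ge0 (level T n))"
    show "homology_iso_at R (Hom (tau_ge0 (level T n)) x y) (Hom (level T n) (onObj ?I x) (onObj ?I y)) (onHom ?I x y) i"
    proof (cases "i \<ge> 0")
      case True
      then show ?thesis
        using homology_iso_at_id[OF X.Hom_complex] xy
        by (simp add: homology_iso_at_good_truncation dg_id_def)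
    next
      case False
      show ?thesis
      proof (rule complex_hom.homology_iso_at_trivial[OF P.complex_hom[OF xy]])
        show "homology_zero (Hom (tau_ge0 (level T n)) x y) i"
          using positively_graded_homology_zero[OF P.A.dg_category_axioms positively_graded_tau_ge0 xy] False by simp
        show "homology_zero (Hom (level T n) (onObj ?I x) (onObj ?I y)) i"
          using level_homology_zero_below xy False by (simp add: dg_id_def)
      qed
    qed
  next
    fix y assume "y \<in> Obj (level T n)"
    then show "\<exists>x\<in>Obj (tau_ge0 (level T n)). \<exists>e. isomorphism_in (H0_cat (level T n)) (onObj ?I x) y e"
      using X.isomorphism_in_H0_refl[of y] by (intro bexI[of _ y]) (simp_all add: dg_id_def)
  qed
qed

end

section \<open>Assembly of the zig-zag\<close>

lemma Post_zigzagI: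
  assumes "postnikov_tower R (tau_ge0 A) S" "postnikov_tower R (tau_ge0 A) T"
    and "tower_morphism R (tau_ge0 A) S T M" "\<And>n. quasi_equivalence R (level S n) (level T n) (M n)"
  shows "Post_zigzag R A S T"
proof -
  have "M \<in> Post_weq R A S T"
    using assms by (simp add: Post_weq_def Post_hom_def Post_def)
  then show ?thesis unfolding Post_zigzag_def by (intro r_into_equivclp) blast
qed

lemma Post_zigzag_canonical:
  assumes A: "dg_category R A" and T: "T \<in> Post R A"
  shows "Post_zigzag R A (tower_tau_le (const_tower (tau_ge0 A))) T"
proof -
  interpret A: dg_category R A by fact
  interpret T: postnikov R "tau_ge0 A" T
    using T by (intro postnikov.intro A.dg_category_tau positively_graded_tau_ge0) (simp add: Post_def)
  interpret K: truncation_system R "tau_ge0 A" "const_tower (tau_ge0 A)"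
    by (rule truncation_system_const[OF A.dg_category_tau positively_graded_tau_ge0])
  let ?T1 = "tower_tau_ge0 T" and ?T2 = "tower_tau_le (tower_tau_ge0 T)"
  interpret S: truncation_system R "tau_ge0 A" ?T1 by (rule T.truncation_system_tau_ge0)
  have lev: "level (tower_tau_le (const_tower (tau_ge0 A))) n = tau_le n (tau_ge0 A)"
    "level ?T1 n = tau_ge0 (level T n)" "level ?T2 n = tau_le n (tau_ge0 (level T n))" for n
    by (simp_all add: tower_tau_le_def tower_tau_ge0_def const_tower_def)
  have "Post_zigzag R A (tower_tau_le (const_tower (tau_ge0 A))) ?T2"
    using S.quasi_equivalence_comparison
    by (intro Post_zigzagI[OF K.postnikov_tower_tau_le S.postnikov_tower_tau_le S.tower_morphism_comparison])
      (simp add: lev)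
  moreover have "Post_zigzag R A ?T1 ?T2"
    using S.quasi_equivalence_proj T.level_homology_zero_above
    by (intro Post_zigzagI[OF T.postnikov_tower_tau_ge0 S.postnikov_tower_tau_le S.tower_morphism_proj])
      (simp add: lev homology_zero_good_truncation)
  moreover have "Post_zigzag R A ?T1 T"
    using T.quasi_equivalence_inclusion
    by (intro Post_zigzagI[OF T.postnikov_tower_tau_ge0 T.tower T.tower_morphism_inclusion])
      (simp add: lev)
  ultimately show ?thesis
    unfolding Post_zigzag_def by (meson equivclp_sym equivclp_trans)
qed

theorem theorem1p2:
  fixes R :: "('r, 's) ring_scheme"
    and A :: "('o, 'r, 'm) dgcat"
    and S T :: "('o, 'r, 'm) tower"
  assumes "cring R"
    and "dg_category R A"
    and "homologically_connective A"
    and "S \<in> Post R A"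
    and "T \<in> Post R A"
  shows "Post_zigzag R A S T"
  \<comment> \<open>The canonical tower depends on \<open>A\<close> alone, so the two zig-zags meet
    there.\<close>
  using Post_zigzag_canonical[OF assms(2,4)] Post_zigzag_canonical[OF assms(2,5)]
  unfolding Post_zigzag_def by (meson equivclp_sym equivclp_trans)

end
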